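(* Let $G\subset\mathbb{C}$ be a bounded simply-connected domain whose boundary $\Gamma=\partial G$ is a Jordan curve. Assume that $\Gamma$ is piecewise analytic without cusps and let $\omega\pi$, $0<\omega<2$, denote its smallest exterior angle. Then there is a constant $c_1(\Gamma)$, depending only on $\Gamma$, such that $$|b_n|\le c_1(\Gamma)\,\frac{1}{n^{1+\omega}},\qquad n\in\mathbb{N},$$ where $b_n$ is the coefficient of $1/w^n$ in the Laurent expansion at infinity of $\Psi$. Moreover, the order $1+\omega$ of $1/n$ is sharp in the sense that for certain $\omega\in(0,2)$ there exists a Jordan curve $\Gamma$ that is piecewise analytic without cusps, with smallest exterior angle $\omega\pi$, and a constant $c_2(\Gamma)>0$ such that $$|b_n|\ge c_2(\Gamma)\,\frac{1}{n^{1+\omega}}\quad\text{for infinitely many } n .$$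
   Context: $\mathbb{N}=\{1,2,\dots\}$. Let $\Omega=\overline{\mathbb{C}}\setminus\overline{G}$, $\Delta=\{w:|w|>1\}\cup\{\infty\}$, $\Phi:\Omega\to\Delta$ the conformal map with $\Phi(z)=\gamma z+\gamma_0+\gamma_1/z+\cdots$ near infinity, $\gamma>0$, and $\Psi=\Phi^{-1}:\Delta\to\Omega$, $\Psi(w)=bw+b_0+b_1/w+b_2/w^2+\cdots$ for $|w|>1$, $b=1/\gamma$. "Piecewise analytic without cusps" means that $\Gamma$ consists of a finite number of analytic arcs that meet at corner points $z_j$, $j=1,\dots,N$, where they form exterior angles (angles measured in $\Omega$) $\omega_j\pi$ with $0<\omega_j<2$; thus $\omega=\min_j\omega_j$. *)

theory Defs
  imports "HOL-Complex_Analysis.Complex_Analysis"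
begin

text \<open>A bounded simply connected domain whose boundary is a Jordan curve.\<close>

definition jordan_domain :: "complex set \<Rightarrow> bool" where
  "jordan_domain G \<longleftrightarrow>
     open G \<and> connected G \<and> G \<noteq> {} \<and> bounded G \<and> simply_connected G \<and>
     (\<exists>g. simple_path g \<and> pathfinish g = pathstart g \<and> path_image g = frontier G)"

text \<open>Regular analytic arcs, analytic up to and including both endpoints: the parametrization is
  the restriction to \<open>[a, b]\<close> of a function holomorphic in a complex neighbourhood of \<open>[a, b]\<close>.
  Injectivity is not required here; it comes from the simple closed path the arc belongs to,
  which also permits a single arc closing up at a single corner.\<close>

definition analytic_arc :: "(real \<Rightarrow> complex) \<Rightarrow> real \<Rightarrow> real \<Rightarrow> bool" where
  "analytic_arc g a b \<longleftrightarrow>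
     (\<exists>f. f analytic_on (complex_of_real ` {a..b}) \<and>
          (\<forall>s\<in>{a..b}. f (complex_of_real s) = g s \<and> deriv f (complex_of_real s) \<noteq> 0))"

text \<open>Let \<open>g\<close> traverse the boundary counterclockwise with corners \<open>g (t 1), \<dots>, g (t N)\<close>, where
  \<open>t 0 = 0\<close> and \<open>t N = 1\<close> give the same corner. At a corner with incoming velocity \<open>u\<close> and outgoing
  velocity \<open>v\<close>, the exterior domain lies to the right of the curve, so the exterior angle is
  swept counterclockwise from the direction \<open>- u\<close> (back along the incoming arc) to \<open>v\<close>.
  The value is \<open>\<omega>\<^sub>j\<close>, i.e. the angle divided by \<open>\<pi>\<close>. Since \<open>Arg2pi\<close> takes values
  in \<open>[0, 2 \<pi>)\<close>, inward as well as outward cusps yield the value \<open>0\<close>.\<close>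

definition exterior_angle :: "(real \<Rightarrow> complex) \<Rightarrow> nat \<Rightarrow> (nat \<Rightarrow> real) \<Rightarrow> nat \<Rightarrow> real" where
  "exterior_angle g N t j =
     (let u = vector_derivative g (at_left (t j));
          v = vector_derivative g (at_right (if j = N then t 0 else t j))
      in Arg2pi (v / (- u)) / pi)"

text \<open>The boundary of \<open>G\<close> is piecewise analytic without cusps; \<open>g\<close> is a counterclockwise
  parametrization, and \<open>t\<close> lists the parameters of the endpoints of the \<open>N\<close> analytic arcs.\<close>

definition piecewise_analytic_without_cusps ::
  "complex set \<Rightarrow> (real \<Rightarrow> complex) \<Rightarrow> nat \<Rightarrow> (nat \<Rightarrow> real) \<Rightarrow> bool" where
  "piecewise_analytic_without_cusps G g N t \<longleftrightarrow>
     simple_path g \<and> pathfinish g = pathstart g \<and> path_image g = frontier G \<and>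
     (\<forall>z\<in>G. winding_number g z = 1) \<and>
     N \<ge> 1 \<and> t 0 = 0 \<and> t N = 1 \<and>
     (\<forall>j<N. t j < t (Suc j) \<and> analytic_arc g (t j) (t (Suc j))) \<and>
     (\<forall>j\<in>{1..N}. 0 < exterior_angle g N t j \<and> exterior_angle g N t j < 2)"

text \<open>A corner with \<open>\<omega>\<^sub>j = 1\<close> is allowed. Subdividing an arc only adds such corners.\<close>

definition has_smallest_exterior_angle :: "complex set \<Rightarrow> real \<Rightarrow> bool" where
  "has_smallest_exterior_angle G \<omega> \<longleftrightarrow>
     (\<exists>g N t. piecewise_analytic_without_cusps G g N t \<and>
              \<omega> = Min (exterior_angle g N t ` {1..N}))"

text \<open>\<open>F z = a z + c\<^sub>0 + c\<^sub>1 / z + c\<^sub>2 / z\<^sup>2 + \<dots>\<close> for \<open>\<bar>z\<bar> > R\<close>.\<close>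

definition laurent_at_infinity ::
  "(complex \<Rightarrow> complex) \<Rightarrow> complex \<Rightarrow> (nat \<Rightarrow> complex) \<Rightarrow> real \<Rightarrow> bool" where
  "laurent_at_infinity F a c R \<longleftrightarrow>
     (\<forall>z. cmod z > R \<longrightarrow> (\<lambda>n. c n / z ^ n) sums (F z - a * z))"

text \<open>The conformal map \<open>\<Phi>\<close> from the complement of \<open>closure G\<close> in the Riemann sphere onto
  \<open>{w. \<bar>w\<bar> > 1} \<union> {\<infinity>}\<close>, given by its restriction to finite points; the expansion with
  \<open>\<gamma> > 0\<close> encodes \<open>\<Phi> \<infinity> = \<infinity>\<close> and conformality at \<open>\<infinity>\<close>.\<close>

definition exterior_map :: "complex set \<Rightarrow> (complex \<Rightarrow> complex) \<Rightarrow> real \<Rightarrow> bool" where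
  "exterior_map G \<Phi> \<gamma> \<longleftrightarrow>
     \<Phi> holomorphic_on (- closure G) \<and>
     bij_betw \<Phi> (- closure G) {w. cmod w > 1} \<and>
     \<gamma> > 0 \<and> (\<exists>c R. laurent_at_infinity \<Phi> (complex_of_real \<gamma>) c R)"

text \<open>\<open>b n\<close> is the coefficient of \<open>1 / w\<^sup>n\<close> in the expansion of \<open>\<Psi> = \<Phi>\<^sup>-\<^sup>1\<close>, whose leading
  coefficient is \<open>1 / \<gamma>\<close>. For a Jordan domain, \<open>\<Phi>\<close>, \<open>\<gamma>\<close> and \<open>b\<close> exist and are unique.\<close>

definition inverse_map_coeffs :: "complex set \<Rightarrow> (nat \<Rightarrow> complex) \<Rightarrow> bool" where
  "inverse_map_coeffs G b \<longleftrightarrow>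
     (\<exists>\<Phi> \<gamma>. exterior_map G \<Phi> \<gamma> \<and>
        laurent_at_infinity (inv_into (- closure G) \<Phi>) (complex_of_real (1 / \<gamma>)) b 1)"

end

theory Submission
  imports Defs "HOL-Real_Asymp.Real_Asymp"
begin

text \<open>
  Since \<open>\<Psi>\<close> inverts \<open>\<Phi>\<close>, the integral of \<open>\<Phi>\<^sup>n\<close> around \<open>\<Gamma>\<close> is \<open>- 2 \<pi> i n b\<^sub>n\<close>. Across each analytic arc,
  \<open>\<Phi>\<close> continues by reflection to a function of modulus less than \<open>1\<close>, so the contour can be
  pushed into \<open>G\<close> along rays that keep a fixed angle with the arcs at the corners. At a corner \<open>p\<close>
  with exterior angle \<open>\<omega> \<pi>\<close>, the maximum principle gives \<open>\<bar>\<Phi> z\<bar> \<ge> exp (c \<bar>z - p\<bar>\<^bsup>1/\<omega>\<^esup>)\<close> inside the sector,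
  so the reflected function is at most \<open>exp (- c s\<^bsup>1/\<omega>\<^esup>)\<close> at distance \<open>s\<close> from the corner, and
  the integral of \<open>exp (- n c s\<^bsup>1/\<omega>\<^esup>)\<close> is \<open>O(n\<^bsup>-\<omega>\<^esup>)\<close>. Dividing by \<open>n\<close> yields the bound for \<open>b\<^sub>n\<close>.

  For sharpness take the union of two discs whose circles meet at right exterior angles, so
  \<open>\<omega> = 1/2\<close>. Its exterior map is the Joukowski map \<open>(z + 1/z) / 2\<close>, whose inverse
  \<open>w + sqrt (w\<^sup>2 - 1)\<close> has binomial coefficients of order \<open>n\<^bsup>-3/2\<^esup>\<close> at the odd powers of \<open>1/w\<close>.
\<close>

section \<open>Exterior maps\<close>

text \<open>The map \<open>\<Phi>\<close> is never extended to \<open>\<Gamma>\<close>: what is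
  available there is only that \<open>cmod (\<Phi> z)\<close> tends to \<open>1\<close>, so an
  integral over \<open>\<Gamma>\<close> itself cannot be formed. The remedy is a primitive. For
  \<open>z0\<close> in \<open>G\<close>, the function
  \<open>\<Phi> z ^ n + n * b n / (z - z0)\<close> has residue zero at infinity and hence a
  single-valued primitive \<open>P\<close> on the exterior. Increments of \<open>P\<close> are taken
  along paths just outside each arc, at distance of order \<open>\<epsilon>\<close> from the
  corners. Summed over all arcs they regroup into jumps of \<open>P\<close> across the corner
  sectors, which vanish as \<open>\<epsilon>\<close> tends to 0, while the summand with
  \<open>z0\<close> integrates to \<open>n * b n\<close> times \<open>2 * pi * \<i>\<close>. Thus
  \<open>2 * pi * n * cmod (b n)\<close> is bounded by the reflected contributions of the arcs.
  Error terms that grow with \<open>n\<close> carry a factor \<open>\<epsilon>\<close> and disappear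
  because \<open>n\<close> is fixed in that limit.

  The arcs at a corner are curved, so the exact comparison function of a straight sector has the
  wrong sign on part of the true boundary; this forces the corrected barrier and the logarithmic
  coordinate. A corner of larger angle obeys the bound with the smallest \<open>\<omega>\<close>
  because parameters along the rays are at most \<open>1\<close>.\<close>

lemma norm_inverse_less_1: "1 < cmod w \<Longrightarrow> cmod (1 / w) < 1"
  by (simp add: norm_divide divide_less_eq_1)

text \<open>The substitution \<open>u = 1 / w\<close> moves infinity to 0. The Laurent hypothesis
  says nothing at \<open>u = 0\<close>, but there the series reduces to its term \<open>b 0\<close>
  and converges by itself.\<close>

lemma laurent_power_series:
  assumes L: "laurent_at_infinity F a b R" and R: "R > 0" and u: "cmod u < 1 / R"
  shows "(\<lambda>n. b n * u ^ n) sums (\<Sum>n. b n * u ^ n)"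
    and "u \<noteq> 0 \<Longrightarrow> (\<Sum>n. b n * u ^ n) = F (1 / u) - a / u"
proof -
  have s: "(\<lambda>n. b n * u ^ n) sums (F (1 / u) - a / u)" if "u \<noteq> 0"
  proof -
    have "cmod (1 / u) > R" using u R that by (simp add: norm_divide field_simps)
    then have "(\<lambda>n. b n / (1 / u) ^ n) sums (F (1 / u) - a * (1 / u))"
      using L unfolding laurent_at_infinity_def by blast
    moreover have "b n / (1 / u) ^ n = b n * u ^ n" for n
      using that by (simp add: power_one_over divide_simps)
    ultimately show ?thesis by simp
  qed
  show "(\<lambda>n. b n * u ^ n) sums (\<Sum>n. b n * u ^ n)"
  proof (cases "u = 0")
    case True
    have "(\<lambda>n. b n * 0 ^ n) sums (b 0)" by (rule powser_sums_zero)
    with True show ?thesis using sums_unique by fastforce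
  next
    case False
    then show ?thesis using s by (simp add: sums_iff)
  qed
  show "u \<noteq> 0 \<Longrightarrow> (\<Sum>n. b n * u ^ n) = F (1 / u) - a / u"
    using s sums_unique by metis
qed

lemma laurent_power_series_holomorphic:
  assumes L: "laurent_at_infinity F a b R" and R: "R > 0"
  shows "(\<lambda>u. \<Sum>n. b (n + m) * u ^ n) holomorphic_on ball 0 (1 / R)"
proof (rule power_series_holomorphic)
  fix w :: complex assume "w \<in> ball 0 (1 / R)"
  then have "summable (\<lambda>n. b n * w ^ n)"
    using laurent_power_series(1)[OF L R, of w] by (simp add: sums_iff)
  then have "summable (\<lambda>n. b (n + m) * w ^ n)"
    using summable_powser_ignore_initial_segment[of b m w] by simp
  then show "(\<lambda>n. b (n + m) * (w - 0) ^ n) sums (\<Sum>n. b (n + m) * w ^ n)"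
    by (simp add: summable_sums)
qed

lemma laurent_power_series_split:
  assumes L: "laurent_at_infinity F a b R" and R: "R > 0" and u: "cmod u < 1 / R"
  shows "(\<Sum>n. b n * u ^ n) = (\<Sum>k<m. b k * u ^ k) + u ^ m * (\<Sum>n. b (n + m) * u ^ n)"
proof -
  have s: "summable (\<lambda>n. b n * u ^ n)"
    using laurent_power_series(1)[OF L R u] by (simp add: sums_iff)
  have s': "summable (\<lambda>n. b (n + m) * u ^ n)"
    using s summable_powser_ignore_initial_segment[of b m u] by simp
  have "(\<Sum>n. b n * u ^ n) = (\<Sum>n. b (n + m) * u ^ (n + m)) + (\<Sum>k<m. b k * u ^ k)"
    using suminf_split_initial_segment[OF s, of m] by simp
  also have "(\<Sum>n. b (n + m) * u ^ (n + m)) = u ^ m * (\<Sum>n. b (n + m) * u ^ n)"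
    using suminf_mult[OF s', of "u ^ m"] by (simp add: power_add mult_ac)
  finally show ?thesis by simp
qed

lemma exterior_map_inverse:
  assumes E: "exterior_map G \<Phi> \<gamma>"
  shows "z \<notin> closure G \<Longrightarrow> inv_into (- closure G) \<Phi> (\<Phi> z) = z"
    and "cmod w > 1 \<Longrightarrow> inv_into (- closure G) \<Phi> w \<notin> closure G"
    and "cmod w > 1 \<Longrightarrow> \<Phi> (inv_into (- closure G) \<Phi> w) = w"
    and "z \<notin> closure G \<Longrightarrow> cmod (\<Phi> z) > 1"
proof -
  have b: "bij_betw \<Phi> (- closure G) {w. cmod w > 1}"
    using E by (simp add: exterior_map_def)
  show "z \<notin> closure G \<Longrightarrow> inv_into (- closure G) \<Phi> (\<Phi> z) = z"
    using b by (simp add: bij_betw_inv_into_left)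
  show "cmod w > 1 \<Longrightarrow> inv_into (- closure G) \<Phi> w \<notin> closure G"
    using b bij_betw_apply[OF bij_betw_inv_into[OF b], of w] by simp
  show "cmod w > 1 \<Longrightarrow> \<Phi> (inv_into (- closure G) \<Phi> w) = w"
    using b by (simp add: bij_betw_inv_into_right)
  show "z \<notin> closure G \<Longrightarrow> cmod (\<Phi> z) > 1"
    using bij_betw_apply[OF b, of z] by simp
qed

lemma exterior_map_field_derivative:
  assumes "exterior_map G \<Phi> \<gamma>" "z \<notin> closure G"
  shows "(\<Phi> has_field_derivative deriv \<Phi> z) (at z)"
  using assms by (auto simp: exterior_map_def intro!: holomorphic_derivI[of \<Phi> "- closure G"])

lemma exterior_map_inverse_holomorphic:
  assumes E: "exterior_map G \<Phi> \<gamma>"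
  shows "inv_into (- closure G) \<Phi> holomorphic_on {w. cmod w > 1}"
proof -
  have inj: "inj_on \<Phi> (- closure G)" and hol: "\<Phi> holomorphic_on (- closure G)"
    and im: "\<Phi> ` (- closure G) = {w. cmod w > 1}"
    using E by (auto simp: exterior_map_def bij_betw_def)
  obtain \<Psi> where \<Psi>: "\<Psi> holomorphic_on \<Phi> ` (- closure G)" "\<And>z. z \<in> - closure G \<Longrightarrow> \<Psi> (\<Phi> z) = z"
    using holomorphic_has_inverse[OF hol open_Compl[OF closed_closure] inj] by metis
  show ?thesis
  proof (rule holomorphic_transform[OF \<Psi>(1)[unfolded im]])
    fix w :: complex assume "w \<in> {w. cmod w > 1}"
    then show "\<Psi> w = inv_into (- closure G) \<Phi> w"
      using \<Psi>(2)[of "inv_into (- closure G) \<Phi> w"] exterior_map_inverse[OF E] by auto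
  qed
qed

text \<open>The cancellation behind the derivative of the primitive below: \<open>D\<close> stands
  for the derivative of \<open>\<Phi>\<close>, \<open>w\<close> and \<open>w2\<close> for
  \<open>\<Phi> z\<close> and its square, \<open>c\<close> for \<open>b n\<close>, and
  \<open>y\<close> for \<open>z - z0\<close>. Everything cancels except the residue term.\<close>

lemma exterior_power_primitive_algebra:
  fixes A B c s w w2 D n y :: complex
  shows "n * D * (A + B + c / w + s / w2) - n * (A * D + B * D - s * (- D / w2)) + n * c * (1 / y - D / w) = n * c / y"
  by (simp add: algebra_simps add_divide_distrib diff_divide_distrib)

text \<open>
  A residue computation stated through a primitive: telescoping its values along the arcs gives
  \<open>b n\<close> without deforming cycles in the exterior domain.
\<close>

lemma exterior_power_primitive:
  assumes E: "exterior_map G \<Phi> \<gamma>"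
    and L: "laurent_at_infinity (inv_into (- closure G) \<Phi>) (complex_of_real (1 / \<gamma>)) b 1"
    and z0: "z0 \<in> closure G" and n: "n \<ge> 1"
  obtains P where "\<And>z. z \<notin> closure G \<Longrightarrow>
    (P has_field_derivative \<Phi> z ^ n + of_nat n * b n / (z - z0)) (at z)"
proof -
  define a where "a = complex_of_real (1 / \<gamma>)"
  have a: "a \<noteq> 0" using E by (auto simp: a_def exterior_map_def)
  note L = L[folded a_def]
  define S where "S m u = (\<Sum>k. b (k + m) * u ^ k)" for m and u :: complex
  have Sh: "S m holomorphic_on ball 0 1" for m
    using laurent_power_series_holomorphic[OF L, of m] unfolding S_def by simp
  have zE: "z = a * \<Phi> z + (\<Sum>k<m. b k / \<Phi> z ^ k) + S m (1 / \<Phi> z) / \<Phi> z ^ m"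
    if z: "z \<notin> closure G" for z m
  proof -
    have w: "cmod (\<Phi> z) > 1" using exterior_map_inverse(4)[OF E z] .
    define u where "u = 1 / \<Phi> z"
    have u: "cmod u < 1" "u \<noteq> 0" "1 / u = \<Phi> z"
      using w norm_inverse_less_1[OF w] by (auto simp: u_def)
    have "(\<Sum>n. b n * u ^ n) = z - a / u"
      using laurent_power_series(2)[OF L, of u] u exterior_map_inverse(1)[OF E z] by simp
    moreover have "(\<Sum>n. b n * u ^ n) = (\<Sum>k<m. b k * u ^ k) + u ^ m * S m u"
      using laurent_power_series_split[OF L, of u m] u by (simp add: S_def)
    ultimately show ?thesis using u(2) w
      by (simp add: u_def power_one_over divide_simps algebra_simps sum_divide_distrib)
  qed
  \<comment> \<open>In the coordinate \<open>u = 1 / \<Phi> z\<close> this is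
    \<open>(z - z0) / \<Phi> z\<close>. It extends to infinity with the value \<open>a\<close> and
    has no zero on the disc because \<open>z0\<close> is not in the exterior, so it has a
    holomorphic logarithm \<open>l\<close>.\<close>
  define k where "k u = a + u * S 0 u - z0 * u" for u
  have kh: "k holomorphic_on ball 0 1" unfolding k_def by (intro holomorphic_intros Sh)
  have kz: "k (1 / \<Phi> z) = (z - z0) / \<Phi> z" if z: "z \<notin> closure G" for z
    using zE[OF z, of 0] exterior_map_inverse(4)[OF E z] by (auto simp: k_def divide_simps)
  have k0: "k u \<noteq> 0" if u: "u \<in> ball 0 1" for u
  proof (cases "u = 0")
    case True then show ?thesis using a by (simp add: k_def)
  next
    case False
    then have w: "cmod (1 / u) > 1" using u by (simp add: norm_divide field_simps)
    define z where "z = inv_into (- closure G) \<Phi> (1 / u)"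
    have "z \<notin> closure G" "\<Phi> z = 1 / u"
      using exterior_map_inverse[OF E] w by (auto simp: z_def)
    then show ?thesis using kz[of z] False z0 by auto
  qed
  obtain l where l: "l holomorphic_on ball 0 1" "\<And>u. u \<in> ball 0 1 \<Longrightarrow> exp (l u) = k u"
    using holomorphic_logarithm_exists[OF convex_ball open_ball kh k0, of 0] by auto
  obtain T where T: "\<And>u. u \<in> ball 0 1 \<Longrightarrow> (T has_field_derivative S (Suc n) u) (at u)"
    using holomorphic_convex_primitive'[OF convex_ball open_ball Sh, of "Suc n"]
    by (metis at_within_open open_ball)
  \<comment> \<open>Integration by parts: \<open>z * \<Phi> z ^ n\<close> minus \<open>n\<close>
    times a primitive of \<open>z * \<Phi> z ^ (n - 1)\<close> with respect to
    \<open>\<Phi> z\<close>, with \<open>z\<close> expanded in powers of \<open>\<Phi> z\<close>.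
    Only the term \<open>b n / \<Phi> z\<close> would require a logarithm of
    \<open>\<Phi> z\<close>; \<open>l (1 / \<Phi> z)\<close> stands for the difference of the
    logarithms of \<open>z - z0\<close> and \<open>\<Phi> z\<close>, which is single-valued although
    neither logarithm is. \<open>T\<close> takes care of the tail.\<close>
  define P where "P z = z * \<Phi> z ^ n - of_nat n * (a * \<Phi> z ^ Suc n / of_nat (Suc n)
     + (\<Sum>k<n. b k * \<Phi> z ^ (n - k) / of_nat (n - k)) - T (1 / \<Phi> z)) + of_nat n * b n * l (1 / \<Phi> z)" for z
  show ?thesis
  proof
    fix z assume z: "z \<notin> closure G"
    define D where "D = deriv \<Phi> z"
    have D: "(\<Phi> has_field_derivative D) (at z)"
      unfolding D_def by (rule exterior_map_field_derivative[OF E z])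
    have w: "cmod (\<Phi> z) > 1" using exterior_map_inverse(4)[OF E z] .
    have nz: "\<Phi> z \<noteq> 0" using w by auto
    have u: "1 / \<Phi> z \<in> ball 0 1" using norm_inverse_less_1[OF w] by simp
    define l' where "l' = deriv l (1 / \<Phi> z)"
    have l': "(l has_field_derivative l') (at (1 / \<Phi> z))"
      unfolding l'_def by (rule holomorphic_derivI[OF l(1) open_ball u])
    have inv: "((\<lambda>z. 1 / \<Phi> z) has_field_derivative (- D / \<Phi> z ^ 2)) (at z)"
      using D nz by (auto intro!: derivative_eq_intros simp: power2_eq_square)
    have dl: "((\<lambda>z. l (1 / \<Phi> z)) has_field_derivative (l' * (- D / \<Phi> z ^ 2))) (at z)"
      using DERIV_chain2[OF l' inv] .
    have dT: "((\<lambda>z. T (1 / \<Phi> z)) has_field_derivative (S (Suc n) (1 / \<Phi> z) * (- D / \<Phi> z ^ 2))) (at z)"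
      using DERIV_chain2[OF T[OF u] inv] .
    \<comment> \<open>Differentiating this identity gives the derivative of
      \<open>l (1 / \<Phi> z)\<close> without choosing any branch.\<close>
    have ex: "exp (l (1 / \<Phi> y)) * \<Phi> y = y - z0" if y: "y \<notin> closure G" for y
    proof -
      have w: "cmod (\<Phi> y) > 1" using exterior_map_inverse(4)[OF E y] .
      then have "1 / \<Phi> y \<in> ball 0 1" using norm_inverse_less_1[OF w] by simp
      then show ?thesis using l(2) kz[OF y] w by auto
    qed
    have "((\<lambda>y. exp (l (1 / \<Phi> y)) * \<Phi> y) has_field_derivative
        (exp (l (1 / \<Phi> z)) * (l' * (- D / \<Phi> z ^ 2)) * \<Phi> z + D * exp (l (1 / \<Phi> z)))) (at z)"
      by (rule derivative_eq_intros dl D refl)+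
    moreover have "((\<lambda>y. exp (l (1 / \<Phi> y)) * \<Phi> y) has_field_derivative 1) (at z)"
    proof (rule has_field_derivative_transform_within_open)
      show "((\<lambda>y. y - z0) has_field_derivative 1) (at z)" by (auto intro!: derivative_eq_intros)
      show "open (- closure G)" "z \<in> - closure G" using z by auto
    qed (use ex in auto)
    ultimately have "exp (l (1 / \<Phi> z)) * (l' * (- D / \<Phi> z ^ 2)) * \<Phi> z + D * exp (l (1 / \<Phi> z)) = 1"
      by (rule DERIV_unique)
    then have "exp (l (1 / \<Phi> z)) * \<Phi> z * (l' * (- D / \<Phi> z ^ 2) + D / \<Phi> z) = 1"
      using nz by (simp only: distrib_left distrib_right) (simp add: mult_ac)
    then have "(z - z0) * (l' * (- D / \<Phi> z ^ 2) + D / \<Phi> z) = 1" unfolding ex[OF z] .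
    moreover have "z - z0 \<noteq> 0" using z z0 by auto
    ultimately have "l' * (- D / \<Phi> z ^ 2) + D / \<Phi> z = 1 / (z - z0)"
      by (metis nonzero_mult_div_cancel_left)
    then have dlog: "l' * (- D / \<Phi> z ^ 2) = 1 / (z - z0) - D / \<Phi> z"
      by (metis add_diff_cancel_right')
    have dsum: "((\<lambda>z. \<Sum>k<n. b k * \<Phi> z ^ (n - k) / of_nat (n - k)) has_field_derivative
        (\<Sum>k<n. b k * \<Phi> z ^ (n - 1 - k) * D)) (at z)"
    proof (rule DERIV_sum)
      fix k assume "k \<in> {..<n}"
      then have k: "k < n" by simp
      have "((\<lambda>z. b k * \<Phi> z ^ (n - k) / of_nat (n - k)) has_field_derivative
         (b k * (of_nat (n - k) * \<Phi> z ^ (n - k - 1) * D) / of_nat (n - k))) (at z)"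
        using D by (auto intro!: derivative_eq_intros)
      then show "((\<lambda>z. b k * \<Phi> z ^ (n - k) / of_nat (n - k)) has_field_derivative
         (b k * \<Phi> z ^ (n - 1 - k) * D)) (at z)"
        using k by (simp add: diff_commute mult.assoc)
    qed
    have dP: "(P has_field_derivative \<Phi> z ^ n + z * (of_nat n * \<Phi> z ^ (n - 1) * D)
        - of_nat n * (a * \<Phi> z ^ n * D + (\<Sum>k<n. b k * \<Phi> z ^ (n - 1 - k) * D)
             - S (Suc n) (1 / \<Phi> z) * (- D / \<Phi> z ^ 2))
        + of_nat n * b n * (l' * (- D / \<Phi> z ^ 2))) (at z)"
    proof -
      have d3: "((\<lambda>z. \<Phi> z ^ n) has_field_derivative (of_nat n * \<Phi> z ^ (n - 1) * D)) (at z)"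
        using D by (auto intro!: derivative_eq_intros)
      have d2: "((\<lambda>z. z * \<Phi> z ^ n) has_field_derivative (\<Phi> z ^ n + z * (of_nat n * \<Phi> z ^ (n - 1) * D))) (at z)"
        using DERIV_mult[OF DERIV_ident d3] by (simp add: mult_ac)
      have "((\<lambda>z. a * \<Phi> z ^ Suc n / of_nat (Suc n)) has_field_derivative
         (a * (of_nat (Suc n) * \<Phi> z ^ n * D) / of_nat (Suc n))) (at z)"
        using DERIV_cdivide[OF DERIV_cmult[OF DERIV_power[OF D, of "Suc n"]], of a "of_nat (Suc n)"]
        by (simp add: mult_ac)
      then have d1: "((\<lambda>z. a * \<Phi> z ^ Suc n / of_nat (Suc n)) has_field_derivative (a * \<Phi> z ^ n * D)) (at z)"
        by (simp del: of_nat_Suc power_Suc add: mult.assoc)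
      show ?thesis
        unfolding P_def
        by (rule DERIV_add[OF DERIV_diff[OF d2 DERIV_cmult[OF DERIV_diff[OF DERIV_add[OF d1 dsum] dT]]] DERIV_cmult[OF dl]])
    qed
    have zn: "z * \<Phi> z ^ (n - 1) = a * \<Phi> z ^ n + (\<Sum>k<n. b k * \<Phi> z ^ (n - 1 - k)) + b n / \<Phi> z
        + S (Suc n) (1 / \<Phi> z) / \<Phi> z ^ 2"
    proof -
      have "z * \<Phi> z ^ (n - 1) = (a * \<Phi> z + (\<Sum>k<n. b k / \<Phi> z ^ k) + b n / \<Phi> z ^ n
         + S (Suc n) (1 / \<Phi> z) / \<Phi> z ^ Suc n) * \<Phi> z ^ (n - 1)"
        using zE[OF z, of "Suc n"] by (simp add: add.assoc)
      also have "\<dots> = a * (\<Phi> z * \<Phi> z ^ (n - 1)) + (\<Sum>k<n. b k / \<Phi> z ^ k * \<Phi> z ^ (n - 1))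
         + b n / \<Phi> z ^ n * \<Phi> z ^ (n - 1) + S (Suc n) (1 / \<Phi> z) / \<Phi> z ^ Suc n * \<Phi> z ^ (n - 1)"
        by (simp only: distrib_right sum_distrib_right mult.assoc)
      also have "\<Phi> z * \<Phi> z ^ (n - 1) = \<Phi> z ^ n" using n by (simp flip: power_Suc)
      also have "(\<Sum>k<n. b k / \<Phi> z ^ k * \<Phi> z ^ (n - 1)) = (\<Sum>k<n. b k * \<Phi> z ^ (n - 1 - k))"
        using nz by (intro sum.cong) (auto simp: power_diff)
      also have "b n / \<Phi> z ^ n * \<Phi> z ^ (n - 1) = b n / \<Phi> z"
        using nz n by (cases n) (auto simp: field_simps)
      also have "S (Suc n) (1 / \<Phi> z) / \<Phi> z ^ Suc n * \<Phi> z ^ (n - 1) = S (Suc n) (1 / \<Phi> z) / \<Phi> z ^ 2"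
        using nz n by (cases n) (auto simp: field_simps power2_eq_square)
      finally show ?thesis .
    qed
    have e1: "z * (of_nat n * \<Phi> z ^ (n - 1) * D) = of_nat n * D * (a * \<Phi> z ^ n + (\<Sum>k<n. b k * \<Phi> z ^ (n - 1 - k)) + b n / \<Phi> z
        + S (Suc n) (1 / \<Phi> z) / \<Phi> z ^ 2)"
      by (simp only: mult.assoc mult.commute mult.left_commute flip: zn)
    have e2: "(\<Sum>k<n. b k * \<Phi> z ^ (n - 1 - k) * D) = (\<Sum>k<n. b k * \<Phi> z ^ (n - 1 - k)) * D"
      by (simp add: sum_distrib_right)
    have ed: "\<Phi> z ^ n + z * (of_nat n * \<Phi> z ^ (n - 1) * D)
        - of_nat n * (a * \<Phi> z ^ n * D + (\<Sum>k<n. b k * \<Phi> z ^ (n - 1 - k) * D)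
             - S (Suc n) (1 / \<Phi> z) * (- D / \<Phi> z ^ 2))
        + of_nat n * b n * (l' * (- D / \<Phi> z ^ 2)) = \<Phi> z ^ n + of_nat n * b n / (z - z0)"
      using exterior_power_primitive_algebra[of "of_nat n" D "a * \<Phi> z ^ n" "\<Sum>k<n. b k * \<Phi> z ^ (n - 1 - k)" "b n" "\<Phi> z"
         "S (Suc n) (1 / \<Phi> z)" "\<Phi> z ^ 2" "z - z0"]
      unfolding e1 e2 dlog by (simp only: add.assoc add_diff_eq [symmetric] diff_add_eq)
    show "(P has_field_derivative \<Phi> z ^ n + of_nat n * b n / (z - z0)) (at z)"
      by (rule DERIV_cong[OF dP ed])
  qed
qed

section \<open>Behaviour at infinity and uniqueness of the exterior map\<close>

lemma laurent_bounded_at_infinity: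
  assumes L: "laurent_at_infinity F a b R"
  obtains B R' where "B > 0" "R' > 0" "R' \<ge> R" "\<And>w. cmod w \<ge> R' \<Longrightarrow> cmod (F w - a * w) \<le> B"
proof -
  \<comment> \<open>\<open>R\<close> may be zero or negative, whereas the disc of radius
    \<open>1 / R1\<close> requires a positive number.\<close>
  define R1 where "R1 = max R 1"
  have R1: "R1 > 0" "R1 \<ge> R" by (auto simp: R1_def)
  have L1: "laurent_at_infinity F a b R1" using L R1 by (auto simp: laurent_at_infinity_def)
  define E where "E u = (\<Sum>n. b n * u ^ n)" for u :: complex
  have "E holomorphic_on ball 0 (1 / R1)"
    using laurent_power_series_holomorphic[OF L1 R1(1), of 0] by (simp add: E_def[abs_def])
  then have "continuous_on (cball 0 (1 / (2 * R1))) E"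
    by (rule holomorphic_on_imp_continuous_on[OF holomorphic_on_subset]) (use R1 in \<open>simp add: cball_subset_ball_iff field_simps\<close>)
  then have "bounded (E ` cball 0 (1 / (2 * R1)))"
    by (intro compact_imp_bounded compact_continuous_image) auto
  then obtain B where B: "B > 0" "\<And>u. u \<in> cball 0 (1 / (2 * R1)) \<Longrightarrow> cmod (E u) \<le> B"
    unfolding bounded_pos by auto
  show ?thesis
  proof
    show "B > 0" by fact
    show "2 * R1 > 0" "2 * R1 \<ge> R" using R1 by auto
    fix w assume w: "cmod w \<ge> 2 * R1"
    define u where "u = 1 / w"
    have w0: "cmod w > 0" using w R1 by linarith
    have u: "cmod u \<le> 1 / (2 * R1)" "u \<noteq> 0" "1 / u = w" "a / u = a * w"
      using w w0 R1 by (auto simp: u_def norm_divide field_simps)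
    have "1 / (2 * R1) < 1 / R1" using R1 by (simp add: divide_simps)
    then have "cmod u < 1 / R1" using u by linarith
    then have "E u = F w - a * w"
      using laurent_power_series(2)[OF L1 R1(1), of u] u by (simp add: E_def)
    then show "cmod (F w - a * w) \<le> B" using B(2)[of u] u by auto
  qed
qed

lemma laurent_ratio_tendsto:
  assumes "laurent_at_infinity F a b R"
  shows "((\<lambda>w. F w / w) \<longlongrightarrow> a) at_infinity"
proof -
  obtain B R' where B: "B > 0" "R' > 0" "\<And>w. cmod w \<ge> R' \<Longrightarrow> cmod (F w - a * w) \<le> B"
    using laurent_bounded_at_infinity[OF assms] by metis
  have "((\<lambda>w. F w / w - a) \<longlongrightarrow> 0) at_infinity"
  proof (rule Lim_null_comparison)
    show "\<forall>\<^sub>F w in at_infinity. cmod (F w / w - a) \<le> B * cmod (inverse w)"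
      unfolding eventually_at_infinity
    proof (intro exI[of _ R'] allI impI)
      fix w :: complex assume w: "cmod w \<ge> R'"
      then have "w \<noteq> 0" using B by auto
      then have "F w / w - a = (F w - a * w) * inverse w" by (simp add: field_simps)
      then show "cmod (F w / w - a) \<le> B * cmod (inverse w)"
        using B(3)[OF w] by (simp add: norm_mult mult_right_mono)
    qed
    have "((\<lambda>w. inverse w) \<longlongrightarrow> (0::complex)) at_infinity" by (rule tendsto_inverse_0)
    then have "((\<lambda>w. B * cmod (inverse w)) \<longlongrightarrow> B * cmod 0) at_infinity"
      by (intro tendsto_intros)
    then show "((\<lambda>w. B * cmod (inverse w)) \<longlongrightarrow> 0) at_infinity" by simp
  qed
  then show ?thesis by (simp add: LIM_zero_iff)
qed

text \<open>\<open>h\<close> is the transition from one exterior map to another, read in the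
  coordinate \<open>1 / w\<close>, so that infinity becomes 0. Both maps are asymptotically linear,
  hence \<open>h u / u\<close> tends to \<open>\<gamma> / \<gamma>'\<close>; this makes
  \<open>h\<close> differentiable at 0 and so holomorphic on the whole disc, ready for Schwarz's
  lemma.\<close>

lemma exterior_transition_derivative:
  assumes E: "exterior_map G \<Phi> \<gamma>" and E': "exterior_map G \<Phi>' \<gamma>'"
    and L: "laurent_at_infinity (inv_into (- closure G) \<Phi>) (complex_of_real (1 / \<gamma>)) b 1"
  defines "h \<equiv> \<lambda>u. if u = 0 then 0 else 1 / \<Phi>' (inv_into (- closure G) \<Phi> (1 / u))"
  shows "h holomorphic_on ball 0 1" "(h has_field_derivative complex_of_real (\<gamma> / \<gamma>')) (at 0)"
    "\<And>u. cmod u < 1 \<Longrightarrow> cmod (h u) < 1"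
proof -
  define \<Psi> where "\<Psi> = inv_into (- closure G) \<Phi>"
  have \<gamma>: "\<gamma> > 0" "\<gamma>' > 0" using E E' by (auto simp: exterior_map_def)
  have \<Psi>h: "\<Psi> holomorphic_on {w. cmod w > 1}"
    unfolding \<Psi>_def by (rule exterior_map_inverse_holomorphic[OF E])
  have \<Psi>out: "\<Psi> w \<notin> closure G" if "cmod w > 1" for w
    using exterior_map_inverse(2)[OF E that] by (simp add: \<Psi>_def)
  have big: "cmod (1 / u) > 1" if "cmod u < 1" "u \<noteq> 0" for u :: complex
    using that by (simp add: norm_divide field_simps)
  have hol': "\<Phi>' holomorphic_on (- closure G)" using E' by (auto simp: exterior_map_def)
  show lt: "cmod (h u) < 1" if "cmod u < 1" for u
    using norm_inverse_less_1[OF exterior_map_inverse(4)[OF E' \<Psi>out[OF big[of u]]]] that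
    by (auto simp: h_def \<Psi>_def)
  have "(\<lambda>u. \<Phi>' (\<Psi> (1 / u))) holomorphic_on (ball 0 1 - {0})"
  proof -
    have "\<Psi> o (\<lambda>u. 1 / u) holomorphic_on (ball 0 1 - {0})"
      using big by (intro holomorphic_on_compose_gen[OF _ \<Psi>h] holomorphic_intros) auto
    then have "\<Phi>' o (\<Psi> o (\<lambda>u. 1 / u)) holomorphic_on (ball 0 1 - {0})"
      using big \<Psi>out by (intro holomorphic_on_compose_gen[OF _ hol']) (auto simp: image_subset_iff)
    then show ?thesis by (simp add: o_def)
  qed
  moreover have "\<Phi>' (\<Psi> (1 / u)) \<noteq> 0" if "u \<in> ball 0 1 - {0}" for u
    using exterior_map_inverse(4)[OF E' \<Psi>out[OF big[of u]]] that by auto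
  ultimately have "(\<lambda>u. 1 / \<Phi>' (\<Psi> (1 / u))) holomorphic_on (ball 0 1 - {0})"
    by (intro holomorphic_intros) auto
  then have h1: "h holomorphic_on (ball 0 1 - {0})"
    by (rule holomorphic_transform) (auto simp: h_def \<Psi>_def)
  have lim\<Psi>: "((\<lambda>w. \<Psi> w / w) \<longlongrightarrow> complex_of_real (1 / \<gamma>)) at_infinity"
    using laurent_ratio_tendsto[OF L] by (simp add: \<Psi>_def)
  have \<Psi>inf: "filterlim \<Psi> at_infinity at_infinity"
  proof -
    have "filterlim (\<lambda>w. \<Psi> w / w * w) at_infinity at_infinity"
      by (rule tendsto_mult_filterlim_at_infinity[OF lim\<Psi> _ filterlim_ident]) (use \<gamma> in auto)
    moreover have "\<forall>\<^sub>F w in at_infinity. \<Psi> w / w * w = \<Psi> w"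
      using eventually_not_equal_at_infinity[of 0] by eventually_elim auto
    ultimately show ?thesis by (rule filterlim_mono_eventually[OF _ order_refl order_refl])
  qed
  obtain c R where "laurent_at_infinity \<Phi>' (complex_of_real \<gamma>') c R"
    using E' by (auto simp: exterior_map_def)
  then have lim\<Phi>: "((\<lambda>w. \<Phi>' w / w) \<longlongrightarrow> complex_of_real \<gamma>') at_infinity"
    by (rule laurent_ratio_tendsto)
  have 1: "((\<lambda>w. \<Phi>' (\<Psi> w) / \<Psi> w * (\<Psi> w / w)) \<longlongrightarrow> complex_of_real \<gamma>' * complex_of_real (1 / \<gamma>)) at_infinity"
    by (rule tendsto_mult[OF filterlim_compose[OF lim\<Phi> \<Psi>inf] lim\<Psi>])
  have "((\<lambda>w. \<Phi>' (\<Psi> w) / w) \<longlongrightarrow> complex_of_real (\<gamma>' / \<gamma>)) at_infinity"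
  proof (rule Lim_transform_eventually)
    show "((\<lambda>w. \<Phi>' (\<Psi> w) / \<Psi> w * (\<Psi> w / w)) \<longlongrightarrow> complex_of_real (\<gamma>' / \<gamma>)) at_infinity"
      using 1 by simp
    have "\<forall>\<^sub>F w in at_infinity. \<Psi> w \<noteq> 0"
      by (rule eventually_compose_filterlim[OF eventually_not_equal_at_infinity \<Psi>inf])
    then show "\<forall>\<^sub>F w in at_infinity. \<Phi>' (\<Psi> w) / \<Psi> w * (\<Psi> w / w) = \<Phi>' (\<Psi> w) / w"
      by eventually_elim auto
  qed
  then have "((\<lambda>w. inverse (\<Phi>' (\<Psi> w) / w)) \<longlongrightarrow> inverse (complex_of_real (\<gamma>' / \<gamma>))) at_infinity"
    using \<gamma> by (intro tendsto_inverse) auto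
  then have "((\<lambda>w. w / \<Phi>' (\<Psi> w)) \<longlongrightarrow> complex_of_real (\<gamma> / \<gamma>')) at_infinity"
    by simp
  then have "((\<lambda>u. inverse u / \<Phi>' (\<Psi> (inverse u))) \<longlongrightarrow> complex_of_real (\<gamma> / \<gamma>')) (at 0)"
    by (rule filterlim_compose[OF _ filterlim_inverse_at_infinity])
  then show d0: "(h has_field_derivative complex_of_real (\<gamma> / \<gamma>')) (at 0)"
    unfolding has_field_derivative_iff
  proof (rule Lim_transform_eventually)
    show "\<forall>\<^sub>F u in at 0. inverse u / \<Phi>' (\<Psi> (inverse u)) = (h u - h 0) / (u - 0)"
      using eventually_neq_at_within[of 0] by eventually_elim (auto simp: h_def \<Psi>_def field_simps)
  qed
  show "h holomorphic_on ball 0 1"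
    unfolding holomorphic_on_open[OF open_ball]
  proof
    fix u :: complex assume u: "u \<in> ball 0 1"
    show "\<exists>f'. (h has_field_derivative f') (at u)"
    proof (cases "u = 0")
      case False
      then show ?thesis using h1 u holomorphic_on_open[of "ball 0 1 - {0}" h] by (auto simp: open_delete)
    qed (use d0 in auto)
  qed
qed

text \<open>
  Schwarz's lemma for both transition maps. Uniqueness makes the constant in the
  coefficient bound independent of the given coefficient sequence.
\<close>

lemma exterior_map_unique:
  assumes E: "exterior_map G \<Phi> \<gamma>" and E': "exterior_map G \<Phi>' \<gamma>'"
    and L: "laurent_at_infinity (inv_into (- closure G) \<Phi>) (complex_of_real (1 / \<gamma>)) b 1"
    and L': "laurent_at_infinity (inv_into (- closure G) \<Phi>') (complex_of_real (1 / \<gamma>')) b' 1"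
  shows "\<gamma> = \<gamma>'" "\<And>z. z \<notin> closure G \<Longrightarrow> \<Phi> z = \<Phi>' z"
proof -
  have \<gamma>: "\<gamma> > 0" "\<gamma>' > 0" using E E' by (auto simp: exterior_map_def)
  define h where "h u = (if u = 0 then 0 else 1 / \<Phi>' (inv_into (- closure G) \<Phi> (1 / u)))" for u
  define h' where "h' u = (if u = 0 then 0 else 1 / \<Phi> (inv_into (- closure G) \<Phi>' (1 / u)))" for u
  note h = exterior_transition_derivative[OF E E' L, folded h_def[abs_def] h_def]
  note h' = exterior_transition_derivative[OF E' E L', folded h'_def[abs_def] h'_def]
  have h0: "h 0 = 0" "h' 0 = 0" by (simp_all add: h_def h'_def)
  have d: "deriv h 0 = complex_of_real (\<gamma> / \<gamma>')" "deriv h' 0 = complex_of_real (\<gamma>' / \<gamma>)"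
    using h(2) h'(2) by (auto simp: DERIV_imp_deriv)
  have "cmod (deriv h 0) \<le> 1" "cmod (deriv h' 0) \<le> 1"
    using Schwarz_Lemma(2)[OF h(1) h0(1) h(3), of 0] Schwarz_Lemma(2)[OF h'(1) h0(2) h'(3), of 0]
    by simp_all
  then show eq: "\<gamma> = \<gamma>'" using \<gamma> unfolding d norm_of_real by (auto simp: field_simps)
  \<comment> \<open>The equality case of Schwarz's lemma makes \<open>h\<close> a rotation, and its
    derivative \<open>1\<close> at 0 makes it the identity.\<close>
  then have "cmod (deriv h 0) = 1" using d \<gamma> by simp
  then obtain \<alpha> where \<alpha>: "\<And>u. cmod u < 1 \<Longrightarrow> h u = \<alpha> * u"
    using Schwarz_Lemma(3)[OF h(1) h0(1) h(3), of 0] by auto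
  have "(h has_field_derivative \<alpha>) (at 0)"
  proof (rule has_field_derivative_transform_within_open[OF _ open_ball])
    show "((\<lambda>u. \<alpha> * u) has_field_derivative \<alpha>) (at 0)" by (auto intro!: derivative_eq_intros)
    show "(0::complex) \<in> ball 0 1" by simp
    show "\<And>u. u \<in> ball 0 1 \<Longrightarrow> \<alpha> * u = h u" using \<alpha> by simp
  qed
  then have \<alpha>1: "\<alpha> = 1" using h(2) eq \<gamma> DERIV_unique by fastforce
  fix z assume z: "z \<notin> closure G"
  have w: "cmod (\<Phi> z) > 1" using exterior_map_inverse(4)[OF E z] .
  define u where "u = 1 / \<Phi> z"
  have u: "cmod u < 1" "u \<noteq> 0" "1 / u = \<Phi> z"
    using w norm_inverse_less_1[OF w] by (auto simp: u_def)
  have "h u = 1 / \<Phi>' z" using u exterior_map_inverse(1)[OF E z] by (simp add: h_def)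
  then have "1 / \<Phi>' z = 1 / \<Phi> z" using \<alpha>[OF u(1)] \<alpha>1 by (simp add: u_def)
  then show "\<Phi> z = \<Phi>' z" by simp
qed

text \<open>Both sequences expand the same inverse map, so their difference is a power series in
  \<open>1 / w\<close> that vanishes on the punctured disc, and by continuity also at 0.\<close>

lemma inverse_map_coeffs_unique:
  assumes "inverse_map_coeffs G b" "inverse_map_coeffs G b'"
  shows "b = b'"
proof -
  obtain \<Phi> \<gamma> where E: "exterior_map G \<Phi> \<gamma>"
    and L: "laurent_at_infinity (inv_into (- closure G) \<Phi>) (complex_of_real (1 / \<gamma>)) b 1"
    using assms(1) by (auto simp: inverse_map_coeffs_def)
  obtain \<Phi>' \<gamma>' where E': "exterior_map G \<Phi>' \<gamma>'"
    and L': "laurent_at_infinity (inv_into (- closure G) \<Phi>') (complex_of_real (1 / \<gamma>')) b' 1"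
    using assms(2) by (auto simp: inverse_map_coeffs_def)
  note u = exterior_map_unique[OF E E' L L']
  have inveq: "inv_into (- closure G) \<Phi> w = inv_into (- closure G) \<Phi>' w" if "cmod w > 1" for w
  proof -
    have "\<Phi>' (inv_into (- closure G) \<Phi> w) = w"
      using u(2) exterior_map_inverse(2,3)[OF E that] by simp
    then show ?thesis using exterior_map_inverse(1)[OF E'] exterior_map_inverse(2)[OF E that] by metis
  qed
  have LD: "laurent_at_infinity (\<lambda>_. 0) 0 (\<lambda>n. b n - b' n) 1"
    unfolding laurent_at_infinity_def
  proof (intro allI impI)
    fix w :: complex assume w: "cmod w > 1"
    show "(\<lambda>n. (b n - b' n) / w ^ n) sums (0 - 0 * w)"
      using sums_diff[OF L[unfolded laurent_at_infinity_def, rule_format, OF w]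
          L'[unfolded laurent_at_infinity_def, rule_format, OF w]] u(1) inveq[OF w]
      by (simp add: diff_divide_distrib)
  qed
  define d where "d v = (\<Sum>n. (b n - b' n) * v ^ n)" for v
  have d0: "d v = 0" if "cmod v < 1" "v \<noteq> 0" for v
    using laurent_power_series(2)[OF LD, of v] that by (simp add: d_def)
  have "d holomorphic_on ball 0 1"
    using laurent_power_series_holomorphic[OF LD, of 0] by (simp add: d_def[abs_def])
  then have "isCont d 0"
    by (metis centre_in_ball continuous_on_eq_continuous_at holomorphic_on_imp_continuous_on open_ball zero_less_one)
  moreover have "(d \<longlongrightarrow> 0) (at 0)"
  proof (rule Lim_transform_eventually[OF tendsto_const])
    show "\<forall>\<^sub>F v in at 0. 0 = d v"
      unfolding eventually_at by (rule exI[of _ 1]) (auto simp: d0)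
  qed
  ultimately have "d 0 = 0" using isCont_def LIM_unique by blast
  then have dz: "d v = 0" if "cmod v < 1" for v using d0 that by (cases "v = 0") auto
  have sm: "(\<lambda>n. (b n - b' n) * v ^ n) sums 0" if "cmod v < 1" for v
    using laurent_power_series(1)[OF LD, of v] that dz[OF that] by (simp add: d_def)
  have 0: "b 0 - b' 0 = 0"
    using sums_unique2[OF sm[of 0] powser_sums_zero[of "\<lambda>n. b n - b' n"]] by simp
  \<comment> \<open>A power series that vanishes at its centre and has some nonzero later
    coefficient is nonzero throughout a punctured disc, against the vanishing just shown.\<close>
  have "b m - b' m = 0" for m
  proof (rule ccontr)
    assume m: "b m - b' m \<noteq> 0"
    then have "m > 0" using 0 by (cases m) auto
    show False
    proof (rule powser_0_nonzero[of 1 0 "\<lambda>n. b n - b' n" "\<lambda>_. 0::complex" m])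
      fix s :: real
      assume s: "0 < s" "\<And>z. z \<in> cball 0 s - {0::complex} \<Longrightarrow> (0::complex) \<noteq> 0"
      show False using s(2)[of "complex_of_real s"] s(1) by simp
    qed (use sm m \<open>m > 0\<close> in auto)
  qed
  then show ?thesis by auto
qed

section \<open>One-sided tangents, a maximum principle, and estimates along rays and
  segments\<close>

lemma arc_vector_derivative_at_left:
  fixes f :: "complex \<Rightarrow> complex"
  assumes "a < b" and eq: "\<And>s. s \<in> {a..b} \<Longrightarrow> f (complex_of_real s) = g s"
    and D: "(f has_field_derivative D) (at (complex_of_real b))"
  shows "vector_derivative g (at_left b) = D"
proof -
  have "((\<lambda>s. f (complex_of_real s)) has_vector_derivative D) (at b within {a..b})"
    by (rule has_vector_derivative_real_field[OF D])
  then have "(g has_vector_derivative D) (at b within {a..b})"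
    by (rule has_vector_derivative_transform[rotated 2]) (use assms in auto)
  then have "(g has_vector_derivative D) (at_left b)"
    using at_within_Icc_at_left[OF assms(1)] by simp
  then show ?thesis by (intro vector_derivative_within) auto
qed

lemma arc_vector_derivative_at_right:
  fixes f :: "complex \<Rightarrow> complex"
  assumes "a < b" and eq: "\<And>s. s \<in> {a..b} \<Longrightarrow> f (complex_of_real s) = g s"
    and D: "(f has_field_derivative D) (at (complex_of_real a))"
  shows "vector_derivative g (at_right a) = D"
proof -
  have "((\<lambda>s. f (complex_of_real s)) has_vector_derivative D) (at a within {a..b})"
    by (rule has_vector_derivative_real_field[OF D])
  then have "(g has_vector_derivative D) (at a within {a..b})"
    by (rule has_vector_derivative_transform[rotated 2]) (use assms in auto)
  then have "(g has_vector_derivative D) (at_right a)"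
    using at_within_Icc_at_right[OF assms(1)] by simp
  then show ?thesis by (intro vector_derivative_within) auto
qed

text \<open>A maximum principle for possibly unbounded \<open>D\<close> and for \<open>F\<close>
  without boundary values: the hypothesis \<open>K\<close> says that the upper limit of the modulus
  at every end of \<open>D\<close> is at most \<open>1\<close>. The superlevel set \<open>S\<close>
  is compact, and since the strict superlevel set \<open>U\<close> is open and contained in
  \<open>S\<close>, no frontier point of \<open>S\<close> has modulus above
  \<open>1 + e\<close>.\<close>

lemma maximum_principle_compact:
  fixes F :: "complex \<Rightarrow> complex"
  assumes D: "open D" and F: "F holomorphic_on D"
    and K: "\<And>e. e > 0 \<Longrightarrow> \<exists>K. compact K \<and> K \<subseteq> D \<and> (\<forall>z\<in>D - K. cmod (F z) \<le> 1 + e)"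
    and z: "z \<in> D"
  shows "cmod (F z) \<le> 1"
proof (rule field_le_epsilon)
  fix e :: real assume "e > 0"
  obtain K where K: "compact K" "K \<subseteq> D" "\<forall>z\<in>D - K. cmod (F z) \<le> 1 + e"
    using K[OF \<open>e > 0\<close>] by auto
  have le: "cmod (F z) \<le> 1 + e" if "z \<in> D" "z \<notin> K" for z using K(3) that by auto
  have cont: "continuous_on D (\<lambda>z. cmod (F z))"
    using F by (intro continuous_on_norm holomorphic_on_imp_continuous_on)
  define S where "S = K \<inter> (\<lambda>z. cmod (F z)) -` {1 + e..}"
  have "closed S"
    unfolding S_def
    by (rule continuous_closed_preimage[OF continuous_on_subset[OF cont K(2)] compact_imp_closed[OF K(1)] closed_atLeast])
  moreover have "bounded S" using compact_imp_bounded[OF K(1)] by (rule bounded_subset) (auto simp: S_def)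
  moreover have SD: "S \<subseteq> D" using K by (auto simp: S_def)
  define U where "U = D \<inter> (\<lambda>z. cmod (F z)) -` {1 + e<..}"
  have U: "open U" unfolding U_def using cont D by (intro continuous_open_preimage) auto
  have US: "U \<subseteq> S" using le by (force simp: U_def S_def)
  show "cmod (F z) \<le> 1 + e"
  proof (cases "z \<in> S")
    case True
    show ?thesis
    proof (rule maximum_modulus_frontier[of F S])
      show "F holomorphic_on interior S"
        using F by (rule holomorphic_on_subset) (use SD interior_subset in blast)
      show "continuous_on (closure S) F"
        using \<open>closed S\<close> SD by (auto intro: continuous_on_subset[OF holomorphic_on_imp_continuous_on[OF F]])
      fix w assume w: "w \<in> frontier S"
      then have "w \<in> S" "w \<notin> interior S" using \<open>closed S\<close> by (auto simp: frontier_def)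
      then have "w \<notin> U" using U US interior_maximal by blast
      then show "cmod (F w) \<le> 1 + e" using \<open>w \<in> S\<close> SD by (auto simp: U_def)
    qed (use \<open>bounded S\<close> True in auto)
  next
    case False
    then show ?thesis using le[of z] z by (cases "z \<in> K") (auto simp: S_def)
  qed
qed

text \<open>The rational majorant has an elementary primitive, so the decay along a ray can later be
  summed by the mean value inequality instead of an integral.\<close>

lemma exp_powr_decay:
  fixes c p :: real
  assumes "c > 0" "p > 0"
  obtains K where "K > 0" "\<And>x. x \<ge> 0 \<Longrightarrow> exp (- c * x powr p) \<le> K / (1 + x)\<^sup>2"
proof -
  have "((\<lambda>x. exp (- c * x powr p) * (1 + x)\<^sup>2) \<longlongrightarrow> 0) at_top"
    using assms by real_asymp
  then have "\<forall>\<^sub>F x in at_top. exp (- c * x powr p) * (1 + x)\<^sup>2 < 1"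
    by (rule order_tendstoD) simp
  then obtain X where X: "\<And>x. x \<ge> X \<Longrightarrow> exp (- c * x powr p) * (1 + x)\<^sup>2 < 1"
    by (auto simp: eventually_at_top_linorder)
  define K where "K = max 1 ((1 + X)\<^sup>2)"
  show ?thesis
  proof
    show "K > 0" by (simp add: K_def)
    fix x :: real assume x: "x \<ge> 0"
    have "exp (- c * x powr p) * (1 + x)\<^sup>2 \<le> K"
    proof (cases "x \<ge> X")
      case True then show ?thesis using X[of x] by (simp add: K_def)
    next
      case False
      have "exp (- c * x powr p) \<le> 1" using assms by simp
      then have "exp (- c * x powr p) * (1 + x)\<^sup>2 \<le> 1 * (1 + x)\<^sup>2" by (intro mult_right_mono) auto
      also have "\<dots> \<le> (1 + X)\<^sup>2" using x False by (simp add: power_mono)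
      finally show ?thesis by (simp add: K_def)
    qed
    then show "exp (- c * x powr p) \<le> K / (1 + x)\<^sup>2" using x by (simp add: pos_le_divide_eq)
  qed
qed

text \<open>Scaling with \<open>l = real n powr \<omega>\<close> gives
  \<open>real n * s powr (1 / \<omega>) = (l * s) powr (1 / \<omega>)\<close>, so the derivative
  along the ray is at most a constant times \<open>1 / (1 + l * s)^2\<close>. Its primitive
  \<open>\<phi>\<close> increases by at most a constant over \<open>l\<close>, which is where the
  power \<open>\<omega>\<close> of \<open>1 / n\<close> originates.\<close>

lemma ray_primitive_bound:
  fixes T t :: "complex \<Rightarrow> complex"
  assumes n: "n \<ge> 1" and \<omega>: "\<omega> > 0" and K: "\<And>x. x \<ge> 0 \<Longrightarrow> exp (- c * x powr (1 / \<omega>)) \<le> K / (1 + x)\<^sup>2"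
    and \<epsilon>: "0 < \<epsilon>" "\<epsilon> < h" and B: "B \<ge> 0"
    and T: "\<And>s. s \<in> {\<epsilon>..h} \<Longrightarrow> (T has_field_derivative t (z + of_real s * d)) (at (z + of_real s * d))"
    and t: "\<And>s. s \<in> {\<epsilon>..h} \<Longrightarrow> cmod (t (z + of_real s * d)) \<le> B * exp (- real n * c * s powr (1 / \<omega>))"
  shows "cmod (T (z + of_real h * d) - T (z + of_real \<epsilon> * d)) \<le> K * B * cmod d / real n powr \<omega>"
proof -
  define l where "l = real n powr \<omega>"
  have l: "l > 0" using n by (simp add: l_def)
  have K0: "K \<ge> 0" using K[of 0] order_trans[OF exp_ge_zero] by fastforce
  define \<phi> where "\<phi> s = - (K * B * cmod d / (l * (1 + l * s)))" for s
  have "cmod (T (z + of_real h * d) - T (z + of_real \<epsilon> * d)) \<le> \<phi> h - \<phi> \<epsilon>"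
  proof (rule differentiable_bound_general[where f = "\<lambda>s. T (z + of_real s * d)"])
    have D: "((\<lambda>s. T (z + of_real s * d)) has_vector_derivative (t (z + of_real s * d) * d)) (at s within A)"
      if "s \<in> {\<epsilon>..h}" for s A
    proof -
      have "((\<lambda>x. T (z + x * d)) has_field_derivative (t (z + of_real s * d) * d)) (at (of_real s))"
        by (rule DERIV_chain2[where f = T and g = "\<lambda>x. z + x * d", OF T[OF that]]) (auto intro!: derivative_eq_intros)
      then show ?thesis by (rule has_vector_derivative_real_field)
    qed
    have D\<phi>: "(\<phi> has_real_derivative (K * B * cmod d / (1 + l * s)\<^sup>2)) (at s within A)"
      if "s \<in> {\<epsilon>..h}" for s A
    proof -
      have ne: "1 + l * s \<noteq> 0" using that \<epsilon> l by (smt (verit) atLeastAtMost_iff mult_pos_pos)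
      have "(\<phi> has_real_derivative (- ((0 * (l * (1 + l * s)) - K * B * cmod d * (l * l)) / (l * (1 + l * s) * (l * (1 + l * s)))))) (at s within A)"
        unfolding \<phi>_def using l ne by (auto intro!: derivative_eq_intros)
      moreover have "- ((0 * (l * (1 + l * s)) - K * B * cmod d * (l * l)) / (l * (1 + l * s) * (l * (1 + l * s))))
         = K * B * cmod d / (1 + l * s)\<^sup>2"
        using l ne by (simp add: power2_eq_square divide_simps)
      ultimately show ?thesis by simp
    qed
    show "continuous_on {\<epsilon>..h} (\<lambda>s. T (z + of_real s * d))"
      using D has_vector_derivative_continuous by (force simp: continuous_on_eq_continuous_within)
    show "continuous_on {\<epsilon>..h} \<phi>"
      using D\<phi> DERIV_continuous by (force simp: continuous_on_eq_continuous_within)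
    fix s assume s: "\<epsilon> < s" "s < h"
    show "((\<lambda>s. T (z + of_real s * d)) has_vector_derivative (t (z + of_real s * d) * d)) (at s)"
      using D s by simp
    show "(\<phi> has_vector_derivative (K * B * cmod d / (1 + l * s)\<^sup>2)) (at s)"
      using D\<phi> s by (simp add: has_real_derivative_iff_has_vector_derivative)
    have "(l * s) powr (1 / \<omega>) = real n * s powr (1 / \<omega>)"
      using s \<epsilon> \<omega> n by (simp add: l_def powr_mult powr_powr)
    then have "exp (- real n * c * s powr (1 / \<omega>)) = exp (- c * (l * s) powr (1 / \<omega>))" by simp
    also have "\<dots> \<le> K / (1 + l * s)\<^sup>2" using K[of "l * s"] l s \<epsilon> by simp
    finally have "cmod (t (z + of_real s * d)) \<le> B * (K / (1 + l * s)\<^sup>2)"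
      using t[of s] s B by (smt (verit) atLeastAtMost_iff mult_left_mono)
    then have "cmod (t (z + of_real s * d)) * cmod d \<le> B * (K / (1 + l * s)\<^sup>2) * cmod d"
      by (intro mult_right_mono) auto
    then show "cmod (t (z + of_real s * d) * d) \<le> K * B * cmod d / (1 + l * s)\<^sup>2"
      by (simp add: norm_mult mult_ac)
  qed (use \<epsilon> in auto)
  also have "\<dots> \<le> - \<phi> \<epsilon>" using l \<epsilon> K0 B by (simp add: \<phi>_def add_nonneg_nonneg)
  also have "\<dots> \<le> K * B * cmod d / l"
  proof -
    have "l * 1 \<le> l * (1 + l * \<epsilon>)" using l \<epsilon> by (intro mult_left_mono) auto
    then have "K * B * cmod d / (l * (1 + l * \<epsilon>)) \<le> K * B * cmod d / l"
      using l K0 B by (intro divide_left_mono) (auto intro!: mult_pos_pos add_pos_nonneg simp: \<epsilon> less_imp_le)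
    then show ?thesis by (simp add: \<phi>_def)
  qed
  finally show ?thesis by (simp add: l_def)
qed

text \<open>A Lebesgue number of the cover by the balls on which \<open>E\<close> is small turns the
  limits at single points of the closed segment into uniform smallness on a parallel segment just
  below it.\<close>

lemma uniform_approach_to_segment:
  fixes E :: "complex \<Rightarrow> real"
  assumes E: "\<And>x. x \<in> {a..b} \<Longrightarrow> (E \<longlongrightarrow> 0) (at (of_real x) within V)" and \<delta>: "\<delta> > 0"
  obtains r where "r > 0" "\<And>x \<eta>. x \<in> {a..b} \<Longrightarrow> 0 < \<eta> \<Longrightarrow> \<eta> < r \<Longrightarrow> of_real x - \<i> * of_real \<eta> \<in> V
     \<Longrightarrow> \<bar>E (of_real x - \<i> * of_real \<eta>)\<bar> < \<delta>"
proof -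
  have "\<exists>d>0. \<forall>z\<in>V. z \<noteq> of_real x \<and> dist z (of_real x) < d \<longrightarrow> \<bar>E z\<bar> < \<delta>" if "x \<in> {a..b}" for x
    using tendstoD[OF E[OF that] \<delta>] by (simp add: eventually_at dist_real_def)
  then obtain d where d: "\<And>x. x \<in> {a..b} \<Longrightarrow> d x > 0"
    "\<And>x z. x \<in> {a..b} \<Longrightarrow> z \<in> V \<Longrightarrow> z \<noteq> of_real x \<Longrightarrow> dist z (of_real x) < d x \<Longrightarrow> \<bar>E z\<bar> < \<delta>"
    by metis
  define \<G> where "\<G> = (\<lambda>x. ball (complex_of_real x) (d x)) ` {a..b}"
  have "compact (complex_of_real ` {a..b})" by (intro compact_continuous_image continuous_intros) auto
  moreover have "complex_of_real ` {a..b} \<subseteq> \<Union>\<G>" using d(1) by (auto simp: \<G>_def)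
  moreover have "\<And>G. G \<in> \<G> \<Longrightarrow> open G" by (auto simp: \<G>_def)
  ultimately obtain r where r: "r > 0" "\<And>x. x \<in> complex_of_real ` {a..b} \<Longrightarrow> \<exists>G\<in>\<G>. ball x r \<subseteq> G"
    using Heine_Borel_lemma by metis
  show ?thesis
  proof
    show "r > 0" by fact
    fix x \<eta> assume x: "x \<in> {a..b}" and \<eta>: "0 < \<eta>" "\<eta> < r" and V: "of_real x - \<i> * of_real \<eta> \<in> V"
    obtain y where y: "y \<in> {a..b}" "ball (of_real x) r \<subseteq> ball (complex_of_real y) (d y)"
      using r(2)[of "of_real x"] x by (auto simp: \<G>_def)
    have "of_real x - \<i> * of_real \<eta> \<in> ball (complex_of_real x) r"
      using \<eta> by (simp add: dist_norm norm_mult)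
    then have "of_real x - \<i> * of_real \<eta> \<in> ball (complex_of_real y) (d y)" using y(2) by blast
    then have "dist (of_real x - \<i> * of_real \<eta>) (complex_of_real y) < d y" by (simp add: dist_commute)
    moreover have "of_real x - \<i> * of_real \<eta> \<noteq> complex_of_real y" using \<eta> by (simp add: complex_eq_iff)
    ultimately show "\<bar>E (of_real x - \<i> * of_real \<eta>)\<bar> < \<delta>" using d(2) y(1) V by blast
  qed
qed

section \<open>The extremal domain\<close>

text \<open>The union of the two discs of radius \<open>sqrt 2\<close> about \<open>i\<close> and \<open>- i\<close>, with corners \<open>1\<close> and \<open>- 1\<close>.\<close>

definition lens :: "complex set" where
  "lens = {z. (cmod z)\<^sup>2 - 2 * \<bar>Im z\<bar> < 1}"

lemma open_lens: "open lens"
  unfolding lens_def by (intro open_Collect_less continuous_intros)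

text \<open>Scaling multiplies the quadratic term by the square of \<open>s\<close>, which is at
  most \<open>s\<close>, and the other term by \<open>s\<close> exactly. This radial contraction
  yields both the closure and the starlikeness of \<open>lens\<close>.\<close>

lemma lens_scale:
  assumes "(cmod z)\<^sup>2 - 2 * \<bar>Im z\<bar> \<le> 1" "0 \<le> s" "s < 1"
  shows "complex_of_real s * z \<in> lens"
proof -
  have "s\<^sup>2 * (cmod z)\<^sup>2 \<le> s * (cmod z)\<^sup>2"
    using assms by (intro mult_right_mono) (auto simp: power2_eq_square mult_left_le_one_le)
  moreover have "s * ((cmod z)\<^sup>2 - 2 * \<bar>Im z\<bar>) \<le> s * 1"
    using assms by (intro mult_left_mono) auto
  ultimately have "s\<^sup>2 * (cmod z)\<^sup>2 - 2 * (s * \<bar>Im z\<bar>) < 1"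
    using assms by (simp add: algebra_simps)
  then show ?thesis using assms by (simp add: lens_def norm_mult power_mult_distrib abs_mult)
qed

lemma closure_lens: "closure lens = {z. (cmod z)\<^sup>2 - 2 * \<bar>Im z\<bar> \<le> 1}"
proof
  have "closed {z. (cmod z)\<^sup>2 - 2 * \<bar>Im z\<bar> \<le> 1}"
    by (intro closed_Collect_le continuous_intros)
  then show "closure lens \<subseteq> {z. (cmod z)\<^sup>2 - 2 * \<bar>Im z\<bar> \<le> 1}"
    by (intro closure_minimal) (auto simp: lens_def)
  show "{z. (cmod z)\<^sup>2 - 2 * \<bar>Im z\<bar> \<le> 1} \<subseteq> closure lens"
  proof
    fix z assume z: "z \<in> {z. (cmod z)\<^sup>2 - 2 * \<bar>Im z\<bar> \<le> 1}"
    define X where "X n = complex_of_real (1 - inverse (real (Suc n))) * z" for n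
    have "X n \<in> lens" for n
      unfolding X_def by (rule lens_scale) (use z in \<open>auto simp: inverse_eq_divide divide_simps\<close>)
    moreover have "X \<longlonglongrightarrow> z"
    proof -
      have "(\<lambda>n. 1 - inverse (real (Suc n))) \<longlonglongrightarrow> 1 - 0"
        by (intro tendsto_diff tendsto_const LIMSEQ_inverse_real_of_nat)
      then have "(\<lambda>n. complex_of_real (1 - inverse (real (Suc n))) * z) \<longlonglongrightarrow> complex_of_real (1 - 0) * z"
        by (intro tendsto_mult tendsto_of_real tendsto_const)
      then show ?thesis by (simp add: X_def[abs_def])
    qed
    ultimately show "z \<in> closure lens" unfolding closure_sequential by blast
  qed
qed

lemma frontier_lens: "frontier lens = {z. (cmod z)\<^sup>2 - 2 * \<bar>Im z\<bar> = 1}"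
  unfolding frontier_def closure_lens interior_open[OF open_lens] by (auto simp: lens_def)

lemma starlike_lens: "starlike lens"
  unfolding starlike_def
proof (intro bexI[of _ 0] ballI subsetI)
  fix x z assume x: "x \<in> lens" and z: "z \<in> closed_segment 0 x"
  then obtain u where u: "0 \<le> u" "u \<le> 1" "z = complex_of_real u * x"
    by (auto simp: in_segment scaleR_conv_of_real)
  show "z \<in> lens"
  proof (cases "u = 1")
    case False
    then show ?thesis using lens_scale[of x u] x u by (auto simp: lens_def)
  qed (use x u in auto)
qed (simp add: lens_def)

lemma bounded_lens: "bounded lens"
proof (rule boundedI)
  fix z assume "z \<in> lens"
  then have 1: "(cmod z)\<^sup>2 < 1 + 2 * cmod z"
    using abs_Im_le_cmod[of z] by (auto simp: lens_def)
  show "cmod z \<le> 3"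
  proof (rule ccontr)
    assume "\<not> cmod z \<le> 3"
    then have "3 * cmod z \<le> (cmod z)\<^sup>2" "cmod z > 3"
      by (auto simp: power2_eq_square intro!: mult_right_mono)
    then show False using 1 by linarith
  qed
qed

text \<open>The positive root \<open>r\<close> of
  \<open>r^2 - 2 * r * \<bar>sin \<theta>\<bar> = 1\<close>, which is the boundary equation in polar
  coordinates about 0.\<close>

definition lens_radius :: "real \<Rightarrow> real" where
  "lens_radius \<theta> = \<bar>sin \<theta>\<bar> + sqrt (1 + (sin \<theta>)\<^sup>2)"

definition lens_path :: "real \<Rightarrow> complex" where
  "lens_path s = complex_of_real (lens_radius (2 * pi * s)) * exp (2 * of_real pi * \<i> * of_real s)"

lemma lens_radius_pos: "lens_radius \<theta> > 0"
proof -
  have "sqrt (1 + (sin \<theta>)\<^sup>2) > 0" by (simp add: add_pos_nonneg)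
  then show ?thesis unfolding lens_radius_def by linarith
qed

lemma norm_exp_2pi [simp]: "cmod (exp (2 * of_real pi * \<i> * of_real s)) = 1"
  by (simp add: norm_exp_eq_Re)

lemma lens_radius_unique:
  assumes "r > 0" shows "r\<^sup>2 - 2 * (r * \<bar>sin \<theta>\<bar>) = 1 \<longleftrightarrow> r = lens_radius \<theta>"
proof
  assume "r\<^sup>2 - 2 * (r * \<bar>sin \<theta>\<bar>) = 1"
  then have "(r - \<bar>sin \<theta>\<bar>)\<^sup>2 = 1 + (sin \<theta>)\<^sup>2" by (simp add: power2_eq_square algebra_simps)
  then have sq: "sqrt (1 + (sin \<theta>)\<^sup>2) = \<bar>r - \<bar>sin \<theta>\<bar>\<bar>" by (metis real_sqrt_abs)
  have "\<bar>sin \<theta>\<bar> < sqrt (1 + (sin \<theta>)\<^sup>2)" by (intro real_less_rsqrt) simp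
  then show "r = lens_radius \<theta>" using sq assms unfolding lens_radius_def by linarith
next
  assume r: "r = lens_radius \<theta>"
  have "(r - \<bar>sin \<theta>\<bar>)\<^sup>2 = 1 + (sin \<theta>)\<^sup>2" by (simp add: r lens_radius_def)
  then show "r\<^sup>2 - 2 * (r * \<bar>sin \<theta>\<bar>) = 1" by (simp add: power2_eq_square algebra_simps)
qed

lemma exp_2pi_eq: "exp (2 * of_real pi * \<i> * of_real s) = Complex (cos (2 * pi * s)) (sin (2 * pi * s))"
  by (simp add: complex_eq_iff Re_exp Im_exp)

lemma polar_frontier_lens:
  assumes "r > 0"
  shows "complex_of_real r * exp (2 * of_real pi * \<i> * of_real s) \<in> frontier lens \<longleftrightarrow> r = lens_radius (2 * pi * s)"
  using lens_radius_unique[OF assms, of "2 * pi * s"] assms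
  by (simp add: frontier_lens norm_mult exp_2pi_eq abs_mult)

lemma path_image_lens_path: "path_image lens_path = frontier lens"
proof
  show "path_image lens_path \<subseteq> frontier lens"
    using polar_frontier_lens[OF lens_radius_pos] by (auto simp: path_image_def lens_path_def)
  show "frontier lens \<subseteq> path_image lens_path"
  proof
    fix z assume z: "z \<in> frontier lens"
    then have "z \<noteq> 0" by (auto simp: frontier_lens)
    define s where "s = Arg2pi z / (2 * pi)"
    have s: "s \<in> {0..1}" using Arg2pi[of z] by (auto simp: s_def)
    have zs: "z = complex_of_real (cmod z) * exp (2 * of_real pi * \<i> * of_real s)"
      using Arg2pi_eq[of z] by (simp add: s_def mult_ac)
    then have "cmod z = lens_radius (2 * pi * s)"
      using polar_frontier_lens[of "cmod z" s] z \<open>z \<noteq> 0\<close> by simp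
    then show "z \<in> path_image lens_path"
      using s zs by (auto simp: path_image_def lens_path_def)
  qed
qed

lemma path_lens_path: "path lens_path"
  unfolding path_def lens_path_def lens_radius_def by (intro continuous_intros)

lemma lens_path_loop: "pathfinish lens_path = pathstart lens_path"
  by (simp add: pathfinish_def pathstart_def lens_path_def lens_radius_def)

lemma simple_path_lens_path: "simple_path lens_path"
  unfolding simple_path_def loop_free_def
proof (intro conjI path_lens_path ballI impI)
  fix x y assume x: "x \<in> {0..1::real}" and y: "y \<in> {0..1::real}" and eq: "lens_path x = lens_path y"
  have "cmod (lens_path x) = cmod (lens_path y)" using eq by simp
  then have "lens_radius (2 * pi * x) = lens_radius (2 * pi * y)"
    using lens_radius_pos[of "2 * pi * x"] lens_radius_pos[of "2 * pi * y"]
    by (simp add: lens_path_def norm_mult)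
  then have "exp (2 * of_real pi * \<i> * of_real x) = exp (2 * of_real pi * \<i> * of_real y)"
    using eq lens_radius_pos[of "2 * pi * y"] by (simp add: lens_path_def)
  then obtain n :: int where "2 * of_real pi * \<i> * of_real x = 2 * of_real pi * \<i> * of_real y + (of_int (2 * n) * pi) * \<i>"
    unfolding exp_eq by auto
  then have "2 * pi * x = 2 * pi * y + 2 * n * pi"
    by (simp add: complex_eq_iff)
  then have "2 * pi * (x - y - n) = 0" by (simp add: algebra_simps)
  then have n: "x - y = n" by simp
  then have "real_of_int n \<le> 1" "- 1 \<le> real_of_int n" using x y by auto
  then have "n \<le> 1" "- 1 \<le> n" by linarith+
  then consider "n = - 1" | "n = 0" | "n = 1" by linarith
  then show "x = y \<or> x = 0 \<and> y = 1 \<or> x = 1 \<and> y = 0"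
    by cases (use n x y in auto)
qed

text \<open>The boundary is a positive radial graph over the unit circle, so the straight homotopy
  to the circle avoids 0. This settles the point 0, and the winding number is constant on the
  connected set \<open>lens\<close>.\<close>

lemma winding_number_lens_path:
  assumes "z \<in> lens" shows "winding_number lens_path z = 1"
proof -
  have "homotopic_loops (- {0}) lens_path (circlepath 0 1)"
  proof (rule homotopic_loops_linear)
    fix s :: real
    show "closed_segment (lens_path s) (circlepath 0 1 s) \<subseteq> - {0}"
    proof
      fix x assume "x \<in> closed_segment (lens_path s) (circlepath 0 1 s)"
      then obtain u where u: "0 \<le> u" "u \<le> 1" "x = (1 - u) *\<^sub>R lens_path s + u *\<^sub>R circlepath 0 1 s"
        by (auto simp: in_segment)
      define c where "c = (1 - u) * lens_radius (2 * pi * s) + u"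
      have "x = complex_of_real c * exp (2 * of_real pi * \<i> * of_real s)"
        by (simp add: c_def u lens_path_def circlepath scaleR_conv_of_real algebra_simps)
      moreover have "c > 0"
        unfolding c_def using u lens_radius_pos[of "2 * pi * s"]
        by (cases "u = 1") (auto intro!: add_pos_nonneg mult_pos_pos)
      ultimately show "x \<in> - {0}" by auto
    qed
  qed (use path_lens_path lens_path_loop in auto)
  then have "winding_number lens_path 0 = winding_number (circlepath 0 1) 0"
    by (rule winding_number_homotopic_loops)
  then have 0: "winding_number lens_path 0 = 1" by (simp add: winding_number_circlepath)
  have "lens \<inter> path_image lens_path = {}"
    unfolding path_image_lens_path frontier_lens by (auto simp: lens_def)
  then have "winding_number lens_path constant_on lens"
    using path_lens_path lens_path_loop starlike_imp_connected[OF starlike_lens]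
    by (intro winding_number_constant) auto
  then show ?thesis using 0 assms unfolding constant_on_def
    by (metis (no_types, lifting) lens_def mem_Collect_eq norm_zero zero_power2 complex.sel(2) abs_zero
        mult_zero_right diff_zero zero_complex.sel(2) zero_less_one)
qed

lemma jordan_domain_lens: "jordan_domain lens"
proof -
  have "0 \<in> lens" by (simp add: lens_def)
  then show ?thesis unfolding jordan_domain_def
    using open_lens starlike_imp_connected[OF starlike_lens] bounded_lens
      starlike_imp_simply_connected[OF starlike_lens] simple_path_lens_path lens_path_loop path_image_lens_path
    by blast
qed

text \<open>The formula of \<open>lens_path\<close> with \<open>\<sigma> * sin\<close> in place of
  the absolute value of the sine, so that it is holomorphic near the real axis;
  \<open>\<sigma> = 1\<close> belongs to the upper arc and \<open>\<sigma> = - 1\<close> to the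
  lower one.\<close>

definition lens_arc :: "complex \<Rightarrow> complex \<Rightarrow> complex" where
  "lens_arc \<sigma> z = (\<sigma> * sin (2 * of_real pi * z) + csqrt (1 + (sin (2 * of_real pi * z))\<^sup>2)) * exp (2 * of_real pi * \<i> * z)"

lemma sin_2pi_real: "sin (2 * of_real pi * complex_of_real s) = complex_of_real (sin (2 * pi * s))"
  by (metis of_real_mult of_real_numeral sin_of_real)

lemma cos_2pi_real: "cos (2 * of_real pi * complex_of_real s) = complex_of_real (cos (2 * pi * s))"
  by (metis of_real_mult of_real_numeral cos_of_real)

lemma one_plus_sin_real: "1 + (sin (2 * of_real pi * complex_of_real s))\<^sup>2 = complex_of_real (1 + (sin (2 * pi * s))\<^sup>2)"
  by (simp add: sin_2pi_real)

lemma one_plus_sin_real_nonpos: "1 + (sin (2 * of_real pi * complex_of_real s))\<^sup>2 \<notin> \<real>\<^sub>\<le>\<^sub>0"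
proof -
  have "\<not> 1 + (sin (2 * pi * s))\<^sup>2 \<le> 0" by (smt (verit) zero_le_power2)
  then show ?thesis unfolding one_plus_sin_real nonpos_Reals_of_real_iff .
qed

lemma csqrt_one_plus_sin_real:
  "csqrt (1 + (sin (2 * of_real pi * complex_of_real s))\<^sup>2) = complex_of_real (sqrt (1 + (sin (2 * pi * s))\<^sup>2))"
  unfolding one_plus_sin_real by (rule of_real_sqrt[symmetric]) (simp add: add_nonneg_nonneg)

lemma lens_arc_analytic: "lens_arc \<sigma> analytic_on (complex_of_real ` A)"
proof -
  define U :: "complex set" where "U = {z. 1 + (sin (2 * of_real pi * z))\<^sup>2 \<notin> \<real>\<^sub>\<le>\<^sub>0}"
  have "open ((\<lambda>z. 1 + (sin (2 * of_real pi * z))\<^sup>2) -` (- \<real>\<^sub>\<le>\<^sub>0) :: complex set)"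
    by (intro open_vimage continuous_intros) auto
  then have U: "open U" by (simp add: U_def vimage_def)
  have "lens_arc \<sigma> holomorphic_on U"
    unfolding lens_arc_def U_def by (intro holomorphic_intros) auto
  then have "lens_arc \<sigma> analytic_on U" using U analytic_on_open by blast
  then show ?thesis by (rule analytic_on_subset) (auto simp: U_def one_plus_sin_real_nonpos)
qed

lemma lens_arc_derivative:
  fixes s \<sigma> :: real
  defines "\<theta> \<equiv> 2 * pi * s"
  shows "(lens_arc (of_real \<sigma>) has_field_derivative
    2 * of_real pi * (of_real (\<sigma> * cos \<theta> + sin \<theta> * cos \<theta> / sqrt (1 + (sin \<theta>)\<^sup>2))
      + \<i> * of_real (\<sigma> * sin \<theta> + sqrt (1 + (sin \<theta>)\<^sup>2))) * exp (2 * of_real pi * \<i> * of_real s)) (at (of_real s))"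
proof -
  have ne: "sqrt (1 + (sin \<theta>)\<^sup>2) \<noteq> 0" by (smt (verit) real_sqrt_eq_zero_cancel_iff zero_le_power2)
  show ?thesis
    unfolding lens_arc_def[abs_def]
    apply (rule derivative_eq_intros refl one_plus_sin_real_nonpos | simp add: one_plus_sin_real_nonpos)+
    using ne unfolding csqrt_one_plus_sin_real sin_2pi_real cos_2pi_real \<theta>_def[symmetric]
    by (simp add: field_simps)
qed

lemma lens_arc_eq_path:
  assumes "\<sigma> * sin (2 * pi * s) = \<bar>sin (2 * pi * s)\<bar>"
  shows "lens_arc (of_real \<sigma>) (of_real s) = lens_path s"
  using assms unfolding lens_arc_def lens_path_def csqrt_one_plus_sin_real sin_2pi_real lens_radius_def
  by (simp flip: of_real_mult of_real_add)

lemma lens_analytic_arc: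
  assumes "\<And>s. s \<in> {a..b} \<Longrightarrow> \<sigma> * sin (2 * pi * s) = \<bar>sin (2 * pi * s)\<bar>"
  shows "analytic_arc lens_path a b"
  unfolding analytic_arc_def
proof (intro exI[of _ "lens_arc (of_real \<sigma>)"] conjI lens_arc_analytic ballI)
  fix s assume s: "s \<in> {a..b}"
  show "lens_arc (of_real \<sigma>) (of_real s) = lens_path s" by (rule lens_arc_eq_path[OF assms[OF s]])
  define \<theta> where "\<theta> = 2 * pi * s"
  define D where "D = complex_of_real (\<sigma> * cos \<theta> + sin \<theta> * cos \<theta> / sqrt (1 + (sin \<theta>)\<^sup>2))
      + \<i> * of_real (\<sigma> * sin \<theta> + sqrt (1 + (sin \<theta>)\<^sup>2))"
  \<comment> \<open>Up to the factor \<open>2 * pi\<close>, the velocity component perpendicular to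
    the position vector is the radius, and this cannot vanish.\<close>
  have "Im D = lens_radius \<theta>" using assms[OF s] by (simp add: D_def lens_radius_def \<theta>_def)
  then have "D \<noteq> 0" using lens_radius_pos[of \<theta>] by auto
  moreover have "deriv (lens_arc (of_real \<sigma>)) (of_real s) = 2 * of_real pi * D * exp (2 * of_real pi * \<i> * of_real s)"
    using lens_arc_derivative[of \<sigma> s] unfolding D_def \<theta>_def by (rule DERIV_imp_deriv)
  ultimately show "deriv (lens_arc (of_real \<sigma>)) (of_real s) \<noteq> 0" by simp
qed

lemma sin_upper: "s \<in> {0..1/2} \<Longrightarrow> 1 * sin (2 * pi * s) = \<bar>sin (2 * pi * s)\<bar>"
  using sin_ge_zero[of "2 * pi * s"] by (auto simp: field_simps)

lemma sin_lower: "s \<in> {1/2..1} \<Longrightarrow> - 1 * sin (2 * pi * s) = \<bar>sin (2 * pi * s)\<bar>"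
  using sin_le_zero[of "2 * pi * s"] by (cases "s = 1") (auto simp: field_simps)

lemma lens_corner_derivatives:
  "vector_derivative lens_path (at_right 0) = 2 * of_real pi * (1 + \<i>)"
  "vector_derivative lens_path (at_left (1/2)) = 2 * of_real pi * (1 - \<i>)"
  "vector_derivative lens_path (at_right (1/2)) = 2 * of_real pi * (- 1 - \<i>)"
  "vector_derivative lens_path (at_left 1) = 2 * of_real pi * (- 1 + \<i>)"
proof -
  have e: "exp (2 * of_real pi * \<i> * complex_of_real (1/2)) = - 1" "exp (2 * of_real pi * \<i> * complex_of_real 1) = 1"
    "exp (2 * of_real pi * \<i> * complex_of_real 0) = 1"
    unfolding exp_2pi_eq by (simp_all add: complex_eq_iff)
  note r = arc_vector_derivative_at_right and l = arc_vector_derivative_at_left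
  have 1: "lens_arc (of_real 1) (of_real s) = lens_path s" if "s \<in> {0..1/2}" for s
    by (rule lens_arc_eq_path[OF sin_upper[OF that]])
  have 2: "lens_arc (of_real (-1)) (of_real s) = lens_path s" if "s \<in> {1/2..1}" for s
    by (rule lens_arc_eq_path[OF sin_lower[OF that]])
  show "vector_derivative lens_path (at_right 0) = 2 * of_real pi * (1 + \<i>)"
    using r[of 0 "1/2", OF _ 1 lens_arc_derivative] e by (simp add: mult_ac)
  show "vector_derivative lens_path (at_left (1/2)) = 2 * of_real pi * (1 - \<i>)"
    using l[of 0 "1/2", OF _ 1 lens_arc_derivative] e by (simp add: mult_ac algebra_simps)
  show "vector_derivative lens_path (at_right (1/2)) = 2 * of_real pi * (- 1 - \<i>)"
    using r[of "1/2" 1, OF _ 2 lens_arc_derivative] e by (simp add: mult_ac algebra_simps)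
  show "vector_derivative lens_path (at_left 1) = 2 * of_real pi * (- 1 + \<i>)"
    using l[of "1/2" 1, OF _ 2 lens_arc_derivative] e by (simp add: mult_ac algebra_simps)
qed

lemma Arg2pi_ii': "Arg2pi \<i> = pi / 2"
proof -
  have "exp (\<i> * complex_of_real (pi / 2)) = \<i>" by (metis cis_conv_exp cis_pi_half)
  then show ?thesis by (intro Arg2pi_unique[of 1]) auto
qed

lemma lens_exterior_angle:
  assumes "j \<in> {1..2}" shows "exterior_angle lens_path 2 (\<lambda>j. real j / 2) j = 1 / 2"
proof -
  have q: "(2 * of_real pi * (- 1 - \<i>)) / (- (2 * of_real pi * (1 - \<i>))) = \<i>"
    "(2 * of_real pi * (1 + \<i>)) / (- (2 * of_real pi * (- 1 + \<i>))) = \<i>"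
    by (simp_all add: complex_eq_iff Re_divide Im_divide power2_eq_square field_simps)
  have n: "real 1 / 2 = 1 / 2" "real 2 / 2 = 1" "real 0 / 2 = 0" "(1::nat) = 2 \<longleftrightarrow> False" by simp_all
  have p: "pi / 2 / pi = 1 / 2" by simp
  consider "j = 1" | "j = 2" using assms by force
  then show ?thesis
  proof cases
    case 1
    show ?thesis unfolding exterior_angle_def Let_def \<open>j = 1\<close> n if_False lens_corner_derivatives q Arg2pi_ii' p ..
  next
    case 2
    show ?thesis unfolding exterior_angle_def Let_def \<open>j = 2\<close> n refl[THEN eqTrueI] if_True lens_corner_derivatives q Arg2pi_ii' p ..
  qed
qed

lemma lens_smallest_angle: "has_smallest_exterior_angle lens (1 / 2)"
  unfolding has_smallest_exterior_angle_def
proof (intro exI conjI)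
  show "piecewise_analytic_without_cusps lens lens_path 2 (\<lambda>j. real j / 2)"
    unfolding piecewise_analytic_without_cusps_def
  proof (intro conjI ballI allI impI simple_path_lens_path lens_path_loop path_image_lens_path winding_number_lens_path)
    fix j :: nat assume "j < 2"
    then consider "j = 0" | "j = 1" by linarith
    then show "analytic_arc lens_path (real j / 2) (real (Suc j) / 2)"
      by cases (use lens_analytic_arc[OF sin_upper] lens_analytic_arc[OF sin_lower] in auto)
  qed (auto simp: lens_exterior_angle)
  have "exterior_angle lens_path 2 (\<lambda>j. real j / 2) ` {1..2} = (\<lambda>_. 1 / 2) ` {1..2::nat}"
    by (rule image_cong[OF refl lens_exterior_angle])
  then show "1 / 2 = Min (exterior_angle lens_path 2 (\<lambda>j. real j / 2) ` {1..2})" by simp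
qed

section \<open>The Joukowski map as exterior map of the lens, and its coefficients\<close>

lemma norm_joukowski:
  "(cmod (z\<^sup>2 + 1))\<^sup>2 - (2 * cmod z)\<^sup>2 = ((cmod z)\<^sup>2 - 1)\<^sup>2 - (2 * \<bar>Im z\<bar>)\<^sup>2"
  unfolding power_mult_distrib cmod_power2 by (simp add: power2_eq_square algebra_simps)

definition joukowski :: "complex \<Rightarrow> complex" where "joukowski z = (z + 1 / z) / 2"

text \<open>The absolute value on the right reflects the invariance of \<open>joukowski\<close>
  under inversion: the points described are the exterior of the lens together with their
  reciprocals.\<close>

lemma norm_joukowski_gt_1:
  assumes "z \<noteq> 0" shows "cmod (joukowski z) > 1 \<longleftrightarrow> \<bar>(cmod z)\<^sup>2 - 1\<bar> > 2 * \<bar>Im z\<bar>"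
proof -
  have "joukowski z = (z\<^sup>2 + 1) / (2 * z)" using assms by (simp add: joukowski_def field_simps power2_eq_square)
  then have "cmod (joukowski z) > 1 \<longleftrightarrow> 2 * cmod z < cmod (z\<^sup>2 + 1)"
    using assms by (simp add: norm_divide norm_mult)
  also have "\<dots> \<longleftrightarrow> (2 * cmod z)\<^sup>2 < (cmod (z\<^sup>2 + 1))\<^sup>2"
    by (metis abs_le_square_iff abs_of_nonneg linorder_not_le norm_ge_zero mult_nonneg_nonneg zero_le_numeral)
  also have "\<dots> \<longleftrightarrow> (2 * \<bar>Im z\<bar>)\<^sup>2 < ((cmod z)\<^sup>2 - 1)\<^sup>2"
    using norm_joukowski[of z] by linarith
  also have "\<dots> \<longleftrightarrow> 2 * \<bar>Im z\<bar> < \<bar>(cmod z)\<^sup>2 - 1\<bar>"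
    by (metis abs_le_square_iff abs_of_nonneg abs_ge_zero linorder_not_le mult_nonneg_nonneg zero_le_numeral)
  finally show ?thesis .
qed

lemma outside_lens: "z \<notin> closure lens \<longleftrightarrow> (cmod z)\<^sup>2 - 1 > 2 * \<bar>Im z\<bar>"
  unfolding closure_lens by auto

text \<open>Two points with the same image are equal or reciprocal, and outside the lens every
  modulus exceeds \<open>1\<close>.\<close>

lemma inj_joukowski: "inj_on joukowski (- closure lens)"
proof (rule inj_onI)
  fix x y assume x: "x \<in> - closure lens" and y: "y \<in> - closure lens" and eq: "joukowski x = joukowski y"
  have m: "cmod x > 1" "cmod y > 1"
    using x y by (auto simp: outside_lens intro!: power_less_imp_less_base[of 1 2])
  then have nz: "x \<noteq> 0" "y \<noteq> 0" by auto
  have "x + 1 / x = y + 1 / y" using eq unfolding joukowski_def by (metis divide_cancel_right zero_neq_numeral)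
  then have "(x + 1 / x) * (x * y) = (y + 1 / y) * (x * y)" by simp
  then have "x * x * y + y = x * y * y + x" using nz by (simp add: distrib_left distrib_right mult_ac)
  then have "(x - y) * (x * y - 1) = 0" by (simp add: algebra_simps)
  moreover have "cmod (x * y) > 1" using m by (simp add: norm_mult less_1_mult)
  ultimately show "x = y" by (auto dest: arg_cong[of _ _ cmod])
qed

text \<open>This is \<open>w + sqrt (w^2 - 1)\<close> with \<open>w\<close> pulled out of the root:
  for \<open>cmod w > 1\<close> the number \<open>1 - 1 / w^2\<close> has positive real part, so the
  principal branch is holomorphic there and has a binomial expansion in
  \<open>1 / w^2\<close>.\<close>

definition joukowski_inv :: "complex \<Rightarrow> complex" where
  "joukowski_inv w = w * (1 + csqrt (1 - 1 / w\<^sup>2))"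

text \<open>The two preimages \<open>w * (1 + s)\<close> and \<open>w * (1 - s)\<close> of
  \<open>w\<close> have product \<open>1\<close>, and \<open>Re s \<ge> 0\<close> makes the former
  the larger one. Its modulus is thus at least \<open>1\<close>, which selects the exterior of the
  lens among the two regions allowed by \<open>norm_joukowski_gt_1\<close>.\<close>

lemma joukowski_inv:
  assumes w: "cmod w > 1"
  shows "joukowski (joukowski_inv w) = w" "joukowski_inv w \<notin> closure lens"
proof -
  define s where "s = csqrt (1 - 1 / w\<^sup>2)"
  have w0: "w \<noteq> 0" using w by auto
  have s2: "s\<^sup>2 = 1 - 1 / w\<^sup>2" by (simp add: s_def)
  have m: "(w * (1 + s)) * (w * (1 - s)) = 1"
  proof -
    have "(w * (1 + s)) * (w * (1 - s)) = w\<^sup>2 * (1 - s\<^sup>2)" by (simp add: power2_eq_square algebra_simps)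
    then show ?thesis using w0 by (simp add: s2)
  qed
  then have nz: "w * (1 + s) \<noteq> 0" by auto
  have inv: "1 / (w * (1 + s)) = w * (1 - s)" using m nz by (simp add: divide_simps mult_ac)
  have z: "joukowski_inv w = w * (1 + s)" by (simp add: joukowski_inv_def s_def)
  show J: "joukowski (joukowski_inv w) = w" unfolding joukowski_def z inv by (simp add: algebra_simps)
  have "0 \<le> Re s" using csqrt_principal[of "1 - 1 / w\<^sup>2"] unfolding s_def by linarith
  then have "cmod (1 - s) \<le> cmod (1 + s)" by (simp add: cmod_def power2_eq_square algebra_simps)
  then have "cmod (w * (1 - s)) \<le> cmod (w * (1 + s))" by (simp add: norm_mult mult_left_mono)
  moreover have "cmod (w * (1 + s)) * cmod (w * (1 - s)) = 1" using m by (metis norm_mult norm_one)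
  ultimately have "1 \<le> cmod (w * (1 + s)) * cmod (w * (1 + s))"
    by (metis mult_left_mono norm_ge_zero)
  then have "(cmod (joukowski_inv w))\<^sup>2 \<ge> 1" by (simp add: z power2_eq_square)
  moreover have "\<bar>(cmod (joukowski_inv w))\<^sup>2 - 1\<bar> > 2 * \<bar>Im (joukowski_inv w)\<bar>"
    using norm_joukowski_gt_1[of "joukowski_inv w"] w J nz z by simp
  ultimately show "joukowski_inv w \<notin> closure lens" by (simp add: outside_lens)
qed

lemma exterior_map_lens: "exterior_map lens joukowski (1 / 2)"
  unfolding exterior_map_def
proof (intro conjI)
  have nz: "z \<noteq> 0" if "z \<in> - closure lens" for z using that by (auto simp: outside_lens)
  show "joukowski holomorphic_on - closure lens"
    unfolding joukowski_def[abs_def] by (intro holomorphic_intros) (use nz in auto)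
  show "bij_betw joukowski (- closure lens) {w. 1 < cmod w}"
    unfolding bij_betw_def
  proof (intro conjI inj_joukowski equalityI subsetI)
    fix w assume "w \<in> joukowski ` (- closure lens)"
    then obtain z where z: "z \<in> - closure lens" "w = joukowski z" by auto
    then show "w \<in> {w. 1 < cmod w}"
      using norm_joukowski_gt_1[OF nz[OF z(1)]] by (auto simp: outside_lens)
  next
    fix w assume "w \<in> {w. 1 < cmod w}"
    then show "w \<in> joukowski ` (- closure lens)"
      using joukowski_inv[of w] by (intro image_eqI[of _ _ "joukowski_inv w"]) auto
  qed
  show "\<exists>c R. laurent_at_infinity joukowski (complex_of_real (1 / 2)) c R"
  proof (intro exI)
    show "laurent_at_infinity joukowski (complex_of_real (1 / 2)) (\<lambda>n. if n = 1 then 1 / 2 else 0) 0"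
      unfolding laurent_at_infinity_def
    proof (intro allI impI)
      fix z :: complex assume "0 < cmod z"
      have "(\<lambda>n. if n = 1 then 1 / 2 / z ^ n else 0) sums (1 / 2 / z ^ 1)" by (rule sums_single)
      moreover have "joukowski z - complex_of_real (1 / 2) * z = 1 / 2 / z ^ 1"
        by (simp add: joukowski_def field_simps)
      moreover have "(\<lambda>n. (if n = 1 then 1 / 2 else 0) / z ^ n) = (\<lambda>n. if n = 1 then 1 / 2 / z ^ n else 0)" by auto
      ultimately show "(\<lambda>n. (if n = 1 then 1 / 2 else 0) / z ^ n) sums (joukowski z - complex_of_real (1 / 2) * z)"
        by simp
    qed
  qed
qed simp

text \<open>In the binomial series for \<open>csqrt (1 - 1 / w^2)\<close>, multiplied by
  \<open>w\<close>, the term of index \<open>k + 1\<close> carries the power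
  \<open>1 / w ^ (2 * k + 1)\<close>; for \<open>n = 2 * k + 1\<close> this index is
  \<open>Suc (n div 2)\<close>. The term of index 0 has become part of the leading term
  \<open>2 * w\<close>.\<close>

definition lens_coeff :: "nat \<Rightarrow> complex" where
  "lens_coeff n = (if odd n then ((1 / 2) gchoose Suc (n div 2)) * (- 1) ^ Suc (n div 2) else 0)"

lemma lens_coeffs: "inverse_map_coeffs lens lens_coeff"
  unfolding inverse_map_coeffs_def
proof (rule exI[of _ joukowski], rule exI[of _ "1 / 2"], rule conjI[OF exterior_map_lens])
  have "inv_into (- closure lens) joukowski w = joukowski_inv w" if "cmod w > 1" for w
    by (rule inv_into_f_eq[OF inj_joukowski]) (use joukowski_inv[OF that] in auto)
  moreover have "(\<lambda>n. lens_coeff n / w ^ n) sums (joukowski_inv w - 2 * w)" if w: "cmod w > 1" for w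
  proof -
    have w0: "w \<noteq> 0" using w by auto
    define f where "f k = ((1 / 2) gchoose k) * (- 1 / w\<^sup>2) ^ k" for k
    have f0: "f 0 = 1" by (simp add: f_def)
    have "cmod (- 1 / w\<^sup>2) < 1"
      using w by (simp add: norm_divide norm_power divide_less_eq_1 one_less_power)
    then have "f sums (1 + (- 1 / w\<^sup>2)) powr (1 / 2)"
      unfolding f_def by (rule gen_binomial_complex)
    also have "(1 + (- 1 / w\<^sup>2)) powr (1 / 2) = csqrt (1 - 1 / w\<^sup>2)"
    proof (cases "1 - 1 / w\<^sup>2 = 0")
      case True then show ?thesis by simp
    next
      case False then show ?thesis by (simp add: csqrt_conv_powr)
    qed
    finally have "(\<lambda>k. f (Suc k)) sums (csqrt (1 - 1 / w\<^sup>2) - 1)"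
      using sums_Suc_iff[of f "csqrt (1 - 1 / w\<^sup>2) - 1"] f0 by simp
    then have "(\<lambda>k. w * f (Suc k)) sums (w * (csqrt (1 - 1 / w\<^sup>2) - 1))" by (rule sums_mult)
    moreover have "w * f (Suc k) = lens_coeff (2 * k + 1) / w ^ (2 * k + 1)" for k
    proof -
      have "(- 1 / w\<^sup>2) ^ Suc k = (- 1) ^ Suc k / (w ^ (2 * k + 1) * w)"
        by (simp only: power_divide flip: power_mult power_Suc2) simp
      then show ?thesis using w0 by (simp add: f_def lens_coeff_def)
    qed
    ultimately have "(\<lambda>k. lens_coeff (2 * k + 1) / w ^ (2 * k + 1)) sums (w * (csqrt (1 - 1 / w\<^sup>2) - 1))"
      by simp
    moreover have "strict_mono (\<lambda>k::nat. 2 * k + 1)" by (auto simp: strict_mono_def)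
    moreover have "lens_coeff n / w ^ n = 0" if "n \<notin> range (\<lambda>k. 2 * k + 1)" for n
      using that by (auto simp: lens_coeff_def elim!: oddE)
    ultimately have "(\<lambda>n. lens_coeff n / w ^ n) sums (w * (csqrt (1 - 1 / w\<^sup>2) - 1))"
      using sums_mono_reindex[of "\<lambda>k::nat. 2 * k + 1" "\<lambda>n. lens_coeff n / w ^ n"] by blast
    then show ?thesis by (simp add: joukowski_inv_def algebra_simps)
  qed
  ultimately show "laurent_at_infinity (inv_into (- closure lens) joukowski) (complex_of_real (1 / (1 / 2))) lens_coeff 1"
    unfolding laurent_at_infinity_def by simp
qed

text \<open>With \<open>m = 2 * j + 1\<close>, consecutive coefficients have the ratio
  \<open>m / (m + 3)\<close> in modulus, and \<open>(m + 3)^2 * m \<le> (m + 2)^3\<close>. Hence the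
  normalized product does not decrease, and it starts at \<open>1 / 2\<close>.\<close>

lemma gbinomial_half_lower:
  "cmod ((1 / 2) gchoose Suc j) * (real (2 * j + 1) * sqrt (real (2 * j + 1))) \<ge> 1 / 2"
proof (induction j)
  case 0
  then show ?case by simp
next
  case (Suc j)
  define m where "m = real (2 * j + 1)"
  have m: "m \<ge> 1" by (simp add: m_def)
  define A where "A = cmod ((1 / 2) gchoose Suc j)"
  have "(1 / 2 - of_nat (Suc j)) * ((1 / 2 :: complex) gchoose Suc j) = of_nat (Suc (Suc j)) * ((1 / 2) gchoose Suc (Suc j))"
    by (simp only: left_diff_distrib gbinomial_mult_1[of "1 / 2 :: complex" "Suc j"] add_diff_cancel_left')
  then have e1: "cmod (1 / 2 - of_nat (Suc j)) * A = real (Suc (Suc j)) * cmod ((1 / 2) gchoose Suc (Suc j))"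
    unfolding A_def by (metis norm_mult norm_of_nat)
  have e2: "cmod (1 / 2 - of_nat (Suc j)) = m / 2"
  proof -
    have "1 / 2 - of_nat (Suc j) = complex_of_real (- m / 2)" by (simp add: m_def field_simps)
    then have "cmod (1 / 2 - of_nat (Suc j)) = \<bar>- m / 2\<bar>" by (simp only: norm_of_real)
    then show ?thesis using m by simp
  qed
  have e3: "real (Suc (Suc j)) = (m + 3) / 2" by (simp add: m_def)
  have "m / 2 * A = (m + 3) / 2 * cmod ((1 / 2) gchoose Suc (Suc j))" using e1 unfolding e2 e3 .
  then have r: "cmod ((1 / 2) gchoose Suc (Suc j)) = A * m / (m + 3)"
    using m by (simp add: field_simps)
  have "m * sqrt m \<le> m * ((m + 2) * sqrt (m + 2)) / (m + 3)"
  proof -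
    have "(m + 3) * sqrt m = sqrt ((m + 3)\<^sup>2 * m)" using m by (simp add: real_sqrt_mult)
    also have "\<dots> \<le> sqrt ((m + 2)\<^sup>2 * (m + 2))"
    proof (rule real_sqrt_le_mono)
      show "(m + 3)\<^sup>2 * m \<le> (m + 2)\<^sup>2 * (m + 2)" using m by (simp add: power2_eq_square algebra_simps)
    qed
    also have "\<dots> = (m + 2) * sqrt (m + 2)" using m by (simp add: real_sqrt_mult)
    finally have "m * ((m + 3) * sqrt m) \<le> m * ((m + 2) * sqrt (m + 2))"
      using m by (intro mult_left_mono) auto
    then show ?thesis using m by (simp add: pos_le_divide_eq mult_ac)
  qed
  then have e4: "A * (m * sqrt m) \<le> A * (m * ((m + 2) * sqrt (m + 2)) / (m + 3))"
    by (intro mult_left_mono) (auto simp: A_def)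
  have e5: "1 / 2 \<le> A * (m * sqrt m)" using Suc by (simp add: A_def m_def)
  have e6: "real (2 * Suc j + 1) = m + 2" by (simp add: m_def)
  have "1 / 2 \<le> A * (m * ((m + 2) * sqrt (m + 2)) / (m + 3))" by (rule order_trans[OF e5 e4])
  also have "\<dots> = A * m / (m + 3) * ((m + 2) * sqrt (m + 2))" by simp
  finally show ?case unfolding r e6 .
qed

lemma lens_coeff_lower:
  assumes "odd n" shows "cmod (lens_coeff n) \<ge> (1 / 2) * (1 / real n powr (1 + 1 / 2))"
proof -
  obtain j where j: "n = 2 * j + 1" using assms by (elim oddE)
  have "cmod (lens_coeff n) = cmod ((1 / 2) gchoose Suc j)"
    by (simp add: lens_coeff_def j norm_mult norm_power)
  moreover have p: "real n > 0" by (simp add: j)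
  moreover have "real n powr (1 + 1 / 2) = real n * sqrt (real n)"
    using p by (subst powr_add) (simp add: powr_half_sqrt)
  moreover have "1 / 2 \<le> cmod ((1 / 2) gchoose Suc j) * (real n * sqrt (real n))"
    using gbinomial_half_lower[of j] by (simp add: j)
  ultimately show ?thesis by (simp add: divide_le_eq mult_ac)
qed

lemma sharpness_example:
  "\<exists>\<omega>::real. 0 < \<omega> \<and> \<omega> < 2 \<and>
            (\<exists>G b. jordan_domain G \<and> has_smallest_exterior_angle G \<omega> \<and> inverse_map_coeffs G b \<and>
               (\<exists>c2::real. c2 > 0 \<and>
                  infinite {n. n \<ge> 1 \<and> cmod (b n) \<ge> c2 * (1 / real n powr (1 + \<omega>))}))"
proof (intro exI conjI)
  show "jordan_domain lens" "has_smallest_exterior_angle lens (1 / 2)" "inverse_map_coeffs lens lens_coeff"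
    by (rule jordan_domain_lens lens_smallest_angle lens_coeffs)+
  have "infinite (range (\<lambda>j::nat. 2 * j + 1))" by (intro range_inj_infinite) (auto simp: inj_def)
  moreover have "range (\<lambda>j. 2 * j + 1) \<subseteq> {n. n \<ge> 1 \<and> cmod (lens_coeff n) \<ge> 1 / 2 * (1 / real n powr (1 + 1 / 2))}"
  proof
    fix n assume "n \<in> range (\<lambda>j::nat. 2 * j + 1)"
    then have "odd n" "n \<ge> 1" by auto
    then show "n \<in> {n. n \<ge> 1 \<and> cmod (lens_coeff n) \<ge> 1 / 2 * (1 / real n powr (1 + 1 / 2))}"
      using lens_coeff_lower[of n] by (intro CollectI conjI)
  qed
  ultimately show "infinite {n. n \<ge> 1 \<and> cmod (lens_coeff n) \<ge> 1 / 2 * (1 / real n powr (1 + 1 / 2))}"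
    using infinite_super by blast
qed auto

section \<open>Reflection across an analytic arc\<close>

text \<open>
  An arc is traversed with the exterior on its right, so the lower half of the rhombus around
  its parameter interval is the part that is mapped into the exterior domain.
\<close>

definition lower_half :: "real \<Rightarrow> real \<Rightarrow> real \<Rightarrow> complex set" where
  "lower_half a b \<kappa> = {\<zeta>. Im \<zeta> < 0 \<and> - Im \<zeta> < \<kappa> * (Re \<zeta> - a) \<and> - Im \<zeta> < \<kappa> * (b - Re \<zeta>)}"

definition upper_half :: "real \<Rightarrow> real \<Rightarrow> real \<Rightarrow> complex set" where
  "upper_half a b \<kappa> = {\<zeta>. Im \<zeta> > 0 \<and> Im \<zeta> < \<kappa> * (Re \<zeta> - a) \<and> Im \<zeta> < \<kappa> * (b - Re \<zeta>)}"

lemma lower_half_halfspaces: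
  "lower_half a b \<kappa> = {\<zeta>. inner \<i> \<zeta> < 0} \<inter> {\<zeta>. inner (Complex (- \<kappa>) (- 1)) \<zeta> < - \<kappa> * a}
     \<inter> {\<zeta>. inner (Complex \<kappa> (- 1)) \<zeta> < \<kappa> * b}"
  by (auto simp: lower_half_def inner_complex_def algebra_simps)

lemma upper_half_halfspaces:
  "upper_half a b \<kappa> = {\<zeta>. inner (- \<i>) \<zeta> < 0} \<inter> {\<zeta>. inner (Complex (- \<kappa>) 1) \<zeta> < - \<kappa> * a}
     \<inter> {\<zeta>. inner (Complex \<kappa> 1) \<zeta> < \<kappa> * b}"
  by (auto simp: upper_half_def inner_complex_def algebra_simps)

lemma open_upper_half: "open (upper_half a b \<kappa>)"
  unfolding upper_half_halfspaces by (intro open_Int open_halfspace_lt)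

lemma convex_lower_half: "convex (lower_half a b \<kappa>)"
  unfolding lower_half_halfspaces by (intro convex_Int convex_halfspace_lt)

lemma convex_upper_half: "convex (upper_half a b \<kappa>)"
  unfolding upper_half_halfspaces by (intro convex_Int convex_halfspace_lt)

lemma cnj_upper_half: "cnj \<zeta> \<in> lower_half a b \<kappa> \<longleftrightarrow> \<zeta> \<in> upper_half a b \<kappa>"
  by (simp add: lower_half_def upper_half_def)

lemma lower_halfI:
  assumes "x \<in> {a + \<epsilon>..b - \<epsilon>}" "0 < \<eta>" "\<eta> < \<kappa> * \<epsilon>" "\<kappa> > 0"
  shows "of_real x - \<i> * of_real \<eta> \<in> lower_half a b \<kappa>"
    and "of_real x + \<i> * of_real \<eta> \<in> upper_half a b \<kappa>"
proof -
  have "\<kappa> * \<epsilon> \<le> \<kappa> * (x - a)" "\<kappa> * \<epsilon> \<le> \<kappa> * (b - x)"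
    using assms by (auto intro!: mult_left_mono)
  then have "\<eta> < \<kappa> * (x - a)" "\<eta> < \<kappa> * (b - x)" using assms by linarith+
  then show "of_real x - \<i> * of_real \<eta> \<in> lower_half a b \<kappa>"
    "of_real x + \<i> * of_real \<eta> \<in> upper_half a b \<kappa>"
    using assms(2) by (simp_all add: lower_half_def upper_half_def)
qed

text \<open>Schwarz reflection, in the real axis for the variable and in the unit circle for the
  value.\<close>

definition reflection :: "(complex \<Rightarrow> complex) \<Rightarrow> complex \<Rightarrow> complex" where
  "reflection F \<zeta> = 1 / cnj (F (cnj \<zeta>))"

lemma reflection_holomorphic:
  assumes "F holomorphic_on lower_half a b \<kappa>" "\<And>\<zeta>. \<zeta> \<in> lower_half a b \<kappa> \<Longrightarrow> F \<zeta> \<noteq> 0"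
  shows "reflection F holomorphic_on upper_half a b \<kappa>"
proof -
  have eq: "cnj ` upper_half a b \<kappa> = lower_half a b \<kappa>"
  proof
    show "lower_half a b \<kappa> \<subseteq> cnj ` upper_half a b \<kappa>"
    proof
      fix x assume "x \<in> lower_half a b \<kappa>"
      then have "cnj x \<in> upper_half a b \<kappa>" using cnj_upper_half[of "cnj x"] by simp
      then show "x \<in> cnj ` upper_half a b \<kappa>" by (intro image_eqI[of _ _ "cnj x"]) auto
    qed
  qed (auto simp: cnj_upper_half)
  have "cnj \<circ> F \<circ> cnj holomorphic_on upper_half a b \<kappa>"
    by (rule holomorphic_on_compose_cnj_cnj) (simp_all add: eq assms open_upper_half)
  then have "(\<lambda>\<zeta>. 1 / (cnj \<circ> F \<circ> cnj) \<zeta>) holomorphic_on upper_half a b \<kappa>"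
    by (rule holomorphic_on_divide[OF holomorphic_on_const]) (use assms(2) cnj_upper_half in auto)
  then show ?thesis by (simp add: reflection_def[abs_def] o_def)
qed

text \<open>\<open>w\<close> and its mirror image \<open>1 / cnj w\<close> have the same argument,
  so their \<open>n\<close>th powers differ by exactly \<open>cmod w ^ n - 1 / cmod w ^ n\<close> in
  modulus. Hence \<open>cmod w\<close> close to \<open>1\<close> suffices for closeness; the
  argument of \<open>w\<close> need not be controlled.\<close>

lemma reflection_difference:
  fixes w :: complex
  assumes "cmod w \<ge> 1"
  shows "cmod (w ^ n * x - (1 / cnj w) ^ n * y) \<le> (cmod w ^ n - 1 / cmod w ^ n) * cmod x + cmod (x - y)"
proof -
  have w: "w \<noteq> 0" using assms by auto
  define v where "v = 1 / cnj w"
  have "v = w / (of_real (cmod w))\<^sup>2"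
    using w complex_norm_square[of w] by (simp add: v_def divide_simps mult_ac)
  then have "v ^ n = w ^ n / of_real ((cmod w ^ n)\<^sup>2)"
    by (simp add: power_divide mult.commute flip: power_mult)
  then have "w ^ n - v ^ n = w ^ n * of_real (1 - 1 / (cmod w ^ n)\<^sup>2)" by (simp add: algebra_simps)
  moreover have w1: "cmod w ^ n \<ge> 1" using assms by (rule one_le_power)
  then have "1 / (cmod w ^ n)\<^sup>2 \<le> 1" by (simp add: divide_le_eq one_le_power)
  ultimately have "cmod (w ^ n - v ^ n) = cmod w ^ n * (1 - 1 / (cmod w ^ n)\<^sup>2)"
    by (simp only: norm_mult norm_of_real norm_power)
  also have "\<dots> = cmod w ^ n - 1 / cmod w ^ n"
    using w by (simp add: right_diff_distrib power2_eq_square)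
  finally have 1: "cmod (w ^ n - v ^ n) = cmod w ^ n - 1 / cmod w ^ n" .
  have "cmod v \<le> 1" using assms by (simp add: v_def norm_divide divide_le_eq_1)
  then have "cmod (v ^ n) \<le> 1" by (simp add: norm_power power_le_one)
  then have "cmod (v ^ n) * cmod (x - y) \<le> 1 * cmod (x - y)" by (intro mult_right_mono) auto
  moreover have "w ^ n * x - v ^ n * y = (w ^ n - v ^ n) * x + v ^ n * (x - y)" by (simp add: algebra_simps)
  then have "cmod (w ^ n * x - v ^ n * y) \<le> cmod (w ^ n - v ^ n) * cmod x + cmod (v ^ n) * cmod (x - y)"
    by (metis norm_mult norm_triangle_ineq)
  ultimately have "cmod (w ^ n * x - v ^ n * y) \<le> (cmod w ^ n - 1 / cmod w ^ n) * cmod x + cmod (x - y)"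
    by (simp add: 1)
  then show ?thesis by (simp only: v_def)
qed

lemma has_vector_derivative_vertical_shift:
  assumes "(R has_field_derivative D) (at (of_real x + c))"
  shows "((\<lambda>x. R (of_real x + c)) has_vector_derivative D) (at x within A)"
proof -
  have "((\<lambda>z. R (z + c)) has_field_derivative D * 1) (at (of_real x))"
    by (rule DERIV_chain2[where f = R and g = "\<lambda>z. z + c", OF assms]) (auto intro!: derivative_eq_intros)
  then show ?thesis by (intro has_vector_derivative_real_field) simp
qed

text \<open>
  Integrals over the segments at heights \<open>- \<eta>\<close> and \<open>\<eta>\<close> are compared as \<open>\<eta> \<rightarrow> 0\<close>. This uses only that
  \<open>cmod (F \<zeta>)\<close> tends to \<open>1\<close> on the open segment; \<open>F\<close> itself is never extended to the boundary.
\<close>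

lemma reflected_arc_estimate:
  fixes F g q R :: "complex \<Rightarrow> complex" and L :: "real \<Rightarrow> complex"
  assumes \<kappa>: "0 < \<kappa>'" "\<kappa>' < \<kappa>"
    and n: "n \<ge> 1" and \<omega>: "\<omega> > 0" and B: "B \<ge> 0"
    and F: "F holomorphic_on lower_half a b \<kappa>"
    and F1: "\<And>\<zeta>. \<zeta> \<in> lower_half a b \<kappa> \<Longrightarrow> cmod (F \<zeta>) > 1"
    and M: "\<And>\<zeta>. \<zeta> \<in> lower_half a b \<kappa> \<Longrightarrow> cmod (F \<zeta>) \<le> M"
    and lim: "\<And>x. a < x \<Longrightarrow> x < b \<Longrightarrow> ((\<lambda>\<zeta>. cmod (F \<zeta>)) \<longlongrightarrow> 1) (at (of_real x) within lower_half a b \<kappa>)"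
    and g: "g holomorphic_on S" "open S" "upper_half a b \<kappa> \<subseteq> S" "lower_half a b \<kappa> \<subseteq> S" "of_real ` {a<..<b} \<subseteq> S"
    and gB: "\<And>\<zeta>. \<zeta> \<in> upper_half a b \<kappa> \<union> lower_half a b \<kappa> \<Longrightarrow> cmod (g \<zeta>) \<le> B"
    and q: "\<And>x. a < x \<Longrightarrow> x < b \<Longrightarrow> isCont q (of_real x)"
    and Q: "\<And>\<zeta>. \<zeta> \<in> lower_half a b \<kappa> \<Longrightarrow> cmod (q \<zeta>) \<le> Q"
    and R: "\<And>\<zeta>. \<zeta> \<in> lower_half a b \<kappa> \<Longrightarrow> (R has_field_derivative (F \<zeta> ^ n * g \<zeta> + \<beta> * q \<zeta>)) (at \<zeta>)"
    and L: "\<And>x. a < x \<Longrightarrow> x < b \<Longrightarrow> (L has_vector_derivative q (of_real x)) (at x)"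
    and K: "\<And>x. x \<ge> 0 \<Longrightarrow> exp (- c * x powr (1 / \<omega>)) \<le> K / (1 + x)\<^sup>2"
    and h: "h = (b - a) / 2"
    and decay_a: "\<And>s. 0 < s \<Longrightarrow> s \<le> h \<Longrightarrow> exp (c * s powr (1 / \<omega>)) \<le> cmod (F (of_real a + of_real s * Complex 1 (- \<kappa>')))"
    and decay_b: "\<And>s. 0 < s \<Longrightarrow> s \<le> h \<Longrightarrow> exp (c * s powr (1 / \<omega>)) \<le> cmod (F (of_real b - of_real s * Complex 1 \<kappa>'))"
    and \<epsilon>: "0 < \<epsilon>" "\<epsilon> < h"
  shows "cmod (R (of_real b - of_real \<epsilon> * Complex 1 \<kappa>') - R (of_real a + of_real \<epsilon> * Complex 1 (- \<kappa>'))
      - \<beta> * (L (b - \<epsilon>) - L (a + \<epsilon>)))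
    \<le> 2 * (K * B * cmod (Complex 1 \<kappa>') / real n powr \<omega>) + 2 * (\<kappa>' * \<epsilon> * (M ^ n * B + cmod \<beta> * Q + B))"
proof (rule field_le_epsilon)
  fix e :: real assume e: "e > 0"
  have ab: "a < b" using \<epsilon> h by auto
  let ?Vm = "lower_half a b \<kappa>" and ?Vp = "upper_half a b \<kappa>"
  have F0: "F \<zeta> \<noteq> 0" if "\<zeta> \<in> ?Vm" for \<zeta> using F1[OF that] by auto
  define G where "G = reflection F"
  have Gh: "G holomorphic_on ?Vp"
    unfolding G_def by (rule reflection_holomorphic[OF F F0])
  have G1: "cmod (G \<zeta>) \<le> 1" if "\<zeta> \<in> ?Vp" for \<zeta>
    using F1[of "cnj \<zeta>"] that by (auto simp: cnj_upper_half G_def reflection_def norm_divide divide_le_eq_1)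
  have hol: "(\<lambda>\<zeta>. G \<zeta> ^ n * g \<zeta>) holomorphic_on ?Vp"
    by (intro holomorphic_intros Gh holomorphic_on_subset[OF g(1) g(3)])
  obtain T where T0: "\<And>\<zeta>. \<zeta> \<in> ?Vp \<Longrightarrow> (T has_field_derivative (G \<zeta> ^ n * g \<zeta>)) (at \<zeta> within ?Vp)"
    using holomorphic_convex_primitive'[OF convex_upper_half open_upper_half hol] by blast
  have T: "(T has_field_derivative (G \<zeta> ^ n * g \<zeta>)) (at \<zeta>)" if "\<zeta> \<in> ?Vp" for \<zeta>
    using T0[OF that] by (simp only: at_within_open[OF that open_upper_half])
  have TB: "cmod (G \<zeta> ^ n * g \<zeta>) \<le> B" if "\<zeta> \<in> ?Vp" for \<zeta>
  proof -
    have "cmod (G \<zeta>) ^ n * cmod (g \<zeta>) \<le> 1 * B"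
      using gB[of \<zeta>] G1[OF that] that by (intro mult_mono power_le_one) auto
    then show ?thesis by (simp add: norm_mult norm_power)
  qed
  have RB: "cmod (F \<zeta> ^ n * g \<zeta> + \<beta> * q \<zeta>) \<le> M ^ n * B + cmod \<beta> * Q" if "\<zeta> \<in> ?Vm" for \<zeta>
  proof -
    have "cmod (F \<zeta>) ^ n * cmod (g \<zeta>) \<le> M ^ n * B"
      using gB[of \<zeta>] M[OF that] that by (intro mult_mono power_mono) (auto intro: zero_le_power order_trans[OF norm_ge_zero])
    moreover have "cmod \<beta> * cmod (q \<zeta>) \<le> cmod \<beta> * Q" using Q[OF that] by (intro mult_left_mono) auto
    moreover have "cmod (F \<zeta> ^ n * g \<zeta> + \<beta> * q \<zeta>) \<le> cmod (F \<zeta>) ^ n * cmod (g \<zeta>) + cmod \<beta> * cmod (q \<zeta>)"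
      by (metis norm_mult norm_power norm_triangle_ineq)
    ultimately show ?thesis by linarith
  qed
  \<comment> \<open>A bound for the mismatch of the three derivatives at a point, at its mirror
    image and at its real part. Each summand tends to 0 at the open segment.\<close>
  define E where "E \<zeta> = (cmod (F \<zeta>) ^ n - 1 / cmod (F \<zeta>) ^ n) * B + cmod (g \<zeta> - g (cnj \<zeta>)) + cmod \<beta> * cmod (q \<zeta> - q (of_real (Re \<zeta>)))" for \<zeta>
  have "(E \<longlongrightarrow> 0) (at (of_real x) within ?Vm)" if x: "x \<in> {a + \<epsilon>..b - \<epsilon>}" for x
  proof -
    have x': "a < x" "x < b" using x \<epsilon> by auto
    have "((\<lambda>\<zeta>. (cmod (F \<zeta>) ^ n - 1 / cmod (F \<zeta>) ^ n) * B) \<longlongrightarrow> (1 ^ n - 1 / 1 ^ n) * B) (at (of_real x) within ?Vm)"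
      by (intro tendsto_intros lim x') auto
    moreover have "complex_of_real x \<in> S" using g(5) x' by auto
    then have gc: "isCont g (of_real x)"
      using g(2) holomorphic_on_imp_continuous_on[OF g(1)] by (simp add: continuous_on_eq_continuous_at)
    have "((\<lambda>\<zeta>. cnj \<zeta>) \<longlongrightarrow> of_real x) (at (of_real x) within ?Vm)"
      by (rule tendsto_eq_intros) (auto intro!: tendsto_eq_intros)
    then have "((\<lambda>\<zeta>. cmod (g \<zeta> - g (cnj \<zeta>))) \<longlongrightarrow> cmod (g (of_real x) - g (of_real x))) (at (of_real x) within ?Vm)"
      using gc by (intro tendsto_norm tendsto_diff isCont_tendsto_compose[OF gc] tendsto_ident_at)
    moreover have "((\<lambda>\<zeta>. complex_of_real (Re \<zeta>)) \<longlongrightarrow> of_real x) (at (of_real x) within ?Vm)"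
      by (rule tendsto_eq_intros) (auto intro!: tendsto_eq_intros)
    then have "((\<lambda>\<zeta>. cmod \<beta> * cmod (q \<zeta> - q (of_real (Re \<zeta>)))) \<longlongrightarrow> cmod \<beta> * cmod (q (of_real x) - q (of_real x))) (at (of_real x) within ?Vm)"
      using q[OF x'] by (intro tendsto_mult tendsto_const tendsto_norm tendsto_diff isCont_tendsto_compose[OF q[OF x']] tendsto_ident_at)
    ultimately have "(E \<longlongrightarrow> (1 ^ n - 1 / 1 ^ n) * B + cmod (g (of_real x) - g (of_real x)) + cmod \<beta> * cmod (q (of_real x) - q (of_real x))) (at (of_real x) within ?Vm)"
      unfolding E_def by (intro tendsto_add)
    then show ?thesis by simp
  qed
  moreover define \<delta> where "\<delta> = e / (b - a)"
  have \<delta>: "\<delta> > 0" using e ab by (simp add: \<delta>_def)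
  ultimately obtain r where r: "r > 0" "\<And>x \<eta>. x \<in> {a + \<epsilon>..b - \<epsilon>} \<Longrightarrow> 0 < \<eta> \<Longrightarrow> \<eta> < r \<Longrightarrow>
      of_real x - \<i> * of_real \<eta> \<in> ?Vm \<Longrightarrow> \<bar>E (of_real x - \<i> * of_real \<eta>)\<bar> < \<delta>"
    using uniform_approach_to_segment by metis
  \<comment> \<open>Below the uniformity radius \<open>r\<close>, so that \<open>E\<close> is small
    at this height, and below \<open>\<kappa>' * \<epsilon>\<close>, so that the ends of both
    segments lie in the rhombus, vertically within \<open>\<kappa>' * \<epsilon>\<close> of the
    points of the rays.\<close>
  define \<eta> where "\<eta> = min r (\<kappa>' * \<epsilon>) / 2"
  have ke: "\<kappa>' * \<epsilon> > 0" "\<kappa>' * \<epsilon> < \<kappa> * \<epsilon>" using \<kappa> \<epsilon> by auto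
  have \<eta>: "0 < \<eta>" "\<eta> < r" "\<eta> < \<kappa>' * \<epsilon>" using r(1) ke by (auto simp: \<eta>_def min_def field_simps)
  have \<kappa>0: "\<kappa> > 0" using \<kappa> by simp
  have \<eta>\<kappa>: "\<eta> < \<kappa> * \<epsilon>" using \<eta> ke by linarith
  define zm where "zm x = of_real x + (- (\<i> * of_real \<eta>))" for x
  define zp where "zp x = of_real x + \<i> * of_real \<eta>" for x
  have zm: "zm x \<in> ?Vm" and zp: "zp x \<in> ?Vp" and cz: "cnj (zm x) = zp x" "cnj (zp x) = zm x" "Re (zm x) = x"
    if "x \<in> {a + \<epsilon>..b - \<epsilon>}" for x
    using lower_halfI[OF that \<eta>(1) \<eta>\<kappa> \<kappa>0] by (auto simp: zm_def zp_def)
  \<comment> \<open>Its derivative is at most \<open>\<delta>\<close>, so the increment of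
    \<open>R\<close> below the segment equals that of \<open>T\<close> above it plus the increment
    of \<open>\<beta> * L\<close>, up to the error \<open>e\<close>.\<close>
  define D where "D x = R (zm x) - T (zp x) - \<beta> * L x" for x
  define D' where "D' x = (F (zm x) ^ n * g (zm x) + \<beta> * q (zm x)) - G (zp x) ^ n * g (zp x) - \<beta> * q (of_real x)" for x
  have DD: "(D has_vector_derivative D' x) (at x)" if x: "x \<in> {a + \<epsilon>..b - \<epsilon>}" for x
  proof -
    have "((\<lambda>x. R (zm x)) has_vector_derivative (F (zm x) ^ n * g (zm x) + \<beta> * q (zm x))) (at x)"
      using R[OF zm[OF x]] unfolding zm_def by (rule has_vector_derivative_vertical_shift)
    moreover have "((\<lambda>x. T (zp x)) has_vector_derivative (G (zp x) ^ n * g (zp x))) (at x)"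
      using T[OF zp[OF x]] unfolding zp_def by (rule has_vector_derivative_vertical_shift)
    moreover have "((\<lambda>x. \<beta> * L x) has_vector_derivative \<beta> * q (of_real x)) (at x)"
      by (rule has_vector_derivative_mult_right[OF L]) (use x \<epsilon> in auto)
    ultimately show ?thesis unfolding D_def D'_def by (intro has_vector_derivative_diff)
  qed
  have D'\<delta>: "cmod (D' x) \<le> \<delta>" if x: "x \<in> {a + \<epsilon>..b - \<epsilon>}" for x
  proof -
    have m: "zm x \<in> ?Vm" "zp x \<in> ?Vp" using zm zp x by auto
    have "G (zp x) = 1 / cnj (F (zm x))" by (simp add: G_def reflection_def cz[OF x])
    then have "cmod (F (zm x) ^ n * g (zm x) - G (zp x) ^ n * g (zp x))
      \<le> (cmod (F (zm x)) ^ n - 1 / cmod (F (zm x)) ^ n) * cmod (g (zm x)) + cmod (g (zm x) - g (zp x))"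
      using reflection_difference[of "F (zm x)" n "g (zm x)" "g (zp x)"] F1[OF m(1)] by simp
    also have "\<dots> \<le> (cmod (F (zm x)) ^ n - 1 / cmod (F (zm x)) ^ n) * B + cmod (g (zm x) - g (zp x))"
    proof -
      have y1: "1 \<le> cmod (F (zm x)) ^ n" using F1[OF m(1)] by (intro one_le_power) auto
      then have y2: "1 / cmod (F (zm x)) ^ n \<le> 1" by (simp add: divide_le_eq_1)
      have "0 \<le> cmod (F (zm x)) ^ n - 1 / cmod (F (zm x)) ^ n" using y1 y2 by linarith
      moreover have "cmod (g (zm x)) \<le> B" using gB[of "zm x"] m by simp
      ultimately show ?thesis by (intro add_right_mono mult_left_mono)
    qed
    finally have 1: "cmod (F (zm x) ^ n * g (zm x) - G (zp x) ^ n * g (zp x))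
      \<le> (cmod (F (zm x)) ^ n - 1 / cmod (F (zm x)) ^ n) * B + cmod (g (zm x) - g (zp x))" .
    have "D' x = (F (zm x) ^ n * g (zm x) - G (zp x) ^ n * g (zp x)) + \<beta> * (q (zm x) - q (of_real x))"
      by (simp add: D'_def algebra_simps)
    then have "cmod (D' x) \<le> cmod (F (zm x) ^ n * g (zm x) - G (zp x) ^ n * g (zp x)) + cmod \<beta> * cmod (q (zm x) - q (of_real x))"
      by (metis norm_mult norm_triangle_ineq)
    then have "cmod (D' x) \<le> E (zm x)" using 1 by (simp add: E_def cz[OF x])
    moreover have "\<bar>E (zm x)\<bar> < \<delta>" using r(2)[OF x \<eta>(1,2)] m(1) by (simp add: zm_def)
    ultimately show ?thesis by linarith
  qed
  have le: "a + \<epsilon> < b - \<epsilon>" using \<epsilon> h by auto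
  have "cmod (D (b - \<epsilon>) - D (a + \<epsilon>)) \<le> \<delta> * (b - \<epsilon>) - \<delta> * (a + \<epsilon>)"
  proof (rule differentiable_bound_general[OF le])
    show "continuous_on {a + \<epsilon>..b - \<epsilon>} D"
      using DD by (meson continuous_at_imp_continuous_on has_vector_derivative_continuous)
    show "continuous_on {a + \<epsilon>..b - \<epsilon>} (\<lambda>x. \<delta> * x)" by (intro continuous_intros)
    fix x assume "a + \<epsilon> < x" "x < b - \<epsilon>"
    then have x: "x \<in> {a + \<epsilon>..b - \<epsilon>}" by auto
    show "(D has_vector_derivative D' x) (at x)" by (rule DD[OF x])
    show "((\<lambda>x. \<delta> * x) has_vector_derivative \<delta>) (at x)"
      unfolding has_real_derivative_iff_has_vector_derivative[symmetric] by (auto intro!: derivative_eq_intros)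
    show "cmod (D' x) \<le> \<delta>" by (rule D'\<delta>[OF x])
  qed
  also have "\<dots> = \<delta> * ((b - \<epsilon>) - (a + \<epsilon>))" by (simp only: right_diff_distrib)
  also have "\<dots> \<le> \<delta> * (b - a)" using \<delta> \<epsilon> by (intro mult_left_mono) auto
  also have "\<dots> = e" using ab by (simp add: \<delta>_def)
  finally have step1: "cmod (D (b - \<epsilon>) - D (a + \<epsilon>)) \<le> e" .
  define am where "am = of_real a + of_real \<epsilon> * Complex 1 (- \<kappa>')"
  define bm where "bm = of_real b - of_real \<epsilon> * Complex 1 \<kappa>'"
  define ap where "ap = of_real a + of_real \<epsilon> * Complex 1 \<kappa>'"
  define bp where "bp = of_real b + of_real \<epsilon> * Complex (- 1) \<kappa>'"
  have amV: "am = of_real (a + \<epsilon>) - \<i> * of_real (\<kappa>' * \<epsilon>)" "bm = of_real (b - \<epsilon>) - \<i> * of_real (\<kappa>' * \<epsilon>)"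
    "ap = of_real (a + \<epsilon>) + \<i> * of_real (\<kappa>' * \<epsilon>)" "bp = of_real (b - \<epsilon>) + \<i> * of_real (\<kappa>' * \<epsilon>)"
    by (simp_all add: am_def bm_def ap_def bp_def complex_eq_iff mult.commute)
  have ends: "a + \<epsilon> \<in> {a + \<epsilon>..b - \<epsilon>}" "b - \<epsilon> \<in> {a + \<epsilon>..b - \<epsilon>}" using le by auto
  have V: "am \<in> ?Vm" "bm \<in> ?Vm" "ap \<in> ?Vp" "bp \<in> ?Vp"
    unfolding amV using lower_halfI[OF ends(1) ke \<kappa>0] lower_halfI[OF ends(2) ke \<kappa>0] by auto
  have dist: "cmod (zm (a + \<epsilon>) - am) \<le> \<kappa>' * \<epsilon>" "cmod (zm (b - \<epsilon>) - bm) \<le> \<kappa>' * \<epsilon>"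
    "cmod (zp (a + \<epsilon>) - ap) \<le> \<kappa>' * \<epsilon>" "cmod (zp (b - \<epsilon>) - bp) \<le> \<kappa>' * \<epsilon>"
    unfolding amV zm_def zp_def using \<eta> by (simp_all add: cmod_def)
  \<comment> \<open>The factor \<open>M ^ n\<close> may be huge, but it only multiplies lengths of
    order \<open>\<epsilon>\<close>.\<close>
  have RM: "cmod (R x - R y) \<le> (M ^ n * B + cmod \<beta> * Q) * cmod (x - y)" if "x \<in> ?Vm" "y \<in> ?Vm" for x y
    by (rule field_differentiable_bound[OF convex_lower_half has_field_derivative_at_within[OF R] RB that])
  have TM: "cmod (T x - T y) \<le> B * cmod (x - y)" if "x \<in> ?Vp" "y \<in> ?Vp" for x y
    by (rule field_differentiable_bound[OF convex_upper_half has_field_derivative_at_within[OF T] TB that])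
  have pos: "M ^ n * B + cmod \<beta> * Q \<ge> 0" using order_trans[OF norm_ge_zero RB[OF V(1)]] .
  have step2: "cmod (R (zm (a + \<epsilon>)) - R am) \<le> (M ^ n * B + cmod \<beta> * Q) * (\<kappa>' * \<epsilon>)"
    using RM[OF zm[OF ends(1)] V(1)] mult_left_mono[OF dist(1) pos] by linarith
  have step3: "cmod (R (zm (b - \<epsilon>)) - R bm) \<le> (M ^ n * B + cmod \<beta> * Q) * (\<kappa>' * \<epsilon>)"
    using RM[OF zm[OF ends(2)] V(2)] mult_left_mono[OF dist(2) pos] by linarith
  have step4: "cmod (T (zp (a + \<epsilon>)) - T ap) \<le> B * (\<kappa>' * \<epsilon>)"
    using TM[OF zp[OF ends(1)] V(3)] mult_left_mono[OF dist(3) B] by linarith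
  have step5: "cmod (T (zp (b - \<epsilon>)) - T bp) \<le> B * (\<kappa>' * \<epsilon>)"
    using TM[OF zp[OF ends(2)] V(4)] mult_left_mono[OF dist(4) B] by linarith
  have cnorm: "cmod (Complex (- 1) \<kappa>') = cmod (Complex 1 \<kappa>')" by (simp add: cmod_def)
  have Gdecay: "cmod (G \<zeta> ^ n * g \<zeta>) \<le> B * exp (- real n * c * s powr (1 / \<omega>))"
    if "\<zeta> \<in> ?Vp" "exp (c * s powr (1 / \<omega>)) \<le> cmod (F (cnj \<zeta>))" for \<zeta> s
  proof -
    have "cmod (G \<zeta>) = 1 / cmod (F (cnj \<zeta>))" by (simp add: G_def reflection_def norm_divide)
    also have "\<dots> \<le> 1 / exp (c * s powr (1 / \<omega>))"
      using that(2) by (intro divide_left_mono) (auto intro: mult_pos_pos order_less_le_trans[OF exp_gt_zero])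
    also have "\<dots> = exp (- c * s powr (1 / \<omega>))" by (simp add: exp_minus inverse_eq_divide)
    finally have "cmod (G \<zeta>) ^ n \<le> exp (- c * s powr (1 / \<omega>)) ^ n" by (intro power_mono) auto
    also have "\<dots> = exp (- real n * c * s powr (1 / \<omega>))" by (simp flip: exp_of_nat_mult add: mult_ac)
    finally have "cmod (G \<zeta>) ^ n * cmod (g \<zeta>) \<le> exp (- real n * c * s powr (1 / \<omega>)) * B"
      using gB[of \<zeta>] that by (intro mult_mono) auto
    then show ?thesis by (simp add: norm_mult norm_power mult.commute)
  qed
  have rayV: "of_real a + of_real s * Complex 1 \<kappa>' \<in> ?Vp" "of_real b + of_real s * Complex (- 1) \<kappa>' \<in> ?Vp"
    if "s \<in> {\<epsilon>..h}" for s
  proof -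
    have s: "0 < s" "s \<le> h" using that \<epsilon> by auto
    have "s * \<kappa>' < \<kappa> * s" using s \<kappa> by (simp add: mult.commute)
    moreover have "\<kappa> * s \<le> \<kappa> * (b - a - s)" using s \<kappa> h by (intro mult_left_mono) auto
    moreover have "s * \<kappa>' > 0" using s \<kappa> by simp
    ultimately show "of_real a + of_real s * Complex 1 \<kappa>' \<in> ?Vp" "of_real b + of_real s * Complex (- 1) \<kappa>' \<in> ?Vp"
      by (auto simp: upper_half_def algebra_simps)
  qed
  have step6: "cmod (T (of_real a + of_real h * Complex 1 \<kappa>') - T ap) \<le> K * B * cmod (Complex 1 \<kappa>') / real n powr \<omega>"
    unfolding ap_def
  proof (rule ray_primitive_bound[OF n \<omega> K \<epsilon> B T])
    fix s assume s: "s \<in> {\<epsilon>..h}"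
    show "of_real a + of_real s * Complex 1 \<kappa>' \<in> ?Vp" by (rule rayV[OF s])
    show "cmod (G (of_real a + of_real s * Complex 1 \<kappa>') ^ n * g (of_real a + of_real s * Complex 1 \<kappa>'))
      \<le> B * exp (- real n * c * s powr (1 / \<omega>))"
    proof (rule Gdecay[OF rayV(1)[OF s]])
      have "cnj (of_real a + of_real s * Complex 1 \<kappa>') = of_real a + of_real s * Complex 1 (- \<kappa>')"
        by (simp add: complex_eq_iff)
      then show "exp (c * s powr (1 / \<omega>)) \<le> cmod (F (cnj (of_real a + of_real s * Complex 1 \<kappa>')))"
        using decay_a[of s] s \<epsilon> by simp
    qed
  qed
  have step7: "cmod (T (of_real b + of_real h * Complex (- 1) \<kappa>') - T bp) \<le> K * B * cmod (Complex 1 \<kappa>') / real n powr \<omega>"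
    unfolding bp_def cnorm[symmetric]
  proof (rule ray_primitive_bound[OF n \<omega> K \<epsilon> B T])
    fix s assume s: "s \<in> {\<epsilon>..h}"
    show "of_real b + of_real s * Complex (- 1) \<kappa>' \<in> ?Vp" by (rule rayV[OF s])
    show "cmod (G (of_real b + of_real s * Complex (- 1) \<kappa>') ^ n * g (of_real b + of_real s * Complex (- 1) \<kappa>'))
      \<le> B * exp (- real n * c * s powr (1 / \<omega>))"
    proof (rule Gdecay[OF rayV(2)[OF s]])
      have "cnj (of_real b + of_real s * Complex (- 1) \<kappa>') = of_real b - of_real s * Complex 1 \<kappa>'"
        by (simp add: complex_eq_iff)
      then show "exp (c * s powr (1 / \<omega>)) \<le> cmod (F (cnj (of_real b + of_real s * Complex (- 1) \<kappa>')))"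
        using decay_b[of s] s \<epsilon> by simp
    qed
  qed
  \<comment> \<open>The rays of slope \<open>\<kappa>'\<close> from both ends meet over the midpoint
    because \<open>h\<close> is half the length. The value of \<open>T\<close> at this apex cancels,
    leaving only increments along rays on which the reflected function decays.\<close>
  have mid: "of_real a + of_real h * Complex 1 \<kappa>' = of_real b + of_real h * Complex (- 1) \<kappa>'"
    by (simp add: complex_eq_iff h field_simps)
  define t where "t = T (of_real a + of_real h * Complex 1 \<kappa>')"
  have eq: "R bm - R am - \<beta> * (L (b - \<epsilon>) - L (a + \<epsilon>)) = (D (b - \<epsilon>) - D (a + \<epsilon>))
     - (R (zm (b - \<epsilon>)) - R bm) + (R (zm (a + \<epsilon>)) - R am) + (T (zp (b - \<epsilon>)) - T bp) - (T (zp (a + \<epsilon>)) - T ap)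
     - (t - T bp) + (t - T ap)"
    by (simp add: D_def algebra_simps)
  have tri: "cmod (x1 - x2 + x3 + x4 - x5 - x6 + x7) \<le> cmod x1 + cmod x2 + cmod x3 + cmod x4 + cmod x5 + cmod x6 + cmod x7" for x1 x2 x3 x4 x5 x6 x7
    by (smt (verit) norm_triangle_ineq norm_triangle_ineq4)
  have "cmod (R bm - R am - \<beta> * (L (b - \<epsilon>) - L (a + \<epsilon>))) \<le> e + (M ^ n * B + cmod \<beta> * Q) * (\<kappa>' * \<epsilon>) + (M ^ n * B + cmod \<beta> * Q) * (\<kappa>' * \<epsilon>)
    + B * (\<kappa>' * \<epsilon>) + B * (\<kappa>' * \<epsilon>) + K * B * cmod (Complex 1 \<kappa>') / real n powr \<omega> + K * B * cmod (Complex 1 \<kappa>') / real n powr \<omega>"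
    unfolding eq
    by (rule order_trans[OF tri]) (intro add_mono step1 step2 step3 step4 step5 step6[folded t_def] step7[folded mid t_def])
  also have "\<dots> = 2 * (K * B * cmod (Complex 1 \<kappa>') / real n powr \<omega>) + 2 * (\<kappa>' * \<epsilon> * (M ^ n * B + cmod \<beta> * Q + B)) + e"
    by (simp add: algebra_simps)
  finally show "cmod (R (of_real b - of_real \<epsilon> * Complex 1 \<kappa>') - R (of_real a + of_real \<epsilon> * Complex 1 (- \<kappa>'))
      - \<beta> * (L (b - \<epsilon>) - L (a + \<epsilon>)))
    \<le> 2 * (K * B * cmod (Complex 1 \<kappa>') / real n powr \<omega>) + 2 * (\<kappa>' * \<epsilon> * (M ^ n * B + cmod \<beta> * Q + B)) + e"
    by (simp only: am_def bm_def)
qed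

section \<open>Corners\<close>

text \<open>The mean value inequality is applied to \<open>deriv k\<close>, whose derivative is
  bounded on a smaller disc, and again to \<open>k\<close> minus its linear part.\<close>

lemma germ_quadratic:
  fixes k :: "complex \<Rightarrow> complex"
  assumes k: "k holomorphic_on ball 0 r0" and r0: "r0 > 0"
  obtains M r where "0 < r" "r < r0" "M > 0"
    "\<And>\<zeta>. cmod \<zeta> \<le> r \<Longrightarrow> cmod (k \<zeta> - k 0 - deriv k 0 * \<zeta>) \<le> M * (cmod \<zeta>)\<^sup>2"
proof -
  define r where "r = r0 / 2"
  have r: "0 < r" "r < r0" using r0 by (auto simp: r_def)
  have sub: "cball 0 r \<subseteq> ball 0 r0" using r by auto
  have k1: "deriv k holomorphic_on ball 0 r0" by (rule holomorphic_deriv[OF k open_ball])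
  have "deriv (deriv k) holomorphic_on ball 0 r0" by (rule holomorphic_deriv[OF k1 open_ball])
  then have "continuous_on (cball 0 r) (deriv (deriv k))"
    using sub by (meson continuous_on_subset holomorphic_on_imp_continuous_on)
  then have "bounded (deriv (deriv k) ` cball 0 r)"
    by (intro compact_imp_bounded compact_continuous_image) auto
  then obtain M where M: "M > 0" "\<And>w. w \<in> cball 0 r \<Longrightarrow> cmod (deriv (deriv k) w) \<le> M"
    unfolding bounded_pos by auto
  have dk: "cmod (deriv k w - deriv k 0) \<le> M * cmod w" if w: "w \<in> cball 0 r" for w
  proof -
    have "cmod (deriv k w - deriv k 0) \<le> M * cmod (w - 0)"
    proof (rule field_differentiable_bound[of "cball 0 r" "deriv k" "deriv (deriv k)" M w 0, OF convex_cball _ M(2)])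
      fix z :: complex assume "z \<in> cball 0 r"
      then have zz: "z \<in> ball 0 r0" using sub by blast
      show "(deriv k has_field_derivative deriv (deriv k) z) (at z within cball 0 r)"
        by (rule has_field_derivative_at_within[OF holomorphic_derivI[OF k1 open_ball zz]])
    qed (use w r in auto)
    then show ?thesis by simp
  qed
  show ?thesis
  proof
    fix \<zeta> :: complex assume \<zeta>: "cmod \<zeta> \<le> r"
    have "cmod ((k \<zeta> - deriv k 0 * \<zeta>) - (k 0 - deriv k 0 * 0)) \<le> M * cmod \<zeta> * cmod (\<zeta> - 0)"
    proof (rule field_differentiable_bound[of "cball 0 (cmod \<zeta>)" "\<lambda>z. k z - deriv k 0 * z" "\<lambda>z. deriv k z - deriv k 0" "M * cmod \<zeta>" \<zeta> 0, OF convex_cball])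
      fix z :: complex assume z: "z \<in> cball 0 (cmod \<zeta>)"
      then have zr: "z \<in> ball 0 r0" "z \<in> cball 0 r" using \<zeta> r by auto
      have "(k has_field_derivative deriv k z) (at z)" by (rule holomorphic_derivI[OF k open_ball zr(1)])
      then have "((\<lambda>z. k z - deriv k 0 * z) has_field_derivative deriv k z - deriv k 0) (at z)"
        by (auto intro!: derivative_eq_intros)
      then show "((\<lambda>z. k z - deriv k 0 * z) has_field_derivative deriv k z - deriv k 0) (at z within cball 0 (cmod \<zeta>))"
        by (rule has_field_derivative_at_within)
      have "M * cmod z \<le> M * cmod \<zeta>" using z M(1) by (intro mult_left_mono) auto
      then show "cmod (deriv k z - deriv k 0) \<le> M * cmod \<zeta>" using dk[OF zr(2)] by linarith
    qed auto
    then show "cmod (k \<zeta> - k 0 - deriv k 0 * \<zeta>) \<le> M * (cmod \<zeta>)\<^sup>2"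
      by (simp add: power2_eq_square algebra_simps)
  qed (use r M in auto)
qed

text \<open>Written with exponentials, the argument and the increment of \<open>k\<close> have their
  angles as imaginary parts, determined up to multiples of \<open>2 * pi\<close>; hence the integer
  \<open>m\<close>. A conformal germ rotates angles by that of its derivative, and curvature costs
  only a multiple of the distance \<open>exp (Re \<tau>)\<close> from the corner.\<close>

lemma germ_angle:
  fixes k :: "complex \<Rightarrow> complex"
  assumes k: "k holomorphic_on ball 0 r0" and r0: "r0 > 0" and l: "deriv k 0 = exp \<nu>"
  obtains C r where "C > 0" "0 < r" "r < r0"
    "\<And>\<mu> \<tau>. exp (Re \<mu>) < r \<Longrightarrow> k (exp \<mu>) = k 0 + exp \<tau> \<Longrightarrow>
       \<exists>m::int. \<bar>Im \<tau> - Im \<nu> - Im \<mu> - 2 * pi * m\<bar> \<le> C * exp (Re \<tau>)"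
proof -
  obtain M r1 where r1: "0 < r1" "r1 < r0" and M: "M > 0"
    and q: "\<And>\<zeta>. cmod \<zeta> \<le> r1 \<Longrightarrow> cmod (k \<zeta> - k 0 - deriv k 0 * \<zeta>) \<le> M * (cmod \<zeta>)\<^sup>2"
    by (rule germ_quadratic[OF k r0], rule that)
  define N where "N = exp (Re \<nu>)"
  have N: "N > 0" by (simp add: N_def)
  \<comment> \<open>The relative error \<open>E\<close> then has modulus at most
    \<open>1 / 4\<close>, which makes \<open>Ln (1 + E)\<close> comparable with \<open>E\<close> and
    keeps \<open>exp (Re \<tau>)\<close> at least half its linear approximation.\<close>
  define r where "r = min r1 (N / (4 * M))"
  show ?thesis
  proof
    show "4 * M / N\<^sup>2 > 0" using M N by simp
    show "0 < r" "r < r0" using r1 M N by (auto simp: r_def)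
    fix \<mu> \<tau> :: complex assume s: "exp (Re \<mu>) < r" and eq: "k (exp \<mu>) = k 0 + exp \<tau>"
    define s where "s = exp (Re \<mu>)"
    have s': "0 < s" "s \<le> r1" "s \<le> N / (4 * M)" using s by (auto simp: s_def r_def)
    define E where "E = exp \<tau> / (exp \<mu> * exp \<nu>) - 1"
    have E: "exp \<tau> = exp \<mu> * exp \<nu> * (1 + E)" by (simp add: E_def)
    have "cmod (exp \<tau> - exp \<nu> * exp \<mu>) \<le> M * s\<^sup>2"
      using q[of "exp \<mu>"] s' eq by (simp add: l s_def norm_exp_eq_Re)
    moreover have "exp \<tau> - exp \<nu> * exp \<mu> = exp \<mu> * exp \<nu> * E" using E by (simp add: algebra_simps)
    ultimately have "s * N * cmod E \<le> M * s\<^sup>2" by (simp add: norm_mult norm_exp_eq_Re s_def N_def)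
    then have "s * (N * cmod E) \<le> s * (M * s)" by (simp add: power2_eq_square mult_ac)
    then have "N * cmod E \<le> M * s" using s'(1) by simp
    then have Es: "cmod E \<le> M * s / N" using N by (simp add: field_simps)
    also have "M * s / N \<le> 1 / 4" using s' M N by (simp add: field_simps)
    finally have E4: "cmod E \<le> 1 / 4" .
    then have E0: "1 + E \<noteq> 0" by (metis add_eq_0_iff2 norm_minus_cancel norm_one not_le one_less_numeral_iff semiring_norm(76) divide_less_eq_1_pos zero_less_numeral)
    have "exp \<tau> = exp (\<mu> + \<nu> + Ln (1 + E))" using E0 by (simp add: exp_add E)
    then obtain m :: int where m: "\<tau> = \<mu> + \<nu> + Ln (1 + E) + (of_int (2 * m) * pi) * \<i>"
      unfolding exp_eq by auto
    have "cmod (Ln (1 + E)) \<le> 2 * cmod E" using E4 by (intro norm_Ln_le) auto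
    then have "\<bar>Im (Ln (1 + E))\<bar> \<le> 2 * cmod E" using abs_Im_le_cmod order_trans by blast
    moreover have "Im \<tau> - Im \<nu> - Im \<mu> - 2 * pi * m = Im (Ln (1 + E))" by (simp add: m)
    ultimately have "\<bar>Im \<tau> - Im \<nu> - Im \<mu> - 2 * pi * m\<bar> \<le> 2 * (M * s / N)" using Es by linarith
    moreover have "s * N / 2 \<le> exp (Re \<tau>)"
    proof -
      have "1 / 2 \<le> cmod (1 + E)" using E4 norm_triangle_ineq4[of "1 + E" E] by simp
      then have "s * N * (1 / 2) \<le> s * N * cmod (1 + E)" using s' N by (intro mult_left_mono) auto
      also have "\<dots> = cmod (exp \<tau>)" by (simp add: E norm_mult norm_exp_eq_Re s_def N_def)
      finally show ?thesis by (simp add: norm_exp_eq_Re)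
    qed
    then have "2 * (M * s / N) \<le> 4 * M / N\<^sup>2 * exp (Re \<tau>)"
      using M N by (simp add: field_simps power2_eq_square)
    ultimately have "\<bar>Im \<tau> - Im \<nu> - Im \<mu> - 2 * pi * m\<bar> \<le> 4 * M / N\<^sup>2 * exp (Re \<tau>)" by linarith
    then show "\<exists>m::int. \<bar>Im \<tau> - Im \<nu> - Im \<mu> - 2 * pi * m\<bar> \<le> 4 * M / N\<^sup>2 * exp (Re \<tau>)" ..
  qed
qed

text \<open>An inclusion in one direction only, since it serves to exclude points from
  \<open>\<Gamma>\<close>; the parameter can be made as small as the validity of the germs
  demands.\<close>

definition near_arcs :: "complex set \<Rightarrow> complex \<Rightarrow> (complex \<Rightarrow> complex) \<Rightarrow> (complex \<Rightarrow> complex) \<Rightarrow> bool" where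
  "near_arcs \<Gamma> p k1 k2 \<longleftrightarrow> (\<forall>\<delta>>0. \<exists>r>0. \<forall>z\<in>\<Gamma>. dist z p < r \<longrightarrow>
     (\<exists>s. 0 \<le> s \<and> s < \<delta> \<and> (z = k1 (of_real s) \<or> z = k2 (of_real s))))"

lemma near_arcsE:
  assumes "near_arcs \<Gamma> p k1 k2" "\<delta> > 0"
  obtains r where "r > 0" "\<And>z. z \<in> \<Gamma> \<Longrightarrow> dist z p < r \<Longrightarrow>
     \<exists>s. 0 \<le> s \<and> s < \<delta> \<and> (z = k1 (of_real s) \<or> z = k2 (of_real s))"
proof -
  from assms have "\<exists>r>0. \<forall>z\<in>\<Gamma>. dist z p < r \<longrightarrow>
     (\<exists>s. 0 \<le> s \<and> s < \<delta> \<and> (z = k1 (of_real s) \<or> z = k2 (of_real s)))"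
    unfolding near_arcs_def by simp
  then show ?thesis using that by (elim exE conjE) simp
qed

lemma near_arcs_sym: "near_arcs \<Gamma> p k1 k2 \<Longrightarrow> near_arcs \<Gamma> p k2 k1"
  unfolding near_arcs_def by meson

text \<open>
  In the coordinate \<open>z = p + exp \<tau>\<close> the two arcs at the corner are, up to \<open>O(exp (Re \<tau>))\<close>, horizontal
  lines at distance \<open>\<omega> \<pi>\<close>. The error term keeps the set clear of both arcs and, since \<open>exp\<close> is convex,
  makes it convex; no branch cut is needed when \<open>\<omega> > 1\<close>.
\<close>

definition log_sector :: "real \<Rightarrow> real \<Rightarrow> real \<Rightarrow> real \<Rightarrow> complex set" where
  "log_sector \<theta> \<omega> C \<rho> = {\<tau>. Re \<tau> < \<rho> \<and> \<bar>Im \<tau> - \<theta>\<bar> < \<omega> * pi / 2 - C * exp (Re \<tau>)}"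

text \<open>The sides of the sector are at \<open>\<omega> * pi / 2\<close> and its negative. Their
  translates by nonzero multiples of \<open>2 * pi\<close> have absolute value above
  \<open>\<omega> * pi / 2\<close> because the opening is less than \<open>2 * pi\<close>, so an
  angle inside the sector with margin \<open>E\<close> is further than \<open>E\<close> from all of
  them.\<close>

lemma angle_gap:
  fixes m :: int
  assumes "0 < \<omega>" "\<omega> < 2" "s = 1 \<or> s = - 1" "\<bar>y - s * (\<omega> * pi / 2) - 2 * pi * m\<bar> \<le> E" "\<bar>y\<bar> < \<omega> * pi / 2 - E"
  shows False
proof -
  define W where "W = \<omega> * pi"
  define M where "M = 2 * pi * real_of_int m"
  have w: "0 < W" "W < 2 * pi" using assms by (auto simp: W_def)
  have h: "y - s * (W / 2) - M \<le> E" "- (y - s * (W / 2) - M) \<le> E" "y < W / 2 - E" "- y < W / 2 - E"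
    using assms(4,5) unfolding W_def[symmetric] M_def[symmetric] by linarith+
  consider "m = 0" | "m \<ge> 1" | "m \<le> - 1" by linarith
  then have "M = 0 \<or> M \<ge> 2 * pi \<or> M \<le> - (2 * pi)"
  proof cases
    case 2
    then have "2 * pi * 1 \<le> M" unfolding M_def by (intro mult_left_mono) auto
    then show ?thesis by simp
  next
    case 3
    then have "M \<le> 2 * pi * (- 1)" unfolding M_def by (intro mult_left_mono) auto
    then show ?thesis by simp
  qed (simp add: M_def)
  then show False using assms(3) h w by (elim disjE; simp; linarith)
qed

text \<open>A boundary point near \<open>p\<close> lies on one of the two arcs, and
  \<open>germ_angle\<close> then places its angle within \<open>C * exp (Re \<tau>)\<close> of a
  side. That is exactly the margin removed in \<open>log_sector\<close>, so \<open>angle_gap\<close>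
  applies.\<close>

lemma sector_avoids_arcs:
  assumes \<omega>: "0 < \<omega>" "\<omega> < 2" and near: "near_arcs \<Gamma> p k1 k2"
    and k1: "k1 holomorphic_on ball 0 r1" "r1 > 0" "deriv k1 0 = exp \<nu>1" "k1 0 = p"
    and k2: "k2 holomorphic_on ball 0 r2" "r2 > 0" "deriv k2 0 = exp \<nu>2" "k2 0 = p"
    and l: "Im \<nu>1 = \<theta> + \<omega> * pi / 2" "Im \<nu>2 = \<theta> - \<omega> * pi / 2"
  obtains C \<rho> where "C > 0" "\<And>\<tau>. \<tau> \<in> log_sector \<theta> \<omega> C \<rho> \<Longrightarrow> p + exp \<tau> \<notin> \<Gamma>"
proof -
  obtain C1 d1 where C1: "C1 > 0" "0 < d1" "\<And>\<mu> \<tau>. exp (Re \<mu>) < d1 \<Longrightarrow> k1 (exp \<mu>) = k1 0 + exp \<tau> \<Longrightarrow>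
       \<exists>m::int. \<bar>Im \<tau> - Im \<nu>1 - Im \<mu> - 2 * pi * m\<bar> \<le> C1 * exp (Re \<tau>)"
    by (rule germ_angle[OF k1(1-3)], rule that)
  obtain C2 d2 where C2: "C2 > 0" "0 < d2" "\<And>\<mu> \<tau>. exp (Re \<mu>) < d2 \<Longrightarrow> k2 (exp \<mu>) = k2 0 + exp \<tau> \<Longrightarrow>
       \<exists>m::int. \<bar>Im \<tau> - Im \<nu>2 - Im \<mu> - 2 * pi * m\<bar> \<le> C2 * exp (Re \<tau>)"
    by (rule germ_angle[OF k2(1-3)], rule that)
  have d: "min d1 d2 > 0" using C1 C2 by simp
  obtain r where r: "r > 0" "\<And>z. z \<in> \<Gamma> \<Longrightarrow> dist z p < r \<Longrightarrow>
     \<exists>s. 0 \<le> s \<and> s < min d1 d2 \<and> (z = k1 (of_real s) \<or> z = k2 (of_real s))"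
    by (rule near_arcsE[OF near d], rule that)
  show ?thesis
  proof
    show "max C1 C2 > 0" using C1 by simp
    fix \<tau> assume \<tau>: "\<tau> \<in> log_sector \<theta> \<omega> (max C1 C2) (ln r)"
    then have t: "Re \<tau> < ln r" "\<bar>Im \<tau> - \<theta>\<bar> < \<omega> * pi / 2 - max C1 C2 * exp (Re \<tau>)" by (auto simp: log_sector_def)
    show "p + exp \<tau> \<notin> \<Gamma>"
    proof
      assume "p + exp \<tau> \<in> \<Gamma>"
      moreover have "dist (p + exp \<tau>) p < r"
        using t(1) r(1) by (simp add: dist_norm norm_exp_eq_Re) (metis exp_less_mono exp_ln)
      ultimately obtain s where s: "0 \<le> s" "s < min d1 d2" "p + exp \<tau> = k1 (of_real s) \<or> p + exp \<tau> = k2 (of_real s)"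
        using r(2) by blast
      have "s \<noteq> 0" using s(3) k1(4) k2(4) by auto
      then have s0: "s > 0" using s(1) by simp
      define \<mu> where "\<mu> = complex_of_real (ln s)"
      have \<mu>: "exp \<mu> = of_real s" "exp (Re \<mu>) = s" "Im \<mu> = 0"
        using s0 by (simp_all add: \<mu>_def exp_of_real)
      have le: "C1 * exp (Re \<tau>) \<le> max C1 C2 * exp (Re \<tau>)" "C2 * exp (Re \<tau>) \<le> max C1 C2 * exp (Re \<tau>)" by auto
      from s(3) show False
      proof
        assume "p + exp \<tau> = k1 (of_real s)"
        then obtain m :: int where "\<bar>Im \<tau> - Im \<nu>1 - Im \<mu> - 2 * pi * m\<bar> \<le> C1 * exp (Re \<tau>)"
          using C1(3)[of \<mu> \<tau>] \<mu> k1(4) s(2) by auto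
        moreover have "Im \<tau> - Im \<nu>1 - Im \<mu> - 2 * pi * m = (Im \<tau> - \<theta>) - 1 * (\<omega> * pi / 2) - 2 * pi * m"
          using \<mu> l by simp
        ultimately have "\<bar>(Im \<tau> - \<theta>) - 1 * (\<omega> * pi / 2) - 2 * pi * m\<bar> \<le> max C1 C2 * exp (Re \<tau>)"
          using le(1) by linarith
        then show False using angle_gap[OF \<omega>] t(2) by blast
      next
        assume "p + exp \<tau> = k2 (of_real s)"
        then obtain m :: int where "\<bar>Im \<tau> - Im \<nu>2 - Im \<mu> - 2 * pi * m\<bar> \<le> C2 * exp (Re \<tau>)"
          using C2(3)[of \<mu> \<tau>] \<mu> k2(4) s(2) by auto
        moreover have "Im \<tau> - Im \<nu>2 - Im \<mu> - 2 * pi * m = (Im \<tau> - \<theta>) - (- 1) * (\<omega> * pi / 2) - 2 * pi * m"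
          using \<mu> l by simp
        ultimately have "\<bar>(Im \<tau> - \<theta>) - (- 1) * (\<omega> * pi / 2) - 2 * pi * m\<bar> \<le> max C1 C2 * exp (Re \<tau>)"
          using le(2) by linarith
        then show False using angle_gap[OF \<omega>] t(2) by blast
      qed
    qed
  qed
qed

text \<open>A point \<open>k1 \<zeta>\<close> with non-real \<open>\<zeta>\<close> is off the first
  arc by local injectivity. On the second arc its angle would have to bridge the gap between the two
  tangent directions, which neither the tilt of \<open>\<zeta>\<close> nor the curvature of the arcs
  allows. The sign \<open>s0\<close> lets either arc play the role of \<open>k1\<close>.\<close>

lemma wedge_avoids_arcs:
  assumes \<omega>: "0 < \<omega>" "\<omega> < 2" and near: "near_arcs \<Gamma> p k1 k2"
    and k1: "k1 holomorphic_on ball 0 r1" "r1 > 0" "deriv k1 0 = exp \<nu>1" "k1 0 = p"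
    and k2: "k2 holomorphic_on ball 0 r2" "r2 > 0" "deriv k2 0 = exp \<nu>2" "k2 0 = p"
    and l: "Im \<nu>1 - Im \<nu>2 = s0 * (\<omega> * pi)" and s0: "s0 = 1 \<or> s0 = - 1"
  obtains r \<kappa> where "r > 0" "\<kappa> > 0"
    "\<And>\<zeta>. cmod \<zeta> < r \<Longrightarrow> Im \<zeta> \<noteq> 0 \<Longrightarrow> \<bar>Im \<zeta>\<bar> < \<kappa> * Re \<zeta> \<Longrightarrow> k1 \<zeta> \<notin> \<Gamma>"
proof -
  obtain C1 d1 where C1: "C1 > 0" "0 < d1" "d1 < r1" "\<And>\<mu> \<tau>. exp (Re \<mu>) < d1 \<Longrightarrow> k1 (exp \<mu>) = k1 0 + exp \<tau> \<Longrightarrow>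
       \<exists>m::int. \<bar>Im \<tau> - Im \<nu>1 - Im \<mu> - 2 * pi * m\<bar> \<le> C1 * exp (Re \<tau>)"
    by (rule germ_angle[OF k1(1-3)], rule that)
  obtain C2 d2 where C2: "C2 > 0" "0 < d2" "\<And>\<mu> \<tau>. exp (Re \<mu>) < d2 \<Longrightarrow> k2 (exp \<mu>) = k2 0 + exp \<tau> \<Longrightarrow>
       \<exists>m::int. \<bar>Im \<tau> - Im \<nu>2 - Im \<mu> - 2 * pi * m\<bar> \<le> C2 * exp (Re \<tau>)"
    by (rule germ_angle[OF k2(1-3)], rule that)
  have k10: "0 \<in> ball (0::complex) r1" "deriv k1 0 \<noteq> 0" using k1(2,3) by auto
  obtain d3 where d3: "d3 > 0" "inj_on k1 (ball 0 d3)"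
    by (rule has_complex_derivative_locally_injective[OF k1(1) k10(1) open_ball k10(2)], rule that)
  define \<delta> where "\<delta> = min (min d1 d2) d3"
  have \<delta>: "\<delta> > 0" using C1 C2 d3 by (simp add: \<delta>_def)
  obtain r where r: "r > 0" "\<And>z. z \<in> \<Gamma> \<Longrightarrow> dist z p < r \<Longrightarrow>
     \<exists>s. 0 \<le> s \<and> s < \<delta> \<and> (z = k1 (of_real s) \<or> z = k2 (of_real s))"
    by (rule near_arcsE[OF near \<delta>], rule that)
  \<comment> \<open>The angle between the tangent directions modulo \<open>2 * pi\<close>, so both
    the exterior and the interior angle enter. One half of it is granted to the tilt of
    \<open>\<zeta>\<close>, the other to the curvature of the two arcs through the choice of
    \<open>e\<close>.\<close>
  define g where "g = min (\<omega> * pi) (2 * pi - \<omega> * pi)"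
  have g: "g > 0" using \<omega> by (simp add: g_def)
  define e where "e = min r (g / (2 * (C1 + C2)))"
  have e: "e > 0" using r g C1 C2 by (simp add: e_def)
  have "isCont k1 0"
    using holomorphic_on_imp_continuous_on[OF k1(1)] k1(2) by (simp add: continuous_on_eq_continuous_at)
  then obtain d4 where d4: "d4 > 0" "\<And>\<zeta>. dist \<zeta> 0 < d4 \<Longrightarrow> dist (k1 \<zeta>) (k1 0) < e"
    using e unfolding continuous_at_eps_delta by metis
  show ?thesis
  proof
    show "min \<delta> d4 > 0" "g / 2 > 0" using \<delta> d4 g by auto
    fix \<zeta> assume \<zeta>: "cmod \<zeta> < min \<delta> d4" "Im \<zeta> \<noteq> 0" "\<bar>Im \<zeta>\<bar> < g / 2 * Re \<zeta>"
    have Re: "Re \<zeta> > 0"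
    proof -
      have "0 < g / 2 * Re \<zeta>" using \<zeta>(3) abs_ge_zero[of "Im \<zeta>"] by linarith
      then show ?thesis using g by (simp add: zero_less_mult_iff)
    qed
    have nz: "\<zeta> \<noteq> 0" using \<zeta>(2) by auto
    show "k1 \<zeta> \<notin> \<Gamma>"
    proof
      assume G: "k1 \<zeta> \<in> \<Gamma>"
      have de: "dist (k1 \<zeta>) p < e" using d4(2)[of \<zeta>] \<zeta>(1) k1(4) by simp
      then obtain s where s: "0 \<le> s" "s < \<delta>" "k1 \<zeta> = k1 (of_real s) \<or> k1 \<zeta> = k2 (of_real s)"
        using r(2)[OF G] by (auto simp: e_def)
      have \<zeta>d: "\<zeta> \<in> ball 0 d3" using \<zeta>(1) by (simp add: \<delta>_def)
      have "k1 \<zeta> \<noteq> k1 (of_real s)"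
      proof
        assume "k1 \<zeta> = k1 (of_real s)"
        moreover have "of_real s \<in> ball (0::complex) d3" using s by (simp add: \<delta>_def)
        ultimately have "\<zeta> = of_real s" using d3(2) \<zeta>d by (meson inj_onD)
        then show False using \<zeta>(2) by simp
      qed
      then have k2s: "k1 \<zeta> = k2 (of_real s)" using s by blast
      have kp: "k1 \<zeta> \<noteq> p"
      proof
        assume "k1 \<zeta> = p"
        then have "\<zeta> = 0" using d3 \<zeta>d k1(4) by (metis centre_in_ball inj_onD)
        then show False using nz by simp
      qed
      then have s0': "s > 0" using s(1) k2s k2(4) by (cases "s = 0") auto
      define \<tau> where "\<tau> = Ln (k1 \<zeta> - p)"
      have \<tau>: "k1 \<zeta> = p + exp \<tau>" using kp by (simp add: \<tau>_def)
      have ex: "exp (Re \<tau>) < e" using de \<tau> by (simp add: dist_norm norm_exp_eq_Re)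
      have L: "exp (Ln \<zeta>) = \<zeta>" "exp (Re (Ln \<zeta>)) = cmod \<zeta>" using nz by (simp_all add: Re_Ln)
      obtain m1 :: int where m1: "\<bar>Im \<tau> - Im \<nu>1 - Im (Ln \<zeta>) - 2 * pi * m1\<bar> \<le> C1 * exp (Re \<tau>)"
        using C1(4)[of "Ln \<zeta>" \<tau>] L \<tau> k1(4) \<zeta>(1) by (auto simp: \<delta>_def)
      define \<mu> where "\<mu> = complex_of_real (ln s)"
      have \<mu>: "exp \<mu> = of_real s" "exp (Re \<mu>) = s" "Im \<mu> = 0"
        using s0' by (simp_all add: \<mu>_def exp_of_real)
      obtain m2 :: int where m2: "\<bar>Im \<tau> - Im \<nu>2 - Im \<mu> - 2 * pi * m2\<bar> \<le> C2 * exp (Re \<tau>)"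
        using C2(3)[of \<mu> \<tau>] \<mu> \<tau> k2s k2(4) s(2) by (auto simp: \<delta>_def)
      have "Im (Ln \<zeta>) = arctan (Im \<zeta> / Re \<zeta>)" using Re nz by (simp add: Im_Ln_eq)
      then have "\<bar>Im (Ln \<zeta>)\<bar> \<le> \<bar>Im \<zeta> / Re \<zeta>\<bar>" by (simp only: abs_arctan_le)
      also have "\<dots> < g / 2" using \<zeta>(3) Re by (simp add: divide_less_eq)
      finally have A: "\<bar>Im (Ln \<zeta>)\<bar> < g / 2" .
      have "(C1 + C2) * exp (Re \<tau>) < (C1 + C2) * (g / (2 * (C1 + C2)))"
        using ex C1 C2 by (intro mult_strict_left_mono) (auto simp: e_def)
      also have "\<dots> = g / 2" using C1 C2 by (simp add: field_simps)
      finally have B: "C1 * exp (Re \<tau>) + C2 * exp (Re \<tau>) < g / 2" by (simp add: algebra_simps)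
      define m where "m = m1 - m2"
      have "\<bar>s0 * (\<omega> * pi) + 2 * pi * m\<bar> < g"
        using m1 m2 A B \<mu>(3) l by (simp add: m_def algebra_simps abs_if split: if_splits)
      moreover have "\<bar>s0 * (\<omega> * pi) + 2 * pi * m\<bar> \<ge> g"
      proof -
        define W where "W = \<omega> * pi"
        define M where "M = 2 * pi * real_of_int m"
        have w: "0 < W" "W < 2 * pi" "g \<le> W" "g \<le> 2 * pi - W" using \<omega> by (auto simp: g_def W_def)
        consider "m = 0" | "m \<ge> 1" | "m \<le> - 1" by linarith
        then have "M = 0 \<or> M \<ge> 2 * pi \<or> M \<le> - (2 * pi)"
        proof cases
          case 2
          then have "2 * pi * 1 \<le> M" unfolding M_def by (intro mult_left_mono) auto
          then show ?thesis by simp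
        next
          case 3
          then have "M \<le> 2 * pi * (- 1)" unfolding M_def by (intro mult_left_mono) auto
          then show ?thesis by simp
        qed (simp add: M_def)
        then have "\<bar>s0 * W + M\<bar> \<ge> g" using s0 w by (elim disjE; simp; linarith)
        then show ?thesis by (simp add: W_def M_def)
      qed
      ultimately show False by simp
    qed
  qed
qed

text \<open>In the coordinate \<open>z = p + exp \<tau>\<close> the image of a ray becomes
  asymptotic to a horizontal line: its lift is \<open>ln s + \<nu> + Ln (u s)\<close>, where
  \<open>u s\<close> tends to \<open>d\<close>. The condition \<open>Re d > 0\<close> keeps this
  limit off the branch cut.\<close>

lemma germ_ray:
  fixes k :: "complex \<Rightarrow> complex"
  assumes k: "(k has_field_derivative exp \<nu>) (at 0)" and p: "k 0 = p" and d: "Re d > 0"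
  obtains \<tau> where "\<forall>\<^sub>F s in at_right 0. p + exp (\<tau> s) = k (of_real s * d)"
    "((\<lambda>s. \<tau> s - of_real (ln s)) \<longlongrightarrow> \<nu> + Ln d) (at_right 0)"
proof -
  define u where "u s = (k (of_real s * d) - p) / (of_real s * exp \<nu>)" for s :: real
  have d0: "d \<noteq> 0" "d \<notin> \<real>\<^sub>\<le>\<^sub>0" using d by (auto simp: complex_nonpos_Reals_iff)
  have "filterlim (\<lambda>s. of_real s * d) (at 0) (at_right (0::real))"
    unfolding filterlim_at
  proof
    have "((\<lambda>s. complex_of_real s * d) \<longlongrightarrow> of_real 0 * d) (at_right 0)" by (intro tendsto_intros)
    then show "((\<lambda>s. complex_of_real s * d) \<longlongrightarrow> 0) (at_right 0)" by simp
    show "\<forall>\<^sub>F s in at_right (0::real). of_real s * d \<in> UNIV \<and> of_real s * d \<noteq> 0"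
      using eventually_at_right_less[of "0::real"] by eventually_elim (use d0 in auto)
  qed
  moreover have "((\<lambda>y. (k y - p) / y) \<longlongrightarrow> exp \<nu>) (at 0)"
    using k p by (simp add: has_field_derivative_iff)
  ultimately have "((\<lambda>s. (k (of_real s * d) - p) / (of_real s * d)) \<longlongrightarrow> exp \<nu>) (at_right 0)"
    by (rule filterlim_compose[rotated])
  then have "((\<lambda>s. (k (of_real s * d) - p) / (of_real s * d) * (d / exp \<nu>)) \<longlongrightarrow> exp \<nu> * (d / exp \<nu>)) (at_right 0)"
    by (intro tendsto_mult tendsto_const)
  moreover have "(k (of_real s * d) - p) / (of_real s * d) * (d / exp \<nu>) = u s" for s
    using d0 by (simp add: u_def divide_simps)
  ultimately have u: "(u \<longlongrightarrow> d) (at_right 0)" by simp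
  define \<tau> where "\<tau> s = of_real (ln s) + \<nu> + Ln (u s)" for s
  show ?thesis
  proof
    have "\<forall>\<^sub>F s in at_right 0. u s \<noteq> 0" using u d0(1) by (rule tendsto_imp_eventually_ne)
    then show "\<forall>\<^sub>F s in at_right 0. p + exp (\<tau> s) = k (of_real s * d)"
      using eventually_at_right_less[of "0::real"]
    proof eventually_elim
      case (elim s)
      have "exp (complex_of_real (ln s)) = of_real s" using elim by (simp add: exp_of_real)
      then have "exp (\<tau> s) = of_real s * exp \<nu> * u s" using elim by (simp add: \<tau>_def exp_add)
      then show ?case using elim by (simp add: u_def)
    qed
    have "((\<lambda>s. Ln (u s)) \<longlongrightarrow> Ln d) (at_right 0)"
      by (rule tendsto_Ln[OF u d0(2)])
    then have "((\<lambda>s. \<nu> + Ln (u s)) \<longlongrightarrow> \<nu> + Ln d) (at_right 0)" by (rule tendsto_add[OF tendsto_const])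
    then show "((\<lambda>s. \<tau> s - of_real (ln s)) \<longlongrightarrow> \<nu> + Ln d) (at_right 0)" by (simp add: \<tau>_def)
  qed
qed

lemma ray_limits:
  assumes "((\<lambda>s. \<tau> s - of_real (ln s)) \<longlongrightarrow> l) (at_right 0)"
  shows "((\<lambda>s. Im (\<tau> s)) \<longlongrightarrow> Im l) (at_right 0)" "((\<lambda>s. Re (\<tau> s) - ln s) \<longlongrightarrow> Re l) (at_right 0)"
    "filterlim (\<lambda>s. Re (\<tau> s)) at_bot (at_right 0)" "((\<lambda>s. exp (Re (\<tau> s))) \<longlongrightarrow> 0) (at_right 0)"
proof -
  show "((\<lambda>s. Im (\<tau> s)) \<longlongrightarrow> Im l) (at_right 0)" using tendsto_Im[OF assms] by simp
  show R: "((\<lambda>s. Re (\<tau> s) - ln s) \<longlongrightarrow> Re l) (at_right 0)" using tendsto_Re[OF assms] by simp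
  have "filterlim (\<lambda>s::real. - ln s) at_top (at_right 0)"
    using ln_at_0 by (simp add: filterlim_uminus_at_bot)
  then have "filterlim (\<lambda>s. - (Re (\<tau> s) - ln s) + - ln s) at_top (at_right 0)"
    by (rule filterlim_tendsto_add_at_top[OF tendsto_minus[OF R]])
  then show b: "filterlim (\<lambda>s. Re (\<tau> s)) at_bot (at_right 0)" by (simp add: filterlim_uminus_at_bot)
  show "((\<lambda>s. exp (Re (\<tau> s))) \<longlongrightarrow> 0) (at_right 0)" by (rule filterlim_compose[OF exp_at_bot b])
qed

lemma ray_in_log_sector:
  assumes \<tau>: "((\<lambda>s. \<tau> s - of_real (ln s)) \<longlongrightarrow> l) (at_right 0)" and l: "\<bar>Im l - \<theta>\<bar> < \<omega> * pi / 2"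
  shows "\<forall>\<^sub>F s in at_right 0. \<tau> s \<in> log_sector \<theta> \<omega> C \<rho>"
proof -
  note lim = ray_limits[OF \<tau>]
  have "((\<lambda>s. \<omega> * pi / 2 - C * exp (Re (\<tau> s)) - \<bar>Im (\<tau> s) - \<theta>\<bar>) \<longlongrightarrow> \<omega> * pi / 2 - C * 0 - \<bar>Im l - \<theta>\<bar>) (at_right 0)"
    by (intro tendsto_intros lim)
  then have "\<forall>\<^sub>F s in at_right 0. \<omega> * pi / 2 - C * exp (Re (\<tau> s)) - \<bar>Im (\<tau> s) - \<theta>\<bar> > 0"
    by (rule order_tendstoD) (use l in simp)
  moreover have "\<forall>\<^sub>F s in at_right 0. Re (\<tau> s) < \<rho>"
    using lim(3) by (simp add: filterlim_at_bot_dense)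
  ultimately show ?thesis by eventually_elim (simp add: log_sector_def)
qed

lemma convex_log_sector:
  assumes "C \<ge> 0" shows "convex (log_sector \<theta> \<omega> C \<rho>)"
proof (rule convexI)
  fix x y :: complex and u v :: real
  assume x: "x \<in> log_sector \<theta> \<omega> C \<rho>" and y: "y \<in> log_sector \<theta> \<omega> C \<rho>" and uv: "0 \<le> u" "0 \<le> v" "u + v = 1"
  have "exp (u * Re x + v * Re y) \<le> u * exp (Re x) + v * exp (Re y)"
  proof -
    have u: "u = 1 - v" using uv by simp
    show ?thesis unfolding u using convex_onD[OF exp_convex, of v "Re x" "Re y"] uv by simp
  qed
  then have e: "C * exp (u * Re x + v * Re y) \<le> u * (C * exp (Re x)) + v * (C * exp (Re y))"
    using mult_left_mono[OF _ assms] by (fastforce simp: algebra_simps)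
  let ?a = "\<lambda>z. \<bar>Im z - \<theta>\<bar> + C * exp (Re z)"
  have "?a x < \<omega> * pi / 2" "?a y < \<omega> * pi / 2" "Re x < \<rho>" "Re y < \<rho>"
    using x y unfolding log_sector_def mem_Collect_eq by linarith+
  then have "max (Re x) (Re y) < \<rho>" "max (?a x) (?a y) < \<omega> * pi / 2" by (simp_all only: max_less_iff_conj)
  moreover have "u * Re x + v * Re y \<le> max (Re x) (Re y)" "u * ?a x + v * ?a y \<le> max (?a x) (?a y)"
    by (intro convex_bound_le; use uv in auto)+
  moreover have "\<bar>u * Im x + v * Im y - \<theta>\<bar> \<le> u * \<bar>Im x - \<theta>\<bar> + v * \<bar>Im y - \<theta>\<bar>"
  proof -
    have "u * (Im x - \<theta>) + v * (Im y - \<theta>) = u * Im x + v * Im y - (u + v) * \<theta>" by (simp add: algebra_simps)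
    then have "u * Im x + v * Im y - \<theta> = u * (Im x - \<theta>) + v * (Im y - \<theta>)" using uv by simp
    then have "\<bar>u * Im x + v * Im y - \<theta>\<bar> \<le> \<bar>u * (Im x - \<theta>)\<bar> + \<bar>v * (Im y - \<theta>)\<bar>"
      by (simp only: abs_triangle_ineq)
    then show ?thesis using uv by (simp add: abs_mult)
  qed
  moreover have "u * ?a x + v * ?a y = u * \<bar>Im x - \<theta>\<bar> + v * \<bar>Im y - \<theta>\<bar> + (u * (C * exp (Re x)) + v * (C * exp (Re y)))"
    by (simp add: distrib_left)
  ultimately have "u * Re x + v * Re y < \<rho>"
    "\<bar>u * Im x + v * Im y - \<theta>\<bar> < \<omega> * pi / 2 - C * exp (u * Re x + v * Re y)"
    using e by linarith+
  then show "u *\<^sub>R x + v *\<^sub>R y \<in> log_sector \<theta> \<omega> C \<rho>" by (simp add: log_sector_def)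
qed

text \<open>In the logarithmic coordinate the two points for the same \<open>s\<close> stay at
  bounded distance, while the derivative of the primitive carries the factor
  \<open>exp \<tau>\<close>, which tends to 0. Convexity of \<open>log_sector\<close> allows the
  mean value inequality between them, and cutting it at the larger real part keeps that factor at
  most \<open>exp m\<close>.\<close>

lemma primitive_corner_jump:
  assumes C: "C \<ge> 0"
    and P: "\<And>\<tau>. \<tau> \<in> log_sector \<theta> \<omega> C \<rho> \<Longrightarrow> (P has_field_derivative P' (p + exp \<tau>)) (at (p + exp \<tau>))"
    and B: "\<And>\<tau>. \<tau> \<in> log_sector \<theta> \<omega> C \<rho> \<Longrightarrow> cmod (P' (p + exp \<tau>)) \<le> B"
    and \<tau>1: "((\<lambda>s. \<tau>1 s - of_real (ln s)) \<longlongrightarrow> l1) (at_right 0)" "\<bar>Im l1 - \<theta>\<bar> < \<omega> * pi / 2"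
    and \<tau>2: "((\<lambda>s. \<tau>2 s - of_real (ln s)) \<longlongrightarrow> l2) (at_right 0)" "\<bar>Im l2 - \<theta>\<bar> < \<omega> * pi / 2"
  shows "((\<lambda>s. P (p + exp (\<tau>1 s)) - P (p + exp (\<tau>2 s))) \<longlongrightarrow> 0) (at_right 0)"
proof (rule Lim_null_comparison)
  let ?b = "\<lambda>s. B * (exp (Re (\<tau>1 s)) + exp (Re (\<tau>2 s))) * cmod ((\<tau>1 s - of_real (ln s)) - (\<tau>2 s - of_real (ln s)))"
  have "(?b \<longlongrightarrow> B * (0 + 0) * cmod (l1 - l2)) (at_right 0)"
    by (intro tendsto_intros ray_limits(4)[OF \<tau>1(1)] ray_limits(4)[OF \<tau>2(1)] \<tau>1(1) \<tau>2(1))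
  then show "(?b \<longlongrightarrow> 0) (at_right 0)" by simp
  show "\<forall>\<^sub>F s in at_right 0. cmod (P (p + exp (\<tau>1 s)) - P (p + exp (\<tau>2 s))) \<le> ?b s"
    using ray_in_log_sector[OF \<tau>1, of C \<rho>] ray_in_log_sector[OF \<tau>2, of C \<rho>]
  proof eventually_elim
    case (elim s)
    define m where "m = max (Re (\<tau>1 s)) (Re (\<tau>2 s))"
    define S where "S = log_sector \<theta> \<omega> C \<rho> \<inter> {\<tau>. Re \<tau> \<le> m}"
    have "convex S" unfolding S_def by (intro convex_Int convex_log_sector C convex_halfspace_Re_le)
    moreover have "((\<lambda>\<tau>. P (p + exp \<tau>)) has_field_derivative P' (p + exp \<tau>) * exp \<tau>) (at \<tau> within S)" if "\<tau> \<in> S" for \<tau>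
    proof -
      have "\<tau> \<in> log_sector \<theta> \<omega> C \<rho>" using that by (simp add: S_def)
      then have "((\<lambda>\<tau>. P (p + exp \<tau>)) has_field_derivative P' (p + exp \<tau>) * exp \<tau>) (at \<tau>)"
        by (intro DERIV_chain2[where f = P and g = "\<lambda>\<tau>. p + exp \<tau>", OF P]) (auto intro!: derivative_eq_intros)
      then show ?thesis by (rule has_field_derivative_at_within)
    qed
    moreover have B0: "B \<ge> 0" using order_trans[OF norm_ge_zero B[OF elim(1)]] .
    have "cmod (P' (p + exp \<tau>) * exp \<tau>) \<le> B * exp m" if "\<tau> \<in> S" for \<tau>
      using that B[of \<tau>] B0 by (auto simp: S_def norm_mult norm_exp_eq_Re intro!: mult_mono)
    ultimately have "cmod (P (p + exp (\<tau>1 s)) - P (p + exp (\<tau>2 s))) \<le> B * exp m * cmod (\<tau>1 s - \<tau>2 s)"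
      using elim by (intro field_differentiable_bound[of S]) (auto simp: S_def m_def)
    also have "\<dots> \<le> ?b s"
      using B0 by (auto intro!: mult_right_mono mult_left_mono simp: m_def max_def)
    finally show ?case .
  qed
qed

text \<open>
  The first term vanishes on the straight sides \<open>\<bar>Im \<sigma>\<bar> = \<omega> \<pi> / 2\<close>. On the curved sides of \<open>log_sector\<close> it
  may have a real part as large as \<open>exp (Re \<sigma> / \<omega>) O(exp (Re \<sigma>))\<close>, which the second term, negative of
  order \<open>exp (Re \<sigma> / \<omega> + Re \<sigma> / 2)\<close> there, dominates.
\<close>

definition corner_barrier :: "real \<Rightarrow> complex \<Rightarrow> complex" where
  "corner_barrier \<omega> \<sigma> = exp (of_real (1 / \<omega>) * \<sigma>) + exp (of_real (1 / \<omega> + 1 / 2) * \<sigma>)"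

lemma Re_corner_barrier:
  "Re (corner_barrier \<omega> \<sigma>) = exp (Re \<sigma> / \<omega>) * (cos (Im \<sigma> / \<omega>) + exp (Re \<sigma> / 2) * cos (Im \<sigma> * (1 / \<omega> + 1 / 2)))"
proof -
  have "exp ((1 / \<omega> + 1 / 2) * Re \<sigma>) = exp (Re \<sigma> / \<omega>) * exp (Re \<sigma> / 2)"
    by (simp add: algebra_simps flip: exp_add)
  then show ?thesis by (simp add: corner_barrier_def Re_exp algebra_simps)
qed

lemma Re_corner_barrier_le:
  "Re (corner_barrier \<omega> \<sigma>) \<le> exp (Re \<sigma> / \<omega>) * (1 + exp (Re \<sigma> / 2))"
  unfolding Re_corner_barrier by (intro mult_left_mono add_mono) (auto intro: mult_left_le)

text \<open>With \<open>t\<close> the distance of \<open>\<bar>Im \<sigma>\<bar>\<close> from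
  \<open>\<omega> * pi / 2\<close>, the first cosine is \<open>sin (t / \<omega>)\<close>, at most
  of order \<open>exp (Re \<sigma>)\<close>. The additional exponent \<open>1 / 2\<close> turns the
  second one into \<open>- sin (\<omega> * pi / 4 - t * k)\<close>, which stays away from 0 because
  \<open>\<omega> * pi / 4\<close> lies strictly between 0 and \<open>pi / 2\<close>. Its weight
  \<open>exp (Re \<sigma> / 2)\<close> wins far to the left.\<close>

lemma corner_barrier_negative:
  assumes \<omega>: "0 < \<omega>" "\<omega> < 2" and C: "C > 0"
  obtains \<rho>1 where "\<rho>1 < \<rho>" "\<And>\<sigma>. Re \<sigma> \<le> \<rho>1 \<Longrightarrow> \<bar>Im \<sigma>\<bar> \<le> \<omega> * pi / 2 \<Longrightarrow> \<omega> * pi / 2 - C * exp (Re \<sigma>) \<le> \<bar>Im \<sigma>\<bar>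
     \<Longrightarrow> Re (corner_barrier \<omega> \<sigma>) < 0"
proof -
  define k where "k = 1 / \<omega> + 1 / 2"
  \<comment> \<open>Half of the angle \<open>\<omega> * pi / 4\<close> is left as room for
    \<open>t * k\<close>.\<close>
  define s0 where "s0 = sin (\<omega> * pi / 8)"
  have k: "k > 0" using \<omega> by (simp add: k_def add_pos_pos)
  have wp: "0 < \<omega> * pi" "\<omega> * pi < 2 * pi" using \<omega> by auto
  have s0: "s0 > 0" unfolding s0_def using wp by (intro sin_gt_zero) auto
  have "((\<lambda>r. C * exp r * k) \<longlongrightarrow> C * 0 * k) at_bot" by (intro tendsto_intros exp_at_bot)
  then have 1: "\<forall>\<^sub>F r in at_bot. C * exp r * k < \<omega> * pi / 8" by (rule order_tendstoD) (use \<omega> in simp)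
  have "((\<lambda>r. C / \<omega> * exp (r / 2)) \<longlongrightarrow> 0) at_bot" using C \<omega> by real_asymp
  then have 2: "\<forall>\<^sub>F r in at_bot. C / \<omega> * exp (r / 2) < s0" by (rule order_tendstoD) (rule s0)
  obtain N where N: "\<And>r. r \<le> N \<Longrightarrow> C * exp r * k < \<omega> * pi / 8 \<and> C / \<omega> * exp (r / 2) < s0"
    using eventually_conj[OF 1 2] by (auto simp: eventually_at_bot_linorder)
  show ?thesis
  proof
    show "min N (\<rho> - 1) < \<rho>" by simp
    fix \<sigma> assume r: "Re \<sigma> \<le> min N (\<rho> - 1)" and y: "\<bar>Im \<sigma>\<bar> \<le> \<omega> * pi / 2" "\<omega> * pi / 2 - C * exp (Re \<sigma>) \<le> \<bar>Im \<sigma>\<bar>"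
    define t where "t = \<omega> * pi / 2 - \<bar>Im \<sigma>\<bar>"
    have t: "0 \<le> t" "t \<le> C * exp (Re \<sigma>)" using y by (auto simp: t_def)
    note Nr = N[of "Re \<sigma>"]
    have "cos (Im \<sigma> / \<omega>) = cos (\<bar>Im \<sigma>\<bar> / \<omega>)" by (simp add: abs_if)
    also have "\<bar>Im \<sigma>\<bar> / \<omega> = pi / 2 - t / \<omega>" using \<omega> by (simp add: t_def field_simps)
    also have "cos (pi / 2 - t / \<omega>) = sin (t / \<omega>)" by (simp add: cos_diff)
    also have "\<dots> \<le> t / \<omega>" using t \<omega> by (intro sin_x_le_x) auto
    also have "\<dots> \<le> C * exp (Re \<sigma>) / \<omega>" using t \<omega> by (intro divide_right_mono) auto
    finally have c1: "cos (Im \<sigma> / \<omega>) \<le> C * exp (Re \<sigma>) / \<omega>" .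
    have "cos (Im \<sigma> * k) = cos (\<bar>Im \<sigma>\<bar> * k)" by (simp add: abs_if)
    also have "\<bar>Im \<sigma>\<bar> * k = pi / 2 + (\<omega> * pi / 4 - t * k)" using \<omega> by (simp add: t_def k_def field_simps)
    also have "cos (pi / 2 + (\<omega> * pi / 4 - t * k)) = - sin (\<omega> * pi / 4 - t * k)" by (simp add: cos_add)
    finally have c2: "cos (Im \<sigma> * k) = - sin (\<omega> * pi / 4 - t * k)" .
    have "t * k \<le> C * exp (Re \<sigma>) * k" using t k by (intro mult_right_mono) auto
    moreover have "C * exp (Re \<sigma>) * k < \<omega> * pi / 8" using Nr r by simp
    ultimately have tk: "t * k \<le> \<omega> * pi / 8" by linarith
    have tk0: "0 \<le> t * k" using t k by simp
    have "sin (\<omega> * pi / 8) \<le> sin (\<omega> * pi / 4 - t * k)"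
      by (rule sin_monotone_2pi_le; use wp tk tk0 in linarith)
    then have "exp (Re \<sigma> / 2) * cos (Im \<sigma> * k) \<le> exp (Re \<sigma> / 2) * (- s0)"
      unfolding c2 s0_def by (intro mult_left_mono) auto
    moreover have "C * exp (Re \<sigma>) / \<omega> = exp (Re \<sigma> / 2) * (C / \<omega> * exp (Re \<sigma> / 2))"
      by (simp flip: exp_add)
    moreover have "exp (Re \<sigma> / 2) * (C / \<omega> * exp (Re \<sigma> / 2)) < exp (Re \<sigma> / 2) * s0"
      using Nr r by (intro mult_strict_left_mono) auto
    ultimately have "cos (Im \<sigma> / \<omega>) + exp (Re \<sigma> / 2) * cos (Im \<sigma> * k) < 0" using c1 by linarith
    then show "Re (corner_barrier \<omega> \<sigma>) < 0"
      unfolding Re_corner_barrier k_def[symmetric] by (intro mult_pos_neg) auto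
  qed
qed

text \<open>The quotient \<open>F\<close> of \<open>exp (c * corner_barrier)\<close> by
  \<open>\<Phi>\<close> is controlled at each end of the region \<open>D\<close> where the barrier
  has positive real part. On the curved sides and far to the left the barrier tends to 0 while
  \<open>\<Phi>\<close> exceeds \<open>1\<close> in modulus; on the vertical edge
  \<open>\<Phi>\<close> has modulus at least some \<open>m > 1\<close>, and \<open>c\<close> is
  chosen to match. The behaviour of \<open>\<Phi>\<close> at \<open>\<Gamma>\<close> does not enter,
  since \<open>D\<close> stays inside \<open>log_sector\<close>.\<close>

lemma corner_barrier_bound:
  assumes \<omega>: "0 < \<omega>" "\<omega> < 2" and C: "C > 0"
    and Om: "open \<Omega>" and \<Phi>: "\<Phi> holomorphic_on \<Omega>" and \<Phi>1: "\<And>z. z \<in> \<Omega> \<Longrightarrow> cmod (\<Phi> z) > 1"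
    and sec: "\<And>\<tau>. \<tau> \<in> log_sector \<theta> \<omega> C \<rho> \<Longrightarrow> p + exp \<tau> \<in> \<Omega>"
  obtains c \<rho>1 where "c > 0"
    "\<And>\<sigma>. Re \<sigma> < \<rho>1 \<Longrightarrow> \<bar>Im \<sigma>\<bar> < \<omega> * pi / 2 \<Longrightarrow> Re (corner_barrier \<omega> \<sigma>) > 0 \<Longrightarrow>
       exp (c * Re (corner_barrier \<omega> \<sigma>)) \<le> cmod (\<Phi> (p + exp (\<sigma> + \<i> * of_real \<theta>)))"
proof -
  let ?B = "\<lambda>\<sigma>. Re (corner_barrier \<omega> \<sigma>)"
  obtain \<rho>1 where \<rho>1: "\<rho>1 < \<rho>" and neg: "\<And>\<sigma>. Re \<sigma> \<le> \<rho>1 \<Longrightarrow> \<bar>Im \<sigma>\<bar> \<le> \<omega> * pi / 2 \<Longrightarrow>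
      \<omega> * pi / 2 - C * exp (Re \<sigma>) \<le> \<bar>Im \<sigma>\<bar> \<Longrightarrow> ?B \<sigma> < 0"
    by (rule corner_barrier_negative[OF \<omega> C], rule that)
  define z where "z \<sigma> = p + exp (\<sigma> + \<i> * of_real \<theta>)" for \<sigma>
  define H where "H = {\<sigma>. Re \<sigma> \<le> \<rho>1 \<and> \<bar>Im \<sigma>\<bar> \<le> \<omega> * pi / 2 \<and> 0 \<le> ?B \<sigma>}"
  have HS: "\<sigma> + \<i> * of_real \<theta> \<in> log_sector \<theta> \<omega> C \<rho>" if "\<sigma> \<in> H" for \<sigma>
    using neg[of \<sigma>] that \<rho>1 by (force simp: H_def log_sector_def)
  have HO: "z \<sigma> \<in> \<Omega>" if "\<sigma> \<in> H" for \<sigma> unfolding z_def by (rule sec[OF HS[OF that]])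
  have cB: "continuous_on A ?B" for A unfolding corner_barrier_def by (intro continuous_intros)
  have Hcl: "closed H"
  proof -
    have "H = {\<sigma>. Re \<sigma> \<le> \<rho>1} \<inter> {\<sigma>. \<bar>Im \<sigma>\<bar> \<le> \<omega> * pi / 2} \<inter> {\<sigma>. 0 \<le> ?B \<sigma>}" by (auto simp: H_def)
    moreover have "closed {\<sigma>. Re \<sigma> \<le> \<rho>1}" "closed {\<sigma>. \<bar>Im \<sigma>\<bar> \<le> \<omega> * pi / 2}" "closed {\<sigma>. 0 \<le> ?B \<sigma>}"
      by (intro closed_Collect_le continuous_intros cB)+
    ultimately show ?thesis by auto
  qed
  have \<Phi>c: "continuous_on H (\<lambda>\<sigma>. \<Phi> (z \<sigma>))"
    by (rule continuous_on_compose2[OF holomorphic_on_imp_continuous_on[OF \<Phi>]])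
       (use HO in \<open>auto simp: z_def intro!: continuous_intros\<close>)
  have bnd: "bounded {\<sigma>. X \<le> Re \<sigma> \<and> Re \<sigma> \<le> \<rho>1 \<and> \<bar>Im \<sigma>\<bar> \<le> \<omega> * pi / 2}" for X
  proof (rule boundedI)
    fix \<sigma> assume "\<sigma> \<in> {\<sigma>. X \<le> Re \<sigma> \<and> Re \<sigma> \<le> \<rho>1 \<and> \<bar>Im \<sigma>\<bar> \<le> \<omega> * pi / 2}"
    then show "cmod \<sigma> \<le> (\<bar>X\<bar> + \<bar>\<rho>1\<bar>) + \<omega> * pi / 2"
      by (intro order_trans[OF cmod_le] add_mono) auto
  qed
  have "\<exists>m>1. \<forall>\<sigma>\<in>H. Re \<sigma> = \<rho>1 \<longrightarrow> m \<le> cmod (\<Phi> (z \<sigma>))"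
  proof (cases "H \<inter> {\<sigma>. Re \<sigma> = \<rho>1} = {}")
    case True
    then show ?thesis by (intro exI[of _ 2]) auto
  next
    case False
    have "closed {\<sigma>. Re \<sigma> = \<rho>1}" by (intro closed_Collect_eq continuous_intros)
    moreover have "bounded (H \<inter> {\<sigma>. Re \<sigma> = \<rho>1})"
      by (rule bounded_subset[OF bnd[of \<rho>1]]) (auto simp: H_def)
    ultimately have "compact (H \<inter> {\<sigma>. Re \<sigma> = \<rho>1})"
      using Hcl by (auto simp: compact_eq_bounded_closed)
    moreover have "continuous_on (H \<inter> {\<sigma>. Re \<sigma> = \<rho>1}) (\<lambda>\<sigma>. cmod (\<Phi> (z \<sigma>)))"
      by (intro continuous_on_norm continuous_on_subset[OF \<Phi>c]) auto
    ultimately obtain x where x: "x \<in> H \<inter> {\<sigma>. Re \<sigma> = \<rho>1}"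
        "\<forall>y\<in>H \<inter> {\<sigma>. Re \<sigma> = \<rho>1}. cmod (\<Phi> (z x)) \<le> cmod (\<Phi> (z y))"
      using continuous_attains_inf[OF _ False] by blast
    then show ?thesis using \<Phi>1[OF HO[of x]] by (intro exI[of _ "cmod (\<Phi> (z x))"]) auto
  qed
  then obtain m where m: "m > 1" "\<And>\<sigma>. \<sigma> \<in> H \<Longrightarrow> Re \<sigma> = \<rho>1 \<Longrightarrow> m \<le> cmod (\<Phi> (z \<sigma>))" by blast
  \<comment> \<open>An upper bound for the barrier on the edge \<open>Re \<sigma> = \<rho>1\<close>;
    with \<open>c = ln m / Bm\<close> the comparison holds there.\<close>
  define Bm where "Bm = exp (\<rho>1 / \<omega>) * (1 + exp (\<rho>1 / 2))"
  have Bm: "Bm > 0" by (simp add: Bm_def add_pos_pos)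
  define c where "c = ln m / Bm"
  have c: "c > 0" using m Bm by (simp add: c_def)
  define D where "D = {\<sigma>. Re \<sigma> < \<rho>1 \<and> \<bar>Im \<sigma>\<bar> < \<omega> * pi / 2 \<and> 0 < ?B \<sigma>}"
  have DH: "D \<subseteq> H" by (auto simp: D_def H_def)
  have D: "open D"
  proof -
    have "D = {\<sigma>. Re \<sigma> < \<rho>1} \<inter> {\<sigma>. \<bar>Im \<sigma>\<bar> < \<omega> * pi / 2} \<inter> {\<sigma>. 0 < ?B \<sigma>}" by (auto simp: D_def)
    moreover have "open {\<sigma>. Re \<sigma> < \<rho>1}" "open {\<sigma>. \<bar>Im \<sigma>\<bar> < \<omega> * pi / 2}" "open {\<sigma>. 0 < ?B \<sigma>}"
      by (intro open_Collect_less continuous_intros cB)+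
    ultimately show ?thesis by auto
  qed
  define F where "F \<sigma> = exp (of_real c * corner_barrier \<omega> \<sigma>) / \<Phi> (z \<sigma>)" for \<sigma>
  have nF: "cmod (F \<sigma>) = exp (c * ?B \<sigma>) / cmod (\<Phi> (z \<sigma>))" for \<sigma>
    by (simp add: F_def norm_divide norm_exp_eq_Re)
  have ne: "\<Phi> (z \<sigma>) \<noteq> 0" if "\<sigma> \<in> H" for \<sigma> using \<Phi>1[OF HO[OF that]] by auto
  have zh: "z holomorphic_on D" unfolding z_def by (intro holomorphic_intros)
  have "\<Phi> \<circ> z holomorphic_on D"
    by (rule holomorphic_on_compose_gen[OF zh \<Phi>]) (use HO DH in auto)
  then have "(\<lambda>\<sigma>. \<Phi> (z \<sigma>)) holomorphic_on D" by (simp add: o_def)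
  then have Fh: "F holomorphic_on D"
    unfolding F_def corner_barrier_def using ne DH by (intro holomorphic_intros) auto
  have Fc: "continuous_on H F"
    unfolding F_def corner_barrier_def using ne by (intro continuous_intros \<Phi>c) auto
  have le: "cmod (F \<sigma>) \<le> 1" if \<sigma>: "\<sigma> \<in> D" for \<sigma>
  proof (rule maximum_principle_compact[OF D Fh _ \<sigma>])
    fix e :: real assume e: "e > 0"
    define \<mu> where "\<mu> = ln (1 + e) / c"
    have \<mu>: "\<mu> > 0" using e c by (simp add: \<mu>_def)
    \<comment> \<open>Requiring \<open>?B \<sigma> \<ge> \<mu>\<close> bounds \<open>K\<close> on
      the left and keeps it off the zero level of the barrier, while
      \<open>cmod (F \<sigma>) \<ge> 1 + e\<close> keeps it off the vertical edge. Off
      \<open>K\<close> one of the two fails, and each failure gives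
      \<open>cmod (F \<sigma>) \<le> 1 + e\<close>, the first because
      \<open>\<mu> = ln (1 + e) / c\<close>.\<close>
    define K where "K = H \<inter> {\<sigma>. \<mu> \<le> ?B \<sigma>} \<inter> (H \<inter> (\<lambda>\<sigma>. cmod (F \<sigma>)) -` {1 + e..})"
    have "((\<lambda>r. exp (r / \<omega>) * (1 + exp (r / 2))) \<longlongrightarrow> 0) at_bot" using \<omega> by real_asymp
    then have "\<forall>\<^sub>F r in at_bot. exp (r / \<omega>) * (1 + exp (r / 2)) < \<mu>" by (rule order_tendstoD) (rule \<mu>)
    then obtain X where X: "\<And>r. r \<le> X \<Longrightarrow> exp (r / \<omega>) * (1 + exp (r / 2)) < \<mu>"
      by (auto simp: eventually_at_bot_linorder)
    have "K \<subseteq> {\<sigma>. X \<le> Re \<sigma> \<and> Re \<sigma> \<le> \<rho>1 \<and> \<bar>Im \<sigma>\<bar> \<le> \<omega> * pi / 2}"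
    proof
      fix \<sigma> assume \<sigma>: "\<sigma> \<in> K"
      then have "\<mu> \<le> exp (Re \<sigma> / \<omega>) * (1 + exp (Re \<sigma> / 2))"
        using Re_corner_barrier_le[of \<omega> \<sigma>] by (auto simp: K_def)
      then have "\<not> Re \<sigma> \<le> X" using X[of "Re \<sigma>"] by linarith
      then show "\<sigma> \<in> {\<sigma>. X \<le> Re \<sigma> \<and> Re \<sigma> \<le> \<rho>1 \<and> \<bar>Im \<sigma>\<bar> \<le> \<omega> * pi / 2}" using \<sigma> by (auto simp: K_def H_def)
    qed
    then have "bounded K" by (rule bounded_subset[OF bnd])
    moreover have "closed (H \<inter> (\<lambda>\<sigma>. cmod (F \<sigma>)) -` {1 + e..})"
      by (rule continuous_closed_preimage[OF continuous_on_norm[OF Fc] Hcl closed_atLeast])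
    moreover have "closed {\<sigma>. \<mu> \<le> ?B \<sigma>}" by (intro closed_Collect_le continuous_intros cB)
    ultimately have "bounded K" "closed K" unfolding K_def using closed_Int[OF closed_Int[OF Hcl]] by simp_all
    then have "compact K" by (simp add: compact_eq_bounded_closed)
    moreover have "K \<subseteq> D"
    proof
      fix \<sigma> assume \<sigma>: "\<sigma> \<in> K"
      then have H: "\<sigma> \<in> H" "\<mu> \<le> ?B \<sigma>" "1 + e \<le> cmod (F \<sigma>)" by (auto simp: K_def)
      have "\<bar>Im \<sigma>\<bar> < \<omega> * pi / 2"
      proof (rule ccontr)
        assume ge: "\<not> ?thesis"
        have "0 < C * exp (Re \<sigma>)" using C by simp
        then have "?B \<sigma> < 0" using H(1) ge unfolding H_def by (intro neg) auto
        then show False using H(1) by (simp add: H_def)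
      qed
      moreover have "Re \<sigma> \<noteq> \<rho>1"
      proof
        assume r: "Re \<sigma> = \<rho>1"
        have "?B \<sigma> \<le> Bm" using Re_corner_barrier_le[of \<omega> \<sigma>] by (simp add: r Bm_def)
        then have "c * ?B \<sigma> \<le> c * Bm" using c by (intro mult_left_mono) auto
        also have "\<dots> = ln m" using Bm by (simp add: c_def)
        finally have "exp (c * ?B \<sigma>) \<le> m" using m by (simp add: ln_ge_iff)
        then have "cmod (F \<sigma>) \<le> 1" using m(2)[OF H(1) r] m(1) by (simp add: nF divide_le_eq_1)
        then show False using H e by simp
      qed
      ultimately show "\<sigma> \<in> D" using H \<mu> by (auto simp: D_def H_def)
    qed
    moreover have "\<forall>\<sigma>\<in>D - K. cmod (F \<sigma>) \<le> 1 + e"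
    proof
      fix \<sigma> assume \<sigma>: "\<sigma> \<in> D - K"
      then consider "?B \<sigma> < \<mu>" | "cmod (F \<sigma>) < 1 + e" using DH by (force simp: K_def)
      then show "cmod (F \<sigma>) \<le> 1 + e"
      proof cases
        case 1
        then have "c * ?B \<sigma> \<le> ln (1 + e)" using c by (simp add: \<mu>_def field_simps)
        then have "exp (c * ?B \<sigma>) \<le> 1 + e" using e by (simp add: ln_ge_iff)
        moreover have "cmod (F \<sigma>) \<le> exp (c * ?B \<sigma>)"
        proof -
          have "\<sigma> \<in> H" using \<sigma> DH by blast
          then have "1 < cmod (\<Phi> (z \<sigma>))" by (rule \<Phi>1[OF HO])
          then have "exp (c * ?B \<sigma>) / cmod (\<Phi> (z \<sigma>)) \<le> exp (c * ?B \<sigma>) / 1"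
            by (intro divide_left_mono) auto
          then show ?thesis by (simp add: nF)
        qed
        ultimately show ?thesis by linarith
      qed simp
    qed
    ultimately show "\<exists>K. compact K \<and> K \<subseteq> D \<and> (\<forall>z\<in>D - K. cmod (F z) \<le> 1 + e)" by blast
  qed
  show ?thesis
  proof (rule that[OF c])
    fix \<sigma> assume "Re \<sigma> < \<rho>1" "\<bar>Im \<sigma>\<bar> < \<omega> * pi / 2" "Re (corner_barrier \<omega> \<sigma>) > 0"
    then have \<sigma>: "\<sigma> \<in> D" by (simp add: D_def)
    then have "cmod (\<Phi> (z \<sigma>)) > 0" using \<Phi>1[OF HO[of \<sigma>]] DH by (auto intro: less_trans[OF zero_less_one])
    then show "exp (c * Re (corner_barrier \<omega> \<sigma>)) \<le> cmod (\<Phi> (p + exp (\<sigma> + \<i> * of_real \<theta>)))"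
      using le[OF \<sigma>] unfolding nF z_def by (simp add: divide_le_eq_1)
  qed
qed

text \<open>On a ray strictly inside the sector the barrier divided by
  \<open>s powr (1 / \<omega>)\<close> tends to \<open>a = exp (Re l / \<omega>) * cos ((Im l -
  \<theta>) / \<omega>)\<close>, which is positive; the correction term has a higher power of
  \<open>s\<close> and drops out.\<close>

lemma corner_ray_decay:
  fixes k :: "real \<Rightarrow> complex" and \<Phi> :: "complex \<Rightarrow> complex" and \<tau> :: "real \<Rightarrow> complex"
  assumes \<omega>: "0 < \<omega>" "\<omega> < 2" and c: "c > 0"
    and bound: "\<And>\<sigma>. Re \<sigma> < \<rho>1 \<Longrightarrow> \<bar>Im \<sigma>\<bar> < \<omega> * pi / 2 \<Longrightarrow> Re (corner_barrier \<omega> \<sigma>) > 0 \<Longrightarrow>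
       exp (c * Re (corner_barrier \<omega> \<sigma>)) \<le> cmod (\<Phi> (p + exp (\<sigma> + \<i> * of_real \<theta>)))"
    and \<tau>: "\<forall>\<^sub>F s in at_right 0. p + exp (\<tau> s) = k s"
       "((\<lambda>s. \<tau> s - of_real (ln s)) \<longlongrightarrow> l) (at_right 0)"
    and l: "\<bar>Im l - \<theta>\<bar> < \<omega> * pi / 2"
  obtains c' \<delta> where "c' > 0" "\<delta> > 0" "\<And>s. 0 < s \<Longrightarrow> s < \<delta> \<Longrightarrow> exp (c' * s powr (1 / \<omega>)) \<le> cmod (\<Phi> (k s))"
proof -
  define \<sigma> where "\<sigma> s = \<tau> s - \<i> * of_real \<theta>" for s
  define c0 where "c0 = cos ((Im l - \<theta>) / \<omega>)"
  have c0: "c0 > 0"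
  proof -
    have "\<bar>(Im l - \<theta>) / \<omega>\<bar> < pi / 2" using l \<omega> by (simp add: abs_divide divide_less_eq mult.commute)
    then have "- (pi / 2) < (Im l - \<theta>) / \<omega>" "(Im l - \<theta>) / \<omega> < pi / 2" by linarith+
    then show ?thesis unfolding c0_def by (rule cos_gt_zero_pi)
  qed
  note lim = ray_limits[OF \<tau>(2)]
  have e2: "((\<lambda>s. exp (Re (\<tau> s) / 2)) \<longlongrightarrow> 0) (at_right 0)"
  proof -
    have "((\<lambda>s. sqrt (exp (Re (\<tau> s)))) \<longlongrightarrow> sqrt 0) (at_right 0)" by (intro tendsto_intros lim(4))
    moreover have "sqrt (exp x) = exp (x / 2)" for x :: real
      by (rule real_sqrt_unique) (simp_all add: power2_eq_square flip: exp_add)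
    ultimately show ?thesis by simp
  qed
  have Im\<sigma>: "Im (\<sigma> s) = Im (\<tau> s) - \<theta>" for s by (simp add: \<sigma>_def)
  define A where "A s = exp ((Re (\<tau> s) - ln s) / \<omega>) * (cos (Im (\<sigma> s) / \<omega>) + exp (Re (\<tau> s) / 2) * cos (Im (\<sigma> s) * (1 / \<omega> + 1 / 2)))" for s
  define a where "a = exp (Re l / \<omega>) * c0"
  have a: "a > 0" using c0 by (simp add: a_def)
  have "(A \<longlongrightarrow> exp (Re l / \<omega>) * (cos ((Im l - \<theta>) / \<omega>) + 0 * cos ((Im l - \<theta>) * (1 / \<omega> + 1 / 2)))) (at_right 0)"
    unfolding A_def Im\<sigma> by (intro tendsto_intros lim e2) (use \<omega> in auto)
  then have "(A \<longlongrightarrow> a) (at_right 0)" by (simp add: a_def c0_def)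
  then have evA: "\<forall>\<^sub>F s in at_right 0. A s > a / 2" by (rule order_tendstoD) (use a in simp)
  have "((\<lambda>s. \<bar>Im (\<tau> s) - \<theta>\<bar>) \<longlongrightarrow> \<bar>Im l - \<theta>\<bar>) (at_right 0)" by (intro tendsto_intros lim)
  then have evI: "\<forall>\<^sub>F s in at_right 0. \<bar>Im (\<tau> s) - \<theta>\<bar> < \<omega> * pi / 2" by (rule order_tendstoD) (rule l)
  have evR: "\<forall>\<^sub>F s in at_right 0. Re (\<tau> s) < \<rho>1" using lim(3) by (simp add: filterlim_at_bot_dense)
  have "\<forall>\<^sub>F s in at_right 0. exp (c * (a / 2) * s powr (1 / \<omega>)) \<le> cmod (\<Phi> (k s))"
    using evA evI evR \<tau>(1) eventually_at_right_less[of "0::real"]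
  proof eventually_elim
    case (elim s)
    have "exp (Re (\<sigma> s) / \<omega>) = exp ((Re (\<tau> s) - ln s) / \<omega>) * s powr (1 / \<omega>)"
      using elim by (simp add: \<sigma>_def powr_def diff_divide_distrib flip: exp_add)
    then have B: "Re (corner_barrier \<omega> (\<sigma> s)) = A s * s powr (1 / \<omega>)"
      by (simp add: Re_corner_barrier A_def) (simp add: \<sigma>_def)
    have "a / 2 * s powr (1 / \<omega>) \<le> A s * s powr (1 / \<omega>)" using elim by (intro mult_right_mono) auto
    then have i1: "c * (a / 2 * s powr (1 / \<omega>)) \<le> c * Re (corner_barrier \<omega> (\<sigma> s))"
      unfolding B using c by (intro mult_left_mono) auto
    have "Re (corner_barrier \<omega> (\<sigma> s)) > 0" unfolding B using elim a by (intro mult_pos_pos) auto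
    then have i2: "exp (c * Re (corner_barrier \<omega> (\<sigma> s))) \<le> cmod (\<Phi> (p + exp (\<sigma> s + \<i> * of_real \<theta>)))"
      using elim by (intro bound) (auto simp: \<sigma>_def)
    have "p + exp (\<sigma> s + \<i> * of_real \<theta>) = k s" using elim by (simp add: \<sigma>_def)
    moreover have "exp (c * (a / 2) * s powr (1 / \<omega>)) \<le> exp (c * Re (corner_barrier \<omega> (\<sigma> s)))"
      using i1 by (simp add: mult.assoc)
    ultimately show ?case using i2 by (metis order_trans)
  qed
  then obtain \<delta> where "\<delta> > 0" "\<And>s. 0 < s \<Longrightarrow> s < \<delta> \<Longrightarrow> exp (c * (a / 2) * s powr (1 / \<omega>)) \<le> cmod (\<Phi> (k s))"
    by (auto simp: eventually_at_right_field)
  then show ?thesis using that[of "c * (a / 2)" \<delta>] c a by auto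
qed

section \<open>Boundary behaviour of the exterior map\<close>

lemma connected_exterior:
  assumes E: "exterior_map G \<Phi> \<gamma>" shows "connected (- closure G)"
proof -
  have "connected {w::complex. cmod w > 1}"
    using connected_complement_bounded_convex[OF bounded_cball convex_cball, of "0::complex" 1]
    by (simp add: cball_def Compl_eq not_le)
  then have "connected (inv_into (- closure G) \<Phi> ` {w. cmod w > 1})"
    by (intro connected_continuous_image holomorphic_on_imp_continuous_on exterior_map_inverse_holomorphic[OF E])
  moreover have "inv_into (- closure G) \<Phi> ` {w. cmod w > 1} = - closure G"
  proof
    show "- closure G \<subseteq> inv_into (- closure G) \<Phi> ` {w. cmod w > 1}"
    proof
      fix z assume "z \<in> - closure G"
      then show "z \<in> inv_into (- closure G) \<Phi> ` {w. cmod w > 1}"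
        using exterior_map_inverse(1,4)[OF E, of z] by (intro image_eqI[of _ _ "\<Phi> z"]) auto
    qed
  qed (use exterior_map_inverse(2)[OF E] in auto)
  ultimately show ?thesis by simp
qed

text \<open>The inverse map differs from a linear function by a bounded amount near infinity, so a
  large value of \<open>\<Phi> z\<close> forces a large \<open>z\<close>.\<close>

lemma exterior_map_bounded:
  assumes E: "exterior_map G \<Phi> \<gamma>"
    and L: "laurent_at_infinity (inv_into (- closure G) \<Phi>) (complex_of_real (1 / \<gamma>)) b 1"
  obtains M where "\<And>z. z \<notin> closure G \<Longrightarrow> cmod z \<le> B \<Longrightarrow> cmod (\<Phi> z) \<le> M"
proof -
  have \<gamma>: "\<gamma> > 0" using E by (simp add: exterior_map_def)
  obtain B' R where B': "B' > 0" "R \<ge> 1"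
    "\<And>w. cmod w \<ge> R \<Longrightarrow> cmod (inv_into (- closure G) \<Phi> w - complex_of_real (1 / \<gamma>) * w) \<le> B'"
    using laurent_bounded_at_infinity[OF L] by metis
  show ?thesis
  proof
    fix z assume z: "z \<notin> closure G" "cmod z \<le> B"
    show "cmod (\<Phi> z) \<le> max R (\<gamma> * (B + B'))"
    proof (cases "cmod (\<Phi> z) \<ge> R")
      case True
      define w where "w = complex_of_real (1 / \<gamma>) * \<Phi> z"
      have "cmod (z - w) \<le> B'"
        using B'(3)[OF True] exterior_map_inverse(1)[OF E z(1)] by (simp add: w_def)
      then have "cmod w \<le> B + B'" using z(2) norm_triangle_ineq4[of z "z - w"] by simp
      moreover have "cmod w = cmod (\<Phi> z) / \<gamma>" using \<gamma> by (simp add: w_def norm_mult norm_divide)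
      ultimately have "cmod (\<Phi> z) \<le> \<gamma> * (B + B')" using \<gamma> by (simp add: field_simps)
      then show ?thesis by simp
    qed simp
  qed
qed

text \<open>Properness: the part of the exterior mapped into the annulus
  \<open>1 + e \<le> cmod w \<le> M\<close> is the image of a compact set under the inverse map,
  hence at positive distance from \<open>p\<close>.\<close>

lemma exterior_map_boundary:
  assumes E: "exterior_map G \<Phi> \<gamma>"
    and L: "laurent_at_infinity (inv_into (- closure G) \<Phi>) (complex_of_real (1 / \<gamma>)) b 1"
    and p: "p \<in> closure G"
  shows "((\<lambda>z. cmod (\<Phi> z)) \<longlongrightarrow> 1) (at p within - closure G)"
proof (rule tendstoI)
  fix e :: real assume e: "e > 0"
  obtain M where M: "\<And>z. z \<notin> closure G \<Longrightarrow> cmod z \<le> cmod p + 1 \<Longrightarrow> cmod (\<Phi> z) \<le> M"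
    by (rule exterior_map_bounded[OF E L, of "cmod p + 1"], rule that)
  define A where "A = cball (0::complex) M - ball 0 (1 + e)"
  have "compact A" unfolding A_def by (intro compact_diff) auto
  moreover have "A \<subseteq> {w. cmod w > 1}" using e by (auto simp: A_def)
  then have "continuous_on A (inv_into (- closure G) \<Phi>)"
    using exterior_map_inverse_holomorphic[OF E] holomorphic_on_imp_continuous_on continuous_on_subset by blast
  ultimately have cl: "closed (inv_into (- closure G) \<Phi> ` A)"
    by (intro compact_imp_closed compact_continuous_image)
  have "p \<notin> inv_into (- closure G) \<Phi> ` A"
    using \<open>A \<subseteq> {w. cmod w > 1}\<close> exterior_map_inverse(2)[OF E] p by fastforce
  then obtain d where d: "d > 0" "\<forall>z\<in>inv_into (- closure G) \<Phi> ` A. d \<le> dist p z"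
    using separate_point_closed[OF cl] by blast
  show "\<forall>\<^sub>F z in at p within - closure G. dist (cmod (\<Phi> z)) 1 < e"
    unfolding eventually_at
  proof (intro exI[of _ "min d 1"] conjI ballI impI)
    show "min d 1 > 0" using d by simp
    fix z assume z: "z \<in> - closure G" "z \<noteq> p \<and> dist z p < min d 1"
    have "cmod z \<le> cmod p + 1" using z norm_triangle_sub[of z p] by (auto simp: dist_norm)
    then have "cmod (\<Phi> z) \<le> M" using M z by auto
    moreover have "\<Phi> z \<notin> A"
    proof
      assume "\<Phi> z \<in> A"
      then have "z \<in> inv_into (- closure G) \<Phi> ` A"
        using exterior_map_inverse(1)[OF E, of z] z(1) by (intro image_eqI[of _ _ "\<Phi> z"]) auto
      then show False using d(2) z(2) by (force simp: dist_commute)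
    qed
    ultimately have "cmod (\<Phi> z) < 1 + e" by (auto simp: A_def)
    moreover have "cmod (\<Phi> z) > 1" using exterior_map_inverse(4)[OF E] z(1) by auto
    ultimately show "dist (cmod (\<Phi> z)) 1 < e" by (simp add: dist_real_def)
  qed
qed

text \<open>A Lebesgue number settles the middle of the segment, the two wedges settle its ends, and
  a small slope makes the rhombus thin enough to fit into their union.\<close>

lemma rhombus_uniform:
  assumes ab: "a < b"
    and int: "\<And>x. a < x \<Longrightarrow> x < b \<Longrightarrow> \<exists>r>0. \<forall>\<zeta>. dist \<zeta> (of_real x) < r \<longrightarrow> Im \<zeta> \<noteq> 0 \<longrightarrow> good \<zeta>"
    and left: "ra > 0" "\<kappa>a > 0" "\<And>\<zeta>. dist \<zeta> (of_real a) < ra \<Longrightarrow> Im \<zeta> \<noteq> 0 \<Longrightarrow> \<bar>Im \<zeta>\<bar> < \<kappa>a * (Re \<zeta> - a) \<Longrightarrow> good \<zeta>"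
    and right: "rb > 0" "\<kappa>b > 0" "\<And>\<zeta>. dist \<zeta> (of_real b) < rb \<Longrightarrow> Im \<zeta> \<noteq> 0 \<Longrightarrow> \<bar>Im \<zeta>\<bar> < \<kappa>b * (b - Re \<zeta>) \<Longrightarrow> good \<zeta>"
  obtains \<kappa> where "\<kappa> > 0" "\<And>\<zeta>. \<zeta> \<in> lower_half a b \<kappa> \<union> upper_half a b \<kappa> \<Longrightarrow> good \<zeta>"
proof -
  define I where "I = {a + ra / 2..b - rb / 2} \<inter> {a<..<b}"
  have Ieq: "I = {a + ra / 2..b - rb / 2}" using left right by (auto simp: I_def)
  have "\<forall>x\<in>I. \<exists>r>0. \<forall>\<zeta>. dist \<zeta> (of_real x) < r \<longrightarrow> Im \<zeta> \<noteq> 0 \<longrightarrow> good \<zeta>" using int by (auto simp: I_def)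
  then obtain d where d: "\<And>x. x \<in> I \<Longrightarrow> d x > 0"
    "\<And>x \<zeta>. x \<in> I \<Longrightarrow> dist \<zeta> (of_real x) < d x \<Longrightarrow> Im \<zeta> \<noteq> 0 \<Longrightarrow> good \<zeta>"
    by metis
  define \<G> where "\<G> = (\<lambda>x. ball (complex_of_real x) (d x)) ` I"
  have "compact (complex_of_real ` I)" unfolding Ieq by (intro compact_continuous_image continuous_intros) auto
  moreover have "complex_of_real ` I \<subseteq> \<Union>\<G>" using d(1) by (auto simp: \<G>_def)
  moreover have "\<And>G. G \<in> \<G> \<Longrightarrow> open G" by (auto simp: \<G>_def)
  ultimately obtain r where r: "r > 0" "\<And>x. x \<in> complex_of_real ` I \<Longrightarrow> \<exists>G\<in>\<G>. ball x r \<subseteq> G"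
    using Heine_Borel_lemma by metis
  define m where "m = min r (min (ra / 2) (rb / 2))"
  have m: "m > 0" using r left right by (simp add: m_def)
  \<comment> \<open>The quotient \<open>m / (b - a)\<close> forces the height of the rhombus below
    \<open>m\<close>.\<close>
  define \<kappa> where "\<kappa> = min (min \<kappa>a \<kappa>b) (m / (b - a))"
  have \<kappa>: "\<kappa> > 0" using left right m ab by (simp add: \<kappa>_def)
  show ?thesis
  proof (rule that[OF \<kappa>])
    fix \<zeta> assume "\<zeta> \<in> lower_half a b \<kappa> \<union> upper_half a b \<kappa>"
    then have z: "Im \<zeta> \<noteq> 0" "\<bar>Im \<zeta>\<bar> < \<kappa> * (Re \<zeta> - a)" "\<bar>Im \<zeta>\<bar> < \<kappa> * (b - Re \<zeta>)"
      by (auto simp: lower_half_def upper_half_def)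
    have "0 < \<kappa> * (Re \<zeta> - a)" "0 < \<kappa> * (b - Re \<zeta>)" using z(2,3) abs_ge_zero[of "Im \<zeta>"] by linarith+
    then have Re: "a < Re \<zeta>" "Re \<zeta> < b" using \<kappa> by (auto simp: zero_less_mult_iff)
    have "\<kappa> * (Re \<zeta> - a) \<le> \<kappa> * (b - a)" using \<kappa> Re by (intro mult_left_mono) auto
    also have "\<dots> \<le> m / (b - a) * (b - a)" using ab by (intro mult_right_mono) (auto simp: \<kappa>_def)
    finally have Im: "\<bar>Im \<zeta>\<bar> < m" using z(2) ab by simp
    have dist: "dist \<zeta> (of_real y) \<le> \<bar>Re \<zeta> - y\<bar> + \<bar>Im \<zeta>\<bar>" for y
      using cmod_le[of "\<zeta> - of_real y"] by (simp add: dist_norm)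
    consider "Re \<zeta> < a + ra / 2" | "Re \<zeta> > b - rb / 2" | "Re \<zeta> \<in> I" using Ieq by fastforce
    then show "good \<zeta>"
    proof cases
      case 1
      have "dist \<zeta> (of_real a) < ra" using dist[of a] 1 Re Im by (auto simp: m_def)
      moreover have "\<kappa> * (Re \<zeta> - a) \<le> \<kappa>a * (Re \<zeta> - a)" using Re by (intro mult_right_mono) (auto simp: \<kappa>_def)
      ultimately show ?thesis using left(3) z by auto
    next
      case 2
      have "dist \<zeta> (of_real b) < rb" using dist[of b] 2 Re Im by (auto simp: m_def)
      moreover have "\<kappa> * (b - Re \<zeta>) \<le> \<kappa>b * (b - Re \<zeta>)" using Re by (intro mult_right_mono) (auto simp: \<kappa>_def)
      ultimately show ?thesis using right(3) z by auto
    next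
      case 3
      obtain y where y: "y \<in> I" "ball (of_real (Re \<zeta>)) r \<subseteq> ball (complex_of_real y) (d y)"
        using r(2)[of "of_real (Re \<zeta>)"] 3 by (auto simp: \<G>_def)
      have "dist \<zeta> (of_real (Re \<zeta>)) < r" using dist[of "Re \<zeta>"] Im by (simp add: m_def)
      then have "\<zeta> \<in> ball (of_real (Re \<zeta>)) r" by (simp add: dist_commute)
      then have "\<zeta> \<in> ball (complex_of_real y) (d y)" using y(2) by blast
      then show ?thesis using d(2)[OF y(1), of \<zeta>] z(1) by (simp add: dist_commute)
    qed
  qed
qed

lemma lower_half_mono: "\<kappa> \<le> \<kappa>' \<Longrightarrow> a < b \<Longrightarrow> 0 < \<kappa> \<Longrightarrow> lower_half a b \<kappa> \<subseteq> lower_half a b \<kappa>'"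
proof
  fix \<zeta> assume k: "\<kappa> \<le> \<kappa>'" "0 < \<kappa>" and z: "\<zeta> \<in> lower_half a b \<kappa>"
  then have "0 < \<kappa> * (Re \<zeta> - a)" "0 < \<kappa> * (b - Re \<zeta>)" by (auto simp: lower_half_def)
  then have "0 < Re \<zeta> - a" "0 < b - Re \<zeta>" using k by (auto simp: zero_less_mult_iff)
  then have "\<kappa> * (Re \<zeta> - a) \<le> \<kappa>' * (Re \<zeta> - a)" "\<kappa> * (b - Re \<zeta>) \<le> \<kappa>' * (b - Re \<zeta>)"
    using k by (intro mult_right_mono; simp)+
  then show "\<zeta> \<in> lower_half a b \<kappa>'" using z by (simp add: lower_half_def)
qed

lemma upper_half_mono: "\<kappa> \<le> \<kappa>' \<Longrightarrow> a < b \<Longrightarrow> 0 < \<kappa> \<Longrightarrow> upper_half a b \<kappa> \<subseteq> upper_half a b \<kappa>'"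
  using lower_half_mono[of \<kappa> \<kappa>' a b] unfolding subset_iff cnj_upper_half[symmetric] by blast

text \<open>The parameters in \<open>bad\<close> form a compact set whose image misses
  \<open>g x\<close>, so this image has a positive distance from \<open>g x\<close>. The second
  alternative accounts for the base point, where parameters near 0 and near \<open>1\<close>
  meet.\<close>

lemma simple_loop_near:
  fixes g :: "real \<Rightarrow> complex"
  assumes g: "simple_path g" "pathfinish g = pathstart g" and x: "x \<in> {0..1}" and \<delta>: "\<delta> > 0"
  obtains r where "r > 0" "\<And>y. y \<in> {0..1} \<Longrightarrow> dist (g y) (g x) < r \<Longrightarrow>
     \<bar>y - x\<bar> < \<delta> \<or> (x = 0 \<or> x = 1) \<and> (y < \<delta> \<or> y > 1 - \<delta>)"
proof -
  define bad where "bad = {0..1} - ({x - \<delta><..<x + \<delta>} \<union> (if x = 0 \<or> x = 1 then {..<\<delta>} \<union> {1 - \<delta><..} else {}))"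
  have "open ({x - \<delta><..<x + \<delta>} \<union> (if x = 0 \<or> x = 1 then {..<\<delta>} \<union> {1 - \<delta><..} else {}))"
    by (cases "x = 0 \<or> x = 1") (simp_all only: if_True if_False open_Un open_greaterThanLessThan open_lessThan open_greaterThan open_empty)
  then have "compact bad" unfolding bad_def by (intro compact_diff) auto
  moreover have "continuous_on bad g"
    using simple_path_imp_path[OF g(1)] by (auto simp: path_def bad_def intro: continuous_on_subset)
  ultimately have cl: "closed (g ` bad)" by (intro compact_imp_closed compact_continuous_image)
  have nin: "g x \<notin> g ` bad"
  proof
    assume "g x \<in> g ` bad"
    then obtain y where y: "y \<in> bad" "g y = g x" by auto
    then have "y \<in> {0..1}" by (simp add: bad_def)
    then have "y = x \<or> y = 0 \<and> x = 1 \<or> y = 1 \<and> x = 0"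
      using g(1) y(2) x unfolding simple_path_def loop_free_def by blast
    then show False using y(1) \<delta> by (auto simp: bad_def)
  qed
  obtain r where r: "r > 0" "\<forall>z\<in>g ` bad. r \<le> dist (g x) z"
    using separate_point_closed[OF cl nin] by blast
  show ?thesis
  proof (rule that[OF r(1)])
    fix y :: real assume y: "y \<in> {0..1}" "dist (g y) (g x) < r"
    then have "y \<notin> bad" using r(2) by (force simp: dist_commute)
    then show "\<bar>y - x\<bar> < \<delta> \<or> (x = 0 \<or> x = 1) \<and> (y < \<delta> \<or> y > 1 - \<delta>)"
      using y(1) by (auto simp: bad_def abs_if split: if_splits)
  qed
qed

section \<open>The jump of the winding number across an arc\<close>

lemma Ln_rotate:
  assumes "Re Q > 0"
  shows "Ln (\<i> * Q) - Ln (- \<i> * Q) = \<i> * of_real pi"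
proof -
  have Q: "Q \<noteq> 0" using assms by auto
  have I: "\<bar>Im (Ln Q)\<bar> < pi / 2" using Re_Ln_pos_lt[OF Q] assms by simp
  have "exp (\<i> * complex_of_real (pi / 2)) = \<i>" by (metis cis_conv_exp cis_pi_half)
  then have e: "exp (\<i> * complex_of_real pi / 2) = \<i>" by simp
  have "exp (Ln Q + \<i> * of_real pi / 2) = \<i> * Q" using Q by (simp add: exp_add e)
  then have 1: "Ln (\<i> * Q) = Ln Q + \<i> * of_real pi / 2"
    by (rule Ln_unique) (use I in \<open>simp_all add: abs_less_iff\<close>)
  have "exp (Ln Q - \<i> * of_real pi / 2) = Q / \<i>" using Q by (simp add: exp_diff e)
  also have "\<dots> = - \<i> * Q" by (simp add: field_simps)
  finally have "exp (Ln Q - \<i> * of_real pi / 2) = - \<i> * Q" .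
  then have 2: "Ln (- \<i> * Q) = Ln Q - \<i> * of_real pi / 2"
    by (rule Ln_unique) (use I in \<open>simp_all add: abs_less_iff\<close>)
  show ?thesis unfolding 1 2 by (simp add: field_simps)
qed

lemma slit_plane_perturbation:
  assumes "Re a > 0" "cmod e \<le> 1 / 2"
  shows "a * (1 + e) \<notin> \<real>\<^sub>\<le>\<^sub>0"
proof
  assume "a * (1 + e) \<in> \<real>\<^sub>\<le>\<^sub>0"
  then obtain r where r: "r \<le> 0" "a * (1 + e) = of_real r" by (auto elim!: nonpos_Reals_cases)
  have a: "a \<noteq> 0" using assms by auto
  have "\<bar>Re e\<bar> \<le> 1 / 2" using abs_Re_le_cmod[of e] assms(2) by linarith
  then have p: "Re (1 + e) > 0" by (auto simp: abs_le_iff)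
  have "1 + e = of_real r / a" using r(2) a by (simp add: field_simps)
  then have "Re (1 + e) = r * Re a / (cmod a)\<^sup>2" by (simp add: Re_divide cmod_power2)
  also have "\<dots> \<le> 0" using r assms by (simp add: divide_nonpos_nonneg mult_nonpos_nonneg)
  finally show False using p by simp
qed

lemma winding_number_Ln:
  assumes q: "valid_path q" and c: "c \<noteq> 0" and slit: "\<And>w. w \<in> path_image q \<Longrightarrow> c * (w - z) \<notin> \<real>\<^sub>\<le>\<^sub>0"
  shows "winding_number q z = (Ln (c * (pathfinish q - z)) - Ln (c * (pathstart q - z))) / (2 * of_real pi * \<i>)"
proof -
  have "((\<lambda>w. Ln (c * (w - z))) has_field_derivative 1 / (w - z)) (at w within path_image q)" if w: "w \<in> path_image q" for w
  proof -
    have "c * (w - z) \<noteq> 0" using slit[OF w] by auto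
    then show ?thesis using slit[OF w] c by (auto intro!: derivative_eq_intros simp: field_simps)
  qed
  then have "((\<lambda>w. 1 / (w - z)) has_contour_integral (Ln (c * (pathfinish q - z)) - Ln (c * (pathstart q - z)))) q"
    by (rule contour_integral_primitive[OF _ q]) auto
  moreover have "z \<notin> path_image q" using slit[of z] by auto
  ultimately show ?thesis
    using winding_number_valid_path[OF q, of z] contour_integral_unique by force
qed

text \<open>The loop is cut into a short piece \<open>q\<close> through \<open>g x\<close> and two
  remainders. The remainders miss \<open>p\<close>, so their contributions to the difference vanish
  in the limit. The nearly straight piece \<open>q\<close> is evaluated by logarithms, whose
  branches for the two sides differ by \<open>pi\<close> at each end of \<open>q\<close>, together
  one full turn. Conformality makes the upper side of the parameter line the left side of the curve,
  which fixes the sign.\<close>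

lemma winding_number_jump:
  assumes g: "valid_path g" "pathfinish g = pathstart g"
    and ab: "0 \<le> a" "a < x" "x < b" "b \<le> 1"
    and inj: "\<And>y. y \<in> {0..1} \<Longrightarrow> g y = g x \<Longrightarrow> y = x"
    and f: "f holomorphic_on S" "open S" "of_real x \<in> S" "deriv f (of_real x) \<noteq> 0"
    and fg: "\<And>s. s \<in> {a..b} \<Longrightarrow> f (of_real s) = g s"
    and off: "r0 > 0" "\<And>\<zeta>. dist \<zeta> (of_real x) < r0 \<Longrightarrow> Im \<zeta> \<noteq> 0 \<Longrightarrow> f \<zeta> \<notin> path_image g"
  shows "\<forall>\<^sub>F \<eta> in at_right 0. winding_number g (f (of_real x + \<i> * of_real \<eta>)) - winding_number g (f (of_real x - \<i> * of_real \<eta>)) = 1"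
proof -
  define D where "D = deriv f (of_real x)"
  define p where "p = f (of_real x)"
  have D: "D \<noteq> 0" using f by (simp add: D_def)
  have pg: "p = g x" using fg ab by (simp add: p_def)
  have df: "deriv f holomorphic_on S" by (rule holomorphic_deriv[OF f(1,2)])
  have "isCont (deriv f) (of_real x)"
    using holomorphic_on_imp_continuous_on[OF df] f by (simp add: continuous_on_eq_continuous_at)
  then obtain d1 where d1: "d1 > 0" "\<And>\<zeta>. dist \<zeta> (of_real x) < d1 \<Longrightarrow> dist (deriv f \<zeta>) (deriv f (of_real x)) < cmod D / 2"
    using D unfolding continuous_at_eps_delta by (metis half_gt_zero zero_less_norm_iff)
  obtain d2 where d2: "d2 > 0" "ball (of_real x) d2 \<subseteq> S" using f(2,3) open_contains_ball by blast
  define d where "d = min (min d1 d2) (min (x - a) (b - x)) / 2"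
  have d: "d > 0" "2 * d \<le> d1" "2 * d \<le> d2" "d < x - a" "d < b - x" using d1 d2 ab by (auto simp: d_def)
  define U where "U = ball (complex_of_real x) (2 * d)"
  have lin: "cmod ((f \<zeta> - D * \<zeta>) - (f \<xi> - D * \<xi>)) \<le> cmod D / 2 * cmod (\<zeta> - \<xi>)" if "\<zeta> \<in> U" "\<xi> \<in> U" for \<zeta> \<xi>
  proof (rule field_differentiable_bound[of U "\<lambda>z. f z - D * z" "\<lambda>z. deriv f z - D" "cmod D / 2" \<zeta> \<xi>])
    show "convex U" by (simp add: U_def)
    fix z assume z: "z \<in> U"
    then have "z \<in> S" using d d2 by (auto simp: U_def)
    then have "(f has_field_derivative deriv f z) (at z)" by (rule holomorphic_derivI[OF f(1,2)])
    then have "((\<lambda>z. f z - D * z) has_field_derivative deriv f z - D) (at z)"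
      by (auto intro!: derivative_eq_intros)
    then show "((\<lambda>z. f z - D * z) has_field_derivative deriv f z - D) (at z within U)" by (rule has_field_derivative_at_within)
    show "cmod (deriv f z - D) \<le> cmod D / 2"
      using d1(2)[of z] z d by (auto simp: U_def dist_norm D_def norm_minus_commute)
  qed (use that in auto)
  have quot: "\<exists>e. cmod e \<le> 1 / 2 \<and> (f \<zeta> - f \<xi>) / D = (\<zeta> - \<xi>) * (1 + e)" if "\<zeta> \<in> U" "\<xi> \<in> U" for \<zeta> \<xi>
  proof (cases "\<zeta> = \<xi>")
    case True then show ?thesis by (intro exI[of _ 0]) auto
  next
    case False
    define e where "e = (f \<zeta> - f \<xi>) / (D * (\<zeta> - \<xi>)) - 1"
    have n: "cmod D * cmod (\<zeta> - \<xi>) > 0" using D False by simp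
    have "e = ((f \<zeta> - D * \<zeta>) - (f \<xi> - D * \<xi>)) / (D * (\<zeta> - \<xi>))"
      using D False by (simp add: e_def field_simps)
    then have "cmod e = cmod ((f \<zeta> - D * \<zeta>) - (f \<xi> - D * \<xi>)) / (cmod D * cmod (\<zeta> - \<xi>))"
      by (simp add: norm_divide norm_mult)
    also have "\<dots> \<le> 1 / 2" using lin[OF that] n by (simp add: pos_divide_le_eq)
    finally show ?thesis using D False by (intro exI[of _ e]) (simp add: e_def)
  qed
  define q where "q = subpath (x - d) (x + d) g"
  have xd: "x - d \<in> {0..1}" "x + d \<in> {0..1}" using d ab by auto
  have q: "valid_path q" unfolding q_def by (rule valid_path_subpath[OF g(1) xd])
  have qi: "path_image q = g ` {x - d..x + d}" unfolding q_def using d by (subst path_image_subpath) auto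
  have qse: "pathstart q = f (of_real (x - d))" "pathfinish q = f (of_real (x + d))"
    using fg[of "x - d"] fg[of "x + d"] d ab by (auto simp: q_def)
  have wq: "\<exists>s\<in>{x - d..x + d}. w = f (of_real s)" if "w \<in> path_image q" for w
  proof -
    obtain s where s: "s \<in> {x - d..x + d}" "w = g s" using \<open>w \<in> path_image q\<close> unfolding qi by blast
    then have "s \<in> {a..b}" using d by auto
    then show ?thesis using s fg[of s] by (intro bexI[of _ s]) auto
  qed
  have sU: "of_real s \<in> U" if "s \<in> {x - d..x + d}" for s
    using that d by (auto simp: U_def dist_norm norm_minus_commute simp flip: of_real_diff)
  \<comment> \<open>The rotation is chosen so that \<open>of_real \<sigma> * \<i>\<close> times the
    parameter difference has real part \<open>\<eta>\<close>: the branch cut starting at the point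
    on side \<open>\<sigma>\<close> then points away from \<open>q\<close>. Nonlinearity of
    \<open>f\<close> only contributes a factor \<open>1 + e\<close>, which
    \<open>slit_plane_perturbation\<close> absorbs.\<close>
  have wn: "winding_number q (f (of_real x + of_real \<sigma> * \<i> * of_real \<eta>))
      = (Ln (of_real \<sigma> * \<i> / D * (f (of_real (x + d)) - f (of_real x + of_real \<sigma> * \<i> * of_real \<eta>)))
       - Ln (of_real \<sigma> * \<i> / D * (f (of_real (x - d)) - f (of_real x + of_real \<sigma> * \<i> * of_real \<eta>)))) / (2 * of_real pi * \<i>)"
    if \<sigma>: "\<sigma> = 1 \<or> \<sigma> = - 1" and \<eta>: "0 < \<eta>" "\<eta> < d" for \<sigma> \<eta> :: real
    unfolding qse[symmetric]
  proof (rule winding_number_Ln[OF q])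
    show "of_real \<sigma> * \<i> / D \<noteq> 0" using \<sigma> D by auto
    fix w assume "w \<in> path_image q"
    then obtain s where s: "s \<in> {x - d..x + d}" "w = f (of_real s)" using wq by blast
    let ?\<xi> = "complex_of_real x + of_real \<sigma> * \<i> * of_real \<eta>"
    have "?\<xi> \<in> U" using \<sigma> \<eta> d by (auto simp: U_def dist_norm norm_mult)
    then obtain e where e: "cmod e \<le> 1 / 2" "(f (of_real s) - f ?\<xi>) / D = (of_real s - ?\<xi>) * (1 + e)"
      using quot[OF sU[OF s(1)]] by blast
    have "of_real \<sigma> * \<i> / D * (w - f ?\<xi>) = of_real \<sigma> * \<i> * ((f (of_real s) - f ?\<xi>) / D)" by (simp add: s(2))
    also have "\<dots> = (of_real \<sigma> * \<i> * (of_real s - ?\<xi>)) * (1 + e)" unfolding e(2) by simp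
    finally have eq: "of_real \<sigma> * \<i> / D * (w - f ?\<xi>) = (of_real \<sigma> * \<i> * (of_real s - ?\<xi>)) * (1 + e)" .
    have "Re (of_real \<sigma> * \<i> * (of_real s - ?\<xi>)) > 0" using \<sigma> \<eta> by auto
    then show "of_real \<sigma> * \<i> / D * (w - f ?\<xi>) \<notin> \<real>\<^sub>\<le>\<^sub>0"
      unfolding eq using e(1) by (rule slit_plane_perturbation)
  qed
  define zp where "zp \<eta> = f (of_real x + \<i> * of_real \<eta>)" for \<eta> :: real
  define zm where "zm \<eta> = f (of_real x - \<i> * of_real \<eta>)" for \<eta> :: real
  have fc: "isCont f (of_real x)"
    using holomorphic_on_imp_continuous_on[OF f(1)] f by (simp add: continuous_on_eq_continuous_at)
  have "((\<lambda>\<eta>. complex_of_real x + \<i> * of_real \<eta>) \<longlongrightarrow> of_real x + \<i> * of_real 0) (at_right (0::real))"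
    by (intro tendsto_intros)
  then have zp: "(zp \<longlongrightarrow> p) (at_right 0)" unfolding zp_def p_def
    by (intro isCont_tendsto_compose[OF fc]) simp
  have "((\<lambda>\<eta>. complex_of_real x - \<i> * of_real \<eta>) \<longlongrightarrow> of_real x - \<i> * of_real 0) (at_right (0::real))"
    by (intro tendsto_intros)
  then have zm: "(zm \<longlongrightarrow> p) (at_right 0)" unfolding zm_def p_def
    by (intro isCont_tendsto_compose[OF fc]) simp
  define Q1 where "Q1 = (f (of_real (x + d)) - p) / D"
  define Q0 where "Q0 = (f (of_real (x - d)) - p) / D"
  have xU: "of_real x \<in> U" using d by (simp add: U_def)
  have half: "Re (1 + e) > 0" if "cmod e \<le> 1 / 2" for e
    using abs_Re_le_cmod[of e] that by (auto simp: abs_le_iff)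
  have Q1: "Re Q1 > 0"
  proof -
    obtain e where e: "cmod e \<le> 1 / 2" "Q1 = (of_real (x + d) - of_real x) * (1 + e)"
      using quot[OF sU xU, of "x + d"] d by (auto simp: Q1_def p_def)
    then show ?thesis using half[OF e(1)] d by simp
  qed
  have Q0: "Re (- Q0) > 0"
  proof -
    obtain e where e: "cmod e \<le> 1 / 2" "Q0 = (of_real (x - d) - of_real x) * (1 + e)"
      using quot[OF sU xU, of "x - d"] d by (auto simp: Q0_def p_def)
    then show ?thesis using half[OF e(1)] d by simp
  qed
  have ns: "\<i> * Q1 \<notin> \<real>\<^sub>\<le>\<^sub>0" "- \<i> * Q1 \<notin> \<real>\<^sub>\<le>\<^sub>0" "\<i> * Q0 \<notin> \<real>\<^sub>\<le>\<^sub>0" "- \<i> * Q0 \<notin> \<real>\<^sub>\<le>\<^sub>0"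
    using Q1 Q0 by (auto simp: complex_nonpos_Reals_iff)
  define A where "A \<eta> = (Ln (\<i> / D * (f (of_real (x + d)) - zp \<eta>)) - Ln (\<i> / D * (f (of_real (x - d)) - zp \<eta>)))
     - (Ln (- \<i> / D * (f (of_real (x + d)) - zm \<eta>)) - Ln (- \<i> / D * (f (of_real (x - d)) - zm \<eta>)))" for \<eta>
  have "(A \<longlongrightarrow> (Ln (\<i> / D * (f (of_real (x + d)) - p)) - Ln (\<i> / D * (f (of_real (x - d)) - p)))
     - (Ln (- \<i> / D * (f (of_real (x + d)) - p)) - Ln (- \<i> / D * (f (of_real (x - d)) - p)))) (at_right 0)"
    unfolding A_def using ns by (intro tendsto_diff tendsto_Ln tendsto_mult tendsto_const zp zm) (auto simp: Q1_def Q0_def)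
  moreover have "(Ln (\<i> / D * (f (of_real (x + d)) - p)) - Ln (\<i> / D * (f (of_real (x - d)) - p)))
     - (Ln (- \<i> / D * (f (of_real (x + d)) - p)) - Ln (- \<i> / D * (f (of_real (x - d)) - p))) = 2 * of_real pi * \<i>"
  proof -
    have "Ln (\<i> * Q1) - Ln (- \<i> * Q1) = \<i> * of_real pi" by (rule Ln_rotate[OF Q1])
    moreover have "Ln (\<i> * (- Q0)) - Ln (- \<i> * (- Q0)) = \<i> * of_real pi" by (rule Ln_rotate[OF Q0])
    ultimately have "(Ln (\<i> * Q1) - Ln (\<i> * Q0)) - (Ln (- \<i> * Q1) - Ln (- \<i> * Q0)) = 2 * of_real pi * \<i>"
      by (simp add: algebra_simps) 
    then show ?thesis by (simp add: Q1_def Q0_def)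
  qed
  ultimately have Alim: "(A \<longlongrightarrow> 2 * of_real pi * \<i>) (at_right 0)" by simp
  define ql where "ql = subpath 0 (x - d) g"
  define qr where "qr = subpath (x + d) 1 g"
  have pathg: "path g" by (rule valid_path_imp_path[OF g(1)])
  have pl: "p \<notin> path_image ql" "p \<notin> path_image qr"
  proof -
    have pi: "path_image ql = g ` {0..x - d}" "path_image qr = g ` {x + d..1}"
      unfolding ql_def qr_def using xd by (auto simp: path_image_subpath)
    have ne: "g x \<noteq> g y" if "y \<in> {0..x - d} \<union> {x + d..1}" for y
      using inj[of y] that xd d by fastforce
    show "p \<notin> path_image ql" "p \<notin> path_image qr" unfolding pi pg using ne by blast+
  qed
  have pathlr: "path ql" "path qr" unfolding ql_def qr_def using xd pathg by (auto intro!: path_subpath)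
  define W where "W \<eta> = (winding_number ql (zp \<eta>) - winding_number ql (zm \<eta>)) + (winding_number qr (zp \<eta>) - winding_number qr (zm \<eta>))
     + A \<eta> / (2 * of_real pi * \<i>)" for \<eta>
  have cont: "isCont (winding_number ql) p" "isCont (winding_number qr) p"
    using continuous_at_winding_number pathlr pl by auto
  have "(W \<longlongrightarrow> (winding_number ql p - winding_number ql p) + (winding_number qr p - winding_number qr p) + 2 * of_real pi * \<i> / (2 * of_real pi * \<i>)) (at_right 0)"
    unfolding W_def
    by (intro tendsto_add tendsto_diff isCont_tendsto_compose[OF cont(1)] isCont_tendsto_compose[OF cont(2)] zp zm tendsto_divide Alim tendsto_const) auto
  then have "(W \<longlongrightarrow> 1) (at_right 0)" by simp
  then have "\<forall>\<^sub>F \<eta> in at_right 0. dist (W \<eta>) 1 < 1" by (rule tendstoD) simp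
  moreover have "\<forall>\<^sub>F \<eta> in at_right 0. \<eta> < min r0 d" using off(1) d(1) by (intro order_tendstoD[OF tendsto_ident_at]) auto
  ultimately show ?thesis using eventually_at_right_less[of "0::real"]
  proof eventually_elim
    case (elim \<eta>)
    have \<eta>: "0 < \<eta>" "\<eta> < r0" "\<eta> < d" using elim by auto
    have z: "zp \<eta> \<notin> path_image g" "zm \<eta> \<notin> path_image g"
      unfolding zp_def zm_def by (rule off(2); use \<eta> in \<open>simp add: dist_norm norm_mult\<close>)+
    have split: "winding_number g z = winding_number ql z + winding_number q z + winding_number qr z" if "z \<notin> path_image g" for z
    proof -
      have "winding_number ql z + winding_number q z = winding_number (subpath 0 (x + d) g) z"
        unfolding ql_def q_def using xd by (intro winding_number_subpath_combine pathg that) auto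
      moreover have "winding_number (subpath 0 (x + d) g) z + winding_number qr z = winding_number (subpath 0 1 g) z"
        unfolding qr_def using xd by (intro winding_number_subpath_combine pathg that) auto
      ultimately show ?thesis by simp
    qed
    have "winding_number q (zp \<eta>) - winding_number q (zm \<eta>) = A \<eta> / (2 * of_real pi * \<i>)"
      using wn[of 1 \<eta>] wn[of "- 1" \<eta>] \<eta> by (simp add: zp_def zm_def A_def diff_divide_distrib)
    then have W: "winding_number g (zp \<eta>) - winding_number g (zm \<eta>) = W \<eta>"
      unfolding split[OF z(1)] split[OF z(2)] W_def by (simp add: algebra_simps)
    \<comment> \<open>Winding numbers of a closed curve are integers, so a difference closer than
      \<open>1\<close> to \<open>1\<close> is equal to it.\<close>
    obtain i j :: int where "winding_number g (zp \<eta>) = of_int i" "winding_number g (zm \<eta>) = of_int j"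
      using integer_winding_number[OF pathg g(2) z(1)] integer_winding_number[OF pathg g(2) z(2)] by (auto elim!: Ints_cases)
    then have Wij: "W \<eta> = of_int (i - j)" using W by simp
    then have "cmod (of_int (i - j - 1)) < 1" using elim(1) by (simp add: dist_norm)
    then have "\<bar>real_of_int (i - j - 1)\<bar> < 1" by (simp only: norm_of_int)
    then have "i - j = 1" by linarith
    then show ?case using W Wij unfolding zp_def zm_def by simp
  qed
qed

text \<open>Beyond \<open>\<delta>\<close> the modulus has a minimum \<open>m > 1\<close> on a
  compact interval. Replacing \<open>\<omega>\<close> by the smaller \<open>\<omega>0\<close> only
  weakens the bound, because \<open>s \<le> 1\<close> gives
  \<open>s powr (1 / \<omega>0) \<le> s powr (1 / \<omega>)\<close>.\<close>

lemma powr_decay_extend: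
  fixes \<Phi> :: "complex \<Rightarrow> complex" and k :: "real \<Rightarrow> complex"
  assumes loc: "c' > 0" "\<delta> > 0" "\<And>s. 0 < s \<Longrightarrow> s < \<delta> \<Longrightarrow> exp (c' * s powr (1 / \<omega>)) \<le> cmod (\<Phi> (k s))"
    and \<omega>: "0 < \<omega>0" "\<omega>0 \<le> \<omega>" and h: "0 < h" "h \<le> 1"
    and \<Phi>: "continuous_on \<Omega> \<Phi>" "\<And>z. z \<in> \<Omega> \<Longrightarrow> cmod (\<Phi> z) > 1"
    and k: "continuous_on {0<..h} k" "\<And>s. s \<in> {0<..h} \<Longrightarrow> k s \<in> \<Omega>"
  obtains c where "c > 0" "\<And>s. 0 < s \<Longrightarrow> s \<le> h \<Longrightarrow> exp (c * s powr (1 / \<omega>0)) \<le> cmod (\<Phi> (k s))"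
proof -
  define d where "d = min \<delta> h / 2"
  have d: "0 < d" "d < \<delta>" "d \<le> h" using loc h by (auto simp: d_def)
  have "continuous_on {d..h} (\<lambda>s. cmod (\<Phi> (k s)))"
    by (intro continuous_on_norm continuous_on_compose2[OF \<Phi>(1)] continuous_on_subset[OF k(1)]) (use d k(2) in auto)
  then obtain x where x: "x \<in> {d..h}" "\<forall>y\<in>{d..h}. cmod (\<Phi> (k x)) \<le> cmod (\<Phi> (k y))"
    using continuous_attains_inf[OF compact_Icc] d(3) by (metis atLeastatMost_empty_iff2)
  define m where "m = cmod (\<Phi> (k x))"
  have m: "m > 1" unfolding m_def using x d by (intro \<Phi>(2) k(2)) auto
  define c where "c = min c' (ln m)"
  have c: "c > 0" using loc(1) m by (simp add: c_def)
  show ?thesis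
  proof (rule that[OF c])
    fix s assume s: "0 < s" "s \<le> h"
    show "exp (c * s powr (1 / \<omega>0)) \<le> cmod (\<Phi> (k s))"
    proof (cases "s < \<delta>")
      case True
      have "1 / \<omega> \<le> 1 / \<omega>0" using \<omega> by (intro divide_left_mono) auto
      then have "s powr (1 / \<omega>0) \<le> s powr (1 / \<omega>)" using s h by (intro powr_mono') auto
      then have "c * s powr (1 / \<omega>0) \<le> c' * s powr (1 / \<omega>)"
        using c by (intro mult_mono) (auto simp: c_def)
      then have "exp (c * s powr (1 / \<omega>0)) \<le> exp (c' * s powr (1 / \<omega>))" by simp
      then show ?thesis using loc(3)[OF s(1) True] by linarith
    next
      case False
      then have "m \<le> cmod (\<Phi> (k s))" using x(2) s d by (simp add: m_def)
      moreover have "s powr (1 / \<omega>0) \<le> 1" using s h \<omega> by (intro powr_le1) auto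
      then have "c * s powr (1 / \<omega>0) \<le> ln m * 1" using c m by (intro mult_mono) (auto simp: c_def)
      then have "exp (c * s powr (1 / \<omega>0)) \<le> exp (ln m)" by simp
      then have "exp (c * s powr (1 / \<omega>0)) \<le> m" using m by simp
      ultimately show ?thesis by linarith
    qed
  qed
qed

section \<open>The boundary curve\<close>

text \<open>Connectedness of the exterior is made an assumption here because it is inherited from
  the exterior map, as the continuous image of the complement of the closed disc.\<close>

locale analytic_boundary =
  fixes G :: "complex set" and g :: "real \<Rightarrow> complex" and N :: nat and t :: "nat \<Rightarrow> real"
  assumes jordan: "jordan_domain G" and pa: "piecewise_analytic_without_cusps G g N t"
    and connected_exterior: "connected (- closure G)"
begin

lemma simple: "simple_path g" and loop: "pathfinish g = pathstart g" and path_image: "path_image g = frontier G"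
  and winding_inside: "z \<in> G \<Longrightarrow> winding_number g z = 1" and N: "N \<ge> 1" and t0: "t 0 = 0" and tN: "t N = 1"
  and t_Suc: "j < N \<Longrightarrow> t j < t (Suc j)" and analytic_arc: "j < N \<Longrightarrow> analytic_arc g (t j) (t (Suc j))"
  and angle: "j \<in> {1..N} \<Longrightarrow> 0 < exterior_angle g N t j \<and> exterior_angle g N t j < 2"
  using pa by (auto simp: piecewise_analytic_without_cusps_def)

lemma open_G: "open G" and bounded_G: "bounded G"
  using jordan by (auto simp: jordan_domain_def)

lemma path_g: "path g" using simple by (rule simple_path_imp_path)

lemma g_in_frontier: "s \<in> {0..1} \<Longrightarrow> g s \<in> frontier G"
  using path_image by (auto simp: path_image_def)

lemma frontier_point:
  assumes "z \<in> frontier G" obtains s where "s \<in> {0..1}" "z = g s"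
  using assms unfolding path_image[symmetric] path_image_def by blast

lemma t_less: "i < j \<Longrightarrow> j \<le> N \<Longrightarrow> t i < t j"
proof (induction j)
  case (Suc j)
  then show ?case using t_Suc[of j] by (cases "i = j") auto
qed simp

lemma t_range: "j \<le> N \<Longrightarrow> t j \<in> {0..1}"
  using t_less[of 0 j] t_less[of j N] t0 tN by (cases "j = 0"; cases "j = N") auto

lemma arc_range: "j < N \<Longrightarrow> {t j..t (Suc j)} \<subseteq> {0..1}"
  using t_range[of j] t_range[of "Suc j"] by auto

lemma off_frontier: "z \<notin> frontier G \<Longrightarrow> z \<in> G \<or> z \<notin> closure G"
  using closure_Un_frontier[of G] by auto

lemma frontier_disjoint: "z \<in> frontier G \<Longrightarrow> z \<notin> G \<and> z \<in> closure G"
  using open_G by (simp add: frontier_def interior_open)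

lemma winding_outside:
  assumes "z \<notin> closure G" shows "winding_number g z = 0"
proof -
  obtain B where B: "\<And>z. B \<le> cmod z \<Longrightarrow> winding_number g z = 0"
    using winding_number_zero_at_infinity[OF path_g loop] by auto
  obtain M where M: "\<And>z. z \<in> closure G \<Longrightarrow> cmod z \<le> M"
    using bounded_closure[OF bounded_G] by (auto simp: bounded_iff)
  define w where "w = complex_of_real (max 0 (max B (M + 1)))"
  have "cmod w = max 0 (max B (M + 1))" by (simp add: w_def)
  then have w: "w \<notin> closure G" "winding_number g w = 0" using M[of w] B[of w] by auto
  have "- closure G \<inter> path_image g = {}" using frontier_disjoint path_image by auto
  then have "winding_number g constant_on (- closure G)"
    using winding_number_constant[OF path_g loop connected_exterior] by blast
  then show ?thesis using w assms unfolding constant_on_def by (metis ComplI)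
qed

text \<open>Transports membership in the exterior from a single point to a whole connected set
  missing the boundary; it is applied to images of half rhombi and of corner sectors.\<close>

lemma connected_side:
  assumes S: "connected S" and off: "\<And>z. z \<in> S \<Longrightarrow> z \<notin> frontier G" and z: "z \<in> S" "z \<notin> closure G"
  shows "w \<in> S \<Longrightarrow> w \<notin> closure G"
proof -
  assume w: "w \<in> S"
  have "S \<inter> - G \<noteq> {}" using z closure_subset by blast
  then have "S \<inter> G = {}" using connected_Int_frontier[OF S, of G] off by blast
  then have "w \<notin> G" using w by auto
  then show ?thesis using off_frontier off w by blast
qed

section \<open>Analytic continuations of the boundary arcs\<close>

definition arc_ext :: "nat \<Rightarrow> complex \<Rightarrow> complex" where
  "arc_ext j = (SOME f. f analytic_on (complex_of_real ` {t j..t (Suc j)}) \<and>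
     (\<forall>s\<in>{t j..t (Suc j)}. f (complex_of_real s) = g s \<and> deriv f (complex_of_real s) \<noteq> 0))"

lemma arc_ext_properties:
  assumes "j < N"
  shows "arc_ext j analytic_on (complex_of_real ` {t j..t (Suc j)}) \<and>
     (\<forall>s\<in>{t j..t (Suc j)}. arc_ext j (complex_of_real s) = g s \<and> deriv (arc_ext j) (complex_of_real s) \<noteq> 0)"
  unfolding arc_ext_def using analytic_arc[OF assms] unfolding analytic_arc_def by (rule someI_ex)

lemma arc_eq: "j < N \<Longrightarrow> s \<in> {t j..t (Suc j)} \<Longrightarrow> arc_ext j (of_real s) = g s"
  and arc_deriv: "j < N \<Longrightarrow> s \<in> {t j..t (Suc j)} \<Longrightarrow> deriv (arc_ext j) (of_real s) \<noteq> 0"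
  using arc_ext_properties by blast+

definition arc_dom :: "nat \<Rightarrow> complex set" where
  "arc_dom j = (SOME S. open S \<and> complex_of_real ` {t j..t (Suc j)} \<subseteq> S \<and> arc_ext j holomorphic_on S)"

lemma arc_dom_properties:
  assumes "j < N"
  shows "open (arc_dom j) \<and> complex_of_real ` {t j..t (Suc j)} \<subseteq> arc_dom j \<and> arc_ext j holomorphic_on arc_dom j"
proof -
  have "\<exists>S. open S \<and> complex_of_real ` {t j..t (Suc j)} \<subseteq> S \<and> arc_ext j holomorphic_on S"
    using arc_ext_properties[OF assms] analytic_on_holomorphic by blast
  then show ?thesis unfolding arc_dom_def by (rule someI_ex)
qed

lemma open_dom: "j < N \<Longrightarrow> open (arc_dom j)" and arc_holo: "j < N \<Longrightarrow> arc_ext j holomorphic_on arc_dom j"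
  and in_dom: "j < N \<Longrightarrow> s \<in> {t j..t (Suc j)} \<Longrightarrow> of_real s \<in> arc_dom j"
  using arc_dom_properties by blast+

lemma arc_has_deriv: "j < N \<Longrightarrow> z \<in> arc_dom j \<Longrightarrow> (arc_ext j has_field_derivative deriv (arc_ext j) z) (at z)"
  by (rule holomorphic_derivI[OF arc_holo open_dom])

lemma g_has_vector_derivative:
  assumes j: "j < N" and s: "t j < s" "s < t (Suc j)"
  shows "(g has_vector_derivative deriv (arc_ext j) (of_real s)) (at s)"
proof (rule has_vector_derivative_transform_within_open)
  show "((\<lambda>s. arc_ext j (of_real s)) has_vector_derivative deriv (arc_ext j) (of_real s)) (at s)"
    by (rule has_vector_derivative_real_field[OF arc_has_deriv[OF j in_dom[OF j]]]) (use s in auto)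
  show "open {t j<..<t (Suc j)}" "s \<in> {t j<..<t (Suc j)}" using s by auto
qed (use arc_eq[OF j] in auto)

lemma arcs_cover: 
  assumes "s \<in> {0..1} - t ` {..N}"
  obtains j where "j < N" "t j < s" "s < t (Suc j)"
proof -
  have "k \<le> N \<Longrightarrow> s < t k \<Longrightarrow> \<exists>j<N. t j < s \<and> s < t (Suc j)" for k
  proof (induction k)
    case 0
    then show ?case using assms t0 by auto
  next
    case (Suc k)
    have "s \<noteq> t k" using assms Suc.prems(1) by auto
    then consider "s < t k" | "t k < s" by linarith
    then show ?case
    proof cases
      case 1 then show ?thesis using Suc by simp
    next
      case 2 then show ?thesis using Suc.prems by (intro exI[of _ k]) auto
    qed
  qed
  moreover have "s < t N" using assms tN by (auto simp: less_le)
  ultimately show ?thesis using that by blast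
qed

lemma valid_path_g: "valid_path g"
  unfolding valid_path_def piecewise_C1_differentiable_on_def
proof (intro conjI exI)
  show "continuous_on {0..1} g" using path_g by (simp add: path_def)
  show "finite (t ` {..N})" by simp
  show "g C1_differentiable_on {0..1} - t ` {..N}"
    unfolding C1_differentiable_on_def
  proof (intro exI conjI ballI)
    fix s assume s: "s \<in> {0..1} - t ` {..N}"
    obtain j where "j < N" "t j < s" "s < t (Suc j)" by (rule arcs_cover[OF s])
    then show "(g has_vector_derivative vector_derivative g (at s)) (at s)"
      using g_has_vector_derivative vector_derivative_works differentiableI_vector by blast
  next
    show "continuous_on ({0..1} - t ` {..N}) (\<lambda>s. vector_derivative g (at s))"
      unfolding continuous_on_eq_continuous_within
    proof
      fix s assume s: "s \<in> {0..1} - t ` {..N}"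
      obtain j where j: "j < N" "t j < s" "s < t (Suc j)" by (rule arcs_cover[OF s])
      have "continuous_on (arc_dom j) (deriv (arc_ext j))"
        by (rule holomorphic_on_imp_continuous_on[OF holomorphic_deriv[OF arc_holo open_dom]]; fact)
      then have "isCont (deriv (arc_ext j)) (of_real s)"
        using open_dom[OF j(1)] in_dom[OF j(1), of s] j by (simp add: continuous_on_eq_continuous_at)
      then have "isCont (\<lambda>s. deriv (arc_ext j) (of_real s)) s"
        by (intro isCont_o2[where f = complex_of_real and g = "deriv (arc_ext j)"] continuous_intros)
      moreover have "\<forall>\<^sub>F x in nhds s. deriv (arc_ext j) (of_real x) = vector_derivative g (at x)"
        using eventually_nhds_in_open[of "{t j<..<t (Suc j)}" s]
          vector_derivative_at[OF g_has_vector_derivative[OF j(1)]] j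
        by (auto elim!: eventually_mono)
      ultimately have "isCont (\<lambda>x. vector_derivative g (at x)) s"
        using isCont_cong by fastforce
      then show "continuous (at s within {0..1} - t ` {..N}) (\<lambda>x. vector_derivative g (at x))"
        by (rule continuous_at_imp_continuous_at_within)
    qed
  qed
qed

text \<open>The fundamental theorem of calculus on each arc; derivatives are required only in the
  interior of the arcs because the curve turns at their ends.\<close>

lemma boundary_integral:
  assumes z: "z \<notin> frontier G"
    and L: "\<And>i x. i < N \<Longrightarrow> t i < x \<Longrightarrow> x < t (Suc i) \<Longrightarrow>
       (L i has_vector_derivative deriv (arc_ext i) (of_real x) / (arc_ext i (of_real x) - z)) (at x)"
    and Lc: "\<And>i. i < N \<Longrightarrow> continuous_on {t i..t (Suc i)} (L i)"
  shows "(\<Sum>i<N. L i (t (Suc i)) - L i (t i)) = 2 * of_real pi * \<i> * winding_number g z"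
proof -
  define h where "h s = 1 / (g s - z) * vector_derivative g (at s)" for s
  have "k \<le> N \<Longrightarrow> (h has_integral (\<Sum>i<k. L i (t (Suc i)) - L i (t i))) {t 0..t k}" for k
  proof (induction k)
    case (Suc k)
    have k: "k < N" using Suc.prems by simp
    have "(h has_integral (L k (t (Suc k)) - L k (t k))) {t k..t (Suc k)}"
    proof (rule fundamental_theorem_of_calculus_interior)
      show "t k \<le> t (Suc k)" using t_Suc[OF k] by simp
      show "continuous_on {t k..t (Suc k)} (L k)" by (rule Lc[OF k])
      fix x assume x: "x \<in> {t k<..<t (Suc k)}"
      then have "h x = deriv (arc_ext k) (of_real x) / (arc_ext k (of_real x) - z)"
        using vector_derivative_at[OF g_has_vector_derivative[OF k, of x]] arc_eq[OF k, of x] by (simp add: h_def)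
      then show "(L k has_vector_derivative h x) (at x)" using L[OF k, of x] x by simp
    qed
    moreover have "t 0 \<le> t k" using t_range[of k] k t0 by auto
    ultimately show ?case
      using Suc t_Suc[OF k] by (auto intro!: has_integral_combine[of "t 0" "t k"] less_imp_le)
  qed (auto intro: has_integral_refl)
  from this[of N] have "(h has_integral (\<Sum>i<N. L i (t (Suc i)) - L i (t i))) {0..1}" by (simp add: t0 tN)
  then have "((\<lambda>w. 1 / (w - z)) has_contour_integral (\<Sum>i<N. L i (t (Suc i)) - L i (t i))) g"
    unfolding has_contour_integral by (simp only: h_def[abs_def])
  moreover have "z \<notin> path_image g" using z path_image by simp
  ultimately show ?thesis
    using winding_number_valid_path[OF valid_path_g, of z] contour_integral_unique by force
qed

section \<open>Tangent data at the corners\<close>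

definition outgoing :: "nat \<Rightarrow> nat" where "outgoing j = (if j = N then 0 else j)"

definition germ_out :: "nat \<Rightarrow> complex \<Rightarrow> complex" where
  "germ_out j \<zeta> = arc_ext (outgoing j) (of_real (t (outgoing j)) + \<zeta>)"

text \<open>The sign reverses the incoming arc, so that both germs leave the corner along positive
  real arguments; the derivative at 0 is then the direction from which \<open>exterior_angle\<close>
  is measured.\<close>

definition germ_in :: "nat \<Rightarrow> complex \<Rightarrow> complex" where
  "germ_in j \<zeta> = arc_ext (j - 1) (of_real (t j) - \<zeta>)"

lemma outgoing_less: "j \<in> {1..N} \<Longrightarrow> outgoing j < N"
  using N by (auto simp: outgoing_def)

lemma g_outgoing: "g (t (outgoing j)) = g (t j)"
  using loop t0 tN by (simp add: outgoing_def pathfinish_def pathstart_def)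

lemma germ_out:
  assumes j: "j \<in> {1..N}"
  obtains r where "r > 0" "germ_out j holomorphic_on ball 0 r"
    "deriv (germ_out j) 0 = deriv (arc_ext (outgoing j)) (of_real (t (outgoing j)))" "germ_out j 0 = g (t j)"
proof -
  let ?o = "outgoing j"
  have o: "?o < N" by (rule outgoing_less[OF j])
  have s: "t ?o \<in> {t ?o..t (Suc ?o)}" using t_Suc[OF o] by auto
  obtain r where r: "r > 0" "ball (of_real (t ?o)) r \<subseteq> arc_dom ?o"
    using open_dom[OF o] in_dom[OF o s] open_contains_ball by blast
  show ?thesis
  proof (rule that[OF r(1)])
    have "arc_ext ?o \<circ> (\<lambda>\<zeta>. of_real (t ?o) + \<zeta>) holomorphic_on ball 0 r"
      by (rule holomorphic_on_compose_gen[OF _ arc_holo[OF o]])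
         (use r in \<open>auto intro!: holomorphic_intros simp: dist_norm subset_iff\<close>)
    then show "germ_out j holomorphic_on ball 0 r" by (simp add: germ_out_def[abs_def] o_def)
    have "(germ_out j has_field_derivative deriv (arc_ext ?o) (of_real (t ?o)) * 1) (at 0)"
      unfolding germ_out_def
      by (rule DERIV_chain2[where f = "arc_ext ?o" and g = "\<lambda>\<zeta>. of_real (t ?o) + \<zeta>"])
         (use arc_has_deriv[OF o in_dom[OF o s]] in \<open>auto intro!: derivative_eq_intros\<close>)
    then show "deriv (germ_out j) 0 = deriv (arc_ext ?o) (of_real (t ?o))" by (auto dest: DERIV_imp_deriv)
    show "germ_out j 0 = g (t j)" using arc_eq[OF o s] g_outgoing by (simp add: germ_out_def)
  qed
qed

lemma germ_in:
  assumes j: "j \<in> {1..N}"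
  obtains r where "r > 0" "germ_in j holomorphic_on ball 0 r"
    "deriv (germ_in j) 0 = - deriv (arc_ext (j - 1)) (of_real (t j))" "germ_in j 0 = g (t j)"
proof -
  have o: "j - 1 < N" and Sj: "Suc (j - 1) = j" using j by auto
  have s: "t j \<in> {t (j - 1)..t (Suc (j - 1))}" using t_Suc[OF o] Sj by auto
  obtain r where r: "r > 0" "ball (of_real (t j)) r \<subseteq> arc_dom (j - 1)"
    using open_dom[OF o] in_dom[OF o s] open_contains_ball by blast
  show ?thesis
  proof (rule that[OF r(1)])
    have "arc_ext (j - 1) \<circ> (\<lambda>\<zeta>. of_real (t j) - \<zeta>) holomorphic_on ball 0 r"
      by (rule holomorphic_on_compose_gen[OF _ arc_holo[OF o]])
         (use r in \<open>auto intro!: holomorphic_intros simp: dist_norm subset_iff\<close>)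
    then show "germ_in j holomorphic_on ball 0 r" by (simp add: germ_in_def[abs_def] o_def)
    have "(germ_in j has_field_derivative deriv (arc_ext (j - 1)) (of_real (t j)) * (- 1)) (at 0)"
      unfolding germ_in_def
      by (rule DERIV_chain2[where f = "arc_ext (j - 1)" and g = "\<lambda>\<zeta>. of_real (t j) - \<zeta>"])
         (use arc_has_deriv[OF o in_dom[OF o s]] in \<open>auto intro!: derivative_eq_intros\<close>)
    then show "deriv (germ_in j) 0 = - deriv (arc_ext (j - 1)) (of_real (t j))" by (auto dest: DERIV_imp_deriv)
    show "germ_in j 0 = g (t j)" using arc_eq[OF o s] by (simp add: germ_in_def)
  qed
qed

lemma corner_near_arcs:
  assumes j: "j \<in> {1..N}"
  shows "near_arcs (frontier G) (g (t j)) (germ_out j) (germ_in j)"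
  unfolding near_arcs_def
proof (intro allI impI)
  fix \<delta> :: real assume \<delta>: "\<delta> > 0"
  let ?o = "outgoing j" and ?i = "j - 1"
  have o: "?o < N" "?i < N" "Suc ?i = j" using outgoing_less[OF j] j by auto
  \<comment> \<open>At most the parameter lengths of both adjacent arcs, so that parameters within
    \<open>e\<close> of the corner belong to these two arcs.\<close>
  define e where "e = min \<delta> (min (t (Suc ?o) - t ?o) (t j - t ?i))"
  have e: "e > 0" "e \<le> \<delta>" using \<delta> t_Suc[OF o(1)] t_Suc[OF o(2)] o(3) by (auto simp: e_def)
  obtain r where r: "r > 0" "\<And>y. y \<in> {0..1} \<Longrightarrow> dist (g y) (g (t j)) < r \<Longrightarrow>
     \<bar>y - t j\<bar> < e \<or> (t j = 0 \<or> t j = 1) \<and> (y < e \<or> y > 1 - e)"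
    using simple_loop_near[OF simple loop t_range[of j] e(1)] j by auto
  show "\<exists>r>0. \<forall>z\<in>frontier G. dist z (g (t j)) < r \<longrightarrow>
     (\<exists>s. 0 \<le> s \<and> s < \<delta> \<and> (z = germ_out j (of_real s) \<or> z = germ_in j (of_real s)))"
  proof (rule exI[of _ r], intro conjI ballI impI r(1))
    fix z assume z: "z \<in> frontier G" "dist z (g (t j)) < r"
    obtain y where y: "y \<in> {0..1}" "z = g y" using z(1) by (rule frontier_point)
    have "(t ?o \<le> y \<and> y < t ?o + e) \<or> (t j - e < y \<and> y \<le> t j)"
    proof (cases "j = N")
      case True
      then have "t j = 1" "t ?o = 0" using tN t0 by (auto simp: outgoing_def)
      then show ?thesis using r(2)[OF y(1)] z y by (auto simp: abs_if split: if_splits)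
    next
      case False
      then have "0 < t j" "t j < 1" "t ?o = t j" using t_less[of 0 j] t_less[of j N] t0 tN j by (auto simp: outgoing_def)
      then show ?thesis using r(2)[OF y(1)] z y by (auto simp: abs_if split: if_splits)
    qed
    then show "\<exists>s. 0 \<le> s \<and> s < \<delta> \<and> (z = germ_out j (of_real s) \<or> z = germ_in j (of_real s))"
    proof
      assume a: "t ?o \<le> y \<and> y < t ?o + e"
      then have "y \<in> {t ?o..t (Suc ?o)}" by (auto simp: e_def)
      then have "z = germ_out j (of_real (y - t ?o))" using arc_eq[OF o(1)] y by (simp add: germ_out_def)
      then show ?thesis using a e by (intro exI[of _ "y - t ?o"]) auto
    next
      assume a: "t j - e < y \<and> y \<le> t j"
      then have "y \<in> {t ?i..t (Suc ?i)}" using o(3) by (auto simp: e_def)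
      then have "z = germ_in j (of_real (t j - y))" using arc_eq[OF o(2)] y by (simp add: germ_in_def)
      then show ?thesis using a e by (intro exI[of _ "t j - y"]) auto
    qed
  qed
qed

lemma corner_angle:
  assumes j: "j \<in> {1..N}"
  shows "exterior_angle g N t j = Arg2pi (deriv (arc_ext (outgoing j)) (of_real (t (outgoing j))) / (- deriv (arc_ext (j - 1)) (of_real (t j)))) / pi"
proof -
  let ?o = "outgoing j" and ?i = "j - 1"
  have o: "?o < N" "?i < N" "Suc ?i = j" using outgoing_less[OF j] j by auto
  have "vector_derivative g (at_left (t j)) = deriv (arc_ext ?i) (of_real (t j))"
    using arc_vector_derivative_at_left[of "t ?i" "t j" "arc_ext ?i" g "deriv (arc_ext ?i) (of_real (t j))"]
      t_Suc[OF o(2)] arc_eq[OF o(2)] arc_has_deriv[OF o(2) in_dom[OF o(2)], of "t j"] o(3) by auto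
  moreover have "vector_derivative g (at_right (t ?o)) = deriv (arc_ext ?o) (of_real (t ?o))"
    using arc_vector_derivative_at_right[of "t ?o" "t (Suc ?o)" "arc_ext ?o" g "deriv (arc_ext ?o) (of_real (t ?o))"]
      t_Suc[OF o(1)] arc_eq[OF o(1)] arc_has_deriv[OF o(1) in_dom[OF o(1)], of "t ?o"] by auto
  moreover have "(if j = N then t 0 else t j) = t ?o" by (simp add: outgoing_def)
  ultimately show ?thesis by (simp add: exterior_angle_def Let_def)
qed

text \<open>The logarithms of the tangent directions are chosen so that their imaginary parts differ
  by exactly the exterior angle, not merely modulo \<open>2 * pi\<close>: \<open>\<nu>2\<close> is
  principal and \<open>\<nu>1\<close> is defined from it. The bisector of the exterior sector has
  the direction \<open>\<theta>\<close>.\<close>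

lemma corner_data:
  assumes j: "j \<in> {1..N}"
  obtains r \<nu>1 \<nu>2 \<theta> where "r > 0" "germ_out j holomorphic_on ball 0 r" "germ_in j holomorphic_on ball 0 r"
    "deriv (germ_out j) 0 = exp \<nu>1" "deriv (germ_in j) 0 = exp \<nu>2"
    "germ_out j 0 = g (t j)" "germ_in j 0 = g (t j)"
    "Im \<nu>1 = \<theta> + exterior_angle g N t j * pi / 2" "Im \<nu>2 = \<theta> - exterior_angle g N t j * pi / 2"
proof -
  let ?o = "outgoing j" and ?i = "j - 1"
  have o: "?o < N" "?i < N" "Suc ?i = j" using outgoing_less[OF j] j by auto
  define v where "v = deriv (arc_ext ?o) (of_real (t ?o))"
  define u where "u = - deriv (arc_ext ?i) (of_real (t j))"
  have v: "v \<noteq> 0" using arc_deriv[OF o(1), of "t ?o"] t_Suc[OF o(1)] by (auto simp: v_def)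
  have u: "u \<noteq> 0" using arc_deriv[OF o(2), of "t j"] t_Suc[OF o(2)] o(3) by (auto simp: u_def)
  obtain r1 where r1: "r1 > 0" "germ_out j holomorphic_on ball 0 r1" "deriv (germ_out j) 0 = v" "germ_out j 0 = g (t j)"
    by (rule germ_out[OF j], rule that) (simp_all add: v_def)
  obtain r2 where r2: "r2 > 0" "germ_in j holomorphic_on ball 0 r2" "deriv (germ_in j) 0 = u" "germ_in j 0 = g (t j)"
    by (rule germ_in[OF j], rule that) (simp_all add: u_def)
  define \<alpha> where "\<alpha> = exterior_angle g N t j"
  have \<alpha>: "Arg2pi (v / u) = \<alpha> * pi" using corner_angle[OF j] by (simp add: \<alpha>_def v_def u_def)
  define \<nu>2 where "\<nu>2 = Ln u"
  define \<nu>1 where "\<nu>1 = Complex (ln (cmod v)) (Im \<nu>2 + \<alpha> * pi)"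
  have e2: "exp \<nu>2 = u" using u by (simp add: \<nu>2_def)
  have "exp \<nu>1 = v"
  proof -
    have f1: "v / u = of_real (cmod (v / u)) * cis (\<alpha> * pi)"
      using Arg2pi_eq[of "v / u"] \<alpha> by (simp add: cis_conv_exp)
    have f2: "exp \<nu>1 = of_real (cmod v) * cis (Im \<nu>2 + \<alpha> * pi)"
      using exp_eq_polar[of \<nu>1] v by (simp add: \<nu>1_def)
    have "exp (Re \<nu>2) = cmod u" using e2 norm_exp_eq_Re[of \<nu>2] by simp
    then have f3: "u = of_real (cmod u) * cis (Im \<nu>2)" using exp_eq_polar[of \<nu>2] e2 by simp
    have "v = v / u * u" using u by simp
    also have "\<dots> = (of_real (cmod (v / u)) * cis (\<alpha> * pi)) * (of_real (cmod u) * cis (Im \<nu>2))"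
      by (rule arg_cong2[OF f1 f3])
    also have "\<dots> = of_real (cmod (v / u) * cmod u) * (cis (Im \<nu>2) * cis (\<alpha> * pi))" by simp
    also have "\<dots> = exp \<nu>1" using u by (simp only: f2 cis_mult norm_divide) simp
    finally show ?thesis by simp
  qed
  moreover have "germ_out j holomorphic_on ball 0 (min r1 r2)" "germ_in j holomorphic_on ball 0 (min r1 r2)"
    using r1(2) r2(2) by (auto intro: holomorphic_on_subset)
  ultimately show ?thesis
    using r1 r2 e2 by (intro that[of "min r1 r2" \<nu>1 \<nu>2 "Im \<nu>2 + \<alpha> * pi / 2"]) (auto simp: \<nu>1_def \<alpha>_def field_simps)
qed

text \<open>Boundary points near \<open>g x\<close> come from real parameters near \<open>x\<close>,
  and the continuation is injective there, so a non-real parameter cannot reach them.\<close>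

lemma arc_interior_avoids:
  assumes i: "i < N" and x: "t i < x" "x < t (Suc i)"
  obtains r where "r > 0" "\<And>\<zeta>. dist \<zeta> (of_real x) < r \<Longrightarrow> Im \<zeta> \<noteq> 0 \<Longrightarrow> \<zeta> \<in> arc_dom i \<and> arc_ext i \<zeta> \<notin> frontier G"
proof -
  have xin: "x \<in> {t i..t (Suc i)}" using x by auto
  have x01: "0 < x" "x < 1" using arc_range[OF i] x t_range[of i] t_range[of "Suc i"] i by auto
  obtain d1 where d1: "d1 > 0" "ball (of_real x) d1 \<subseteq> arc_dom i" "inj_on (arc_ext i) (ball (of_real x) d1)"
    by (rule has_complex_derivative_locally_injective[OF arc_holo[OF i] in_dom[OF i xin] open_dom[OF i] arc_deriv[OF i xin]], rule that)
  define \<delta> where "\<delta> = min d1 (min (x - t i) (t (Suc i) - x))"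
  have \<delta>: "\<delta> > 0" using d1 x by (simp add: \<delta>_def)
  obtain r1 where r1: "r1 > 0" "\<And>y. y \<in> {0..1} \<Longrightarrow> dist (g y) (g x) < r1 \<Longrightarrow>
     \<bar>y - x\<bar> < \<delta> \<or> (x = 0 \<or> x = 1) \<and> (y < \<delta> \<or> y > 1 - \<delta>)"
    using simple_loop_near[OF simple loop _ \<delta>, of x] x01 by auto
  have "isCont (arc_ext i) (of_real x)"
    using arc_has_deriv[OF i in_dom[OF i xin]] by (rule DERIV_isCont)
  then obtain d2 where d2: "d2 > 0" "\<And>\<zeta>. dist \<zeta> (of_real x) < d2 \<Longrightarrow> dist (arc_ext i \<zeta>) (arc_ext i (of_real x)) < r1"
    using r1(1) unfolding continuous_at_eps_delta by metis
  show ?thesis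
  proof (rule that[of "min d1 d2"])
    show "min d1 d2 > 0" using d1 d2 by simp
    fix \<zeta> assume \<zeta>: "dist \<zeta> (of_real x) < min d1 d2" "Im \<zeta> \<noteq> 0"
    then have \<zeta>b: "\<zeta> \<in> ball (of_real x) d1" by (simp add: dist_commute)
    show "\<zeta> \<in> arc_dom i \<and> arc_ext i \<zeta> \<notin> frontier G"
    proof
      show "\<zeta> \<in> arc_dom i" using \<zeta>b d1 by blast
      show "arc_ext i \<zeta> \<notin> frontier G"
      proof
        assume "arc_ext i \<zeta> \<in> frontier G"
        then obtain y where y: "y \<in> {0..1}" "arc_ext i \<zeta> = g y" by (rule frontier_point)
        have "dist (g y) (g x) < r1" using d2(2)[of \<zeta>] \<zeta>(1) arc_eq[OF i xin] y by simp
        then have yx: "\<bar>y - x\<bar> < \<delta>" using r1(2)[OF y(1)] x01 by auto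
        then have "y \<in> {t i..t (Suc i)}" by (auto simp: \<delta>_def abs_if split: if_splits)
        then have "arc_ext i \<zeta> = arc_ext i (of_real y)" using arc_eq[OF i] y by simp
        moreover have "of_real y \<in> ball (complex_of_real x) d1"
          using yx by (simp add: \<delta>_def dist_norm norm_minus_commute flip: of_real_diff) (simp add: abs_minus_commute)
        ultimately have "\<zeta> = of_real y" using d1(3) \<zeta>b by (meson inj_onD)
        then show False using \<zeta>(2) by simp
      qed
    qed
  qed
qed

text \<open>Corners are numbered from \<open>1\<close> to \<open>N\<close>, arcs from 0 to
  \<open>N - 1\<close>. This is the corner at which arc \<open>i\<close> starts, inverse to
  \<open>outgoing\<close>, with \<open>N\<close> standing for the base point.\<close>

definition incoming_corner :: "nat \<Rightarrow> nat" where "incoming_corner i = (if i = 0 then N else i)"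

lemma incoming_corner: "i < N \<Longrightarrow> incoming_corner i \<in> {1..N} \<and> outgoing (incoming_corner i) = i"
  using N by (auto simp: incoming_corner_def outgoing_def)

lemma arc_rhombus:
  assumes i: "i < N"
  obtains \<kappa> where "\<kappa> > 0" "\<And>\<zeta>. \<zeta> \<in> lower_half (t i) (t (Suc i)) \<kappa> \<union> upper_half (t i) (t (Suc i)) \<kappa> \<Longrightarrow>
     \<zeta> \<in> arc_dom i \<and> arc_ext i \<zeta> \<notin> frontier G"
proof -
  have ends: "t i \<in> {t i..t (Suc i)}" "t (Suc i) \<in> {t i..t (Suc i)}" using t_Suc[OF i] by auto
  define j where "j = incoming_corner i"
  have j: "j \<in> {1..N}" "outgoing j = i" using incoming_corner[OF i] by (auto simp: j_def)
  obtain r \<nu>1 \<nu>2 \<theta> where c: "r > 0" "germ_out j holomorphic_on ball 0 r" "germ_in j holomorphic_on ball 0 r"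
    "deriv (germ_out j) 0 = exp \<nu>1" "deriv (germ_in j) 0 = exp \<nu>2"
    "germ_out j 0 = g (t j)" "germ_in j 0 = g (t j)"
    "Im \<nu>1 = \<theta> + exterior_angle g N t j * pi / 2" "Im \<nu>2 = \<theta> - exterior_angle g N t j * pi / 2"
    by (rule corner_data[OF j(1)], rule that)
  have d: "Im \<nu>1 - Im \<nu>2 = 1 * (exterior_angle g N t j * pi)" using c(8,9) by simp
  obtain ra \<kappa>a where A: "ra > 0" "\<kappa>a > 0"
    "\<And>\<zeta>. cmod \<zeta> < ra \<Longrightarrow> Im \<zeta> \<noteq> 0 \<Longrightarrow> \<bar>Im \<zeta>\<bar> < \<kappa>a * Re \<zeta> \<Longrightarrow> germ_out j \<zeta> \<notin> frontier G"
    by (rule wedge_avoids_arcs[OF _ _ corner_near_arcs[OF j(1)] c(2,1,4,6) c(3,1,5,7) d])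
       (use angle[OF j(1)] in \<open>auto intro: that\<close>)
  define l where "l = Suc i"
  have l: "l \<in> {1..N}" "l - 1 = i" using i by (auto simp: l_def)
  obtain r' \<nu>1' \<nu>2' \<theta>' where c': "r' > 0" "germ_out l holomorphic_on ball 0 r'" "germ_in l holomorphic_on ball 0 r'"
    "deriv (germ_out l) 0 = exp \<nu>1'" "deriv (germ_in l) 0 = exp \<nu>2'"
    "germ_out l 0 = g (t l)" "germ_in l 0 = g (t l)"
    "Im \<nu>1' = \<theta>' + exterior_angle g N t l * pi / 2" "Im \<nu>2' = \<theta>' - exterior_angle g N t l * pi / 2"
    by (rule corner_data[OF l(1)], rule that)
  \<comment> \<open>At the end of the arc the incoming germ takes the role of \<open>k1\<close>,
    which reverses the sign of the angle difference.\<close>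
  have d': "Im \<nu>2' - Im \<nu>1' = - 1 * (exterior_angle g N t l * pi)" using c'(8,9) by simp
  obtain rb \<kappa>b where B: "rb > 0" "\<kappa>b > 0"
    "\<And>\<zeta>. cmod \<zeta> < rb \<Longrightarrow> Im \<zeta> \<noteq> 0 \<Longrightarrow> \<bar>Im \<zeta>\<bar> < \<kappa>b * Re \<zeta> \<Longrightarrow> germ_in l \<zeta> \<notin> frontier G"
    by (rule wedge_avoids_arcs[OF _ _ near_arcs_sym[OF corner_near_arcs[OF l(1)]] c'(3,1,5,7) c'(2,1,4,6) d'])
       (use angle[OF l(1)] in \<open>auto intro: that\<close>)
  obtain ra' where ra': "ra' > 0" "ball (of_real (t i)) ra' \<subseteq> arc_dom i"
    using open_dom[OF i] in_dom[OF i ends(1)] open_contains_ball by blast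
  obtain rb' where rb': "rb' > 0" "ball (of_real (t (Suc i))) rb' \<subseteq> arc_dom i"
    using open_dom[OF i] in_dom[OF i ends(2)] open_contains_ball by blast
  show ?thesis
  proof (rule rhombus_uniform[OF t_Suc[OF i], where good = "\<lambda>\<zeta>. \<zeta> \<in> arc_dom i \<and> arc_ext i \<zeta> \<notin> frontier G"
        and ra = "min ra ra'" and rb = "min rb rb'" and \<kappa>a = \<kappa>a and \<kappa>b = \<kappa>b])
    fix x assume "t i < x" "x < t (Suc i)"
    then obtain r where "r > 0" "\<And>\<zeta>. dist \<zeta> (of_real x) < r \<Longrightarrow> Im \<zeta> \<noteq> 0 \<Longrightarrow> \<zeta> \<in> arc_dom i \<and> arc_ext i \<zeta> \<notin> frontier G"
      using arc_interior_avoids[OF i] by metis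
    then show "\<exists>r>0. \<forall>\<zeta>. dist \<zeta> (of_real x) < r \<longrightarrow> Im \<zeta> \<noteq> 0 \<longrightarrow> \<zeta> \<in> arc_dom i \<and> arc_ext i \<zeta> \<notin> frontier G" by blast
  next
    fix \<zeta> assume \<zeta>: "dist \<zeta> (of_real (t i)) < min ra ra'" "Im \<zeta> \<noteq> 0" "\<bar>Im \<zeta>\<bar> < \<kappa>a * (Re \<zeta> - t i)"
    then have "germ_out j (\<zeta> - of_real (t i)) \<notin> frontier G" by (intro A(3)) (auto simp: dist_norm)
    moreover have "\<zeta> \<in> ball (of_real (t i)) ra'" using \<zeta>(1) by (simp add: dist_commute)
    ultimately show "\<zeta> \<in> arc_dom i \<and> arc_ext i \<zeta> \<notin> frontier G" using ra' by (auto simp: germ_out_def j(2))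
  next
    fix \<zeta> assume \<zeta>: "dist \<zeta> (of_real (t (Suc i))) < min rb rb'" "Im \<zeta> \<noteq> 0" "\<bar>Im \<zeta>\<bar> < \<kappa>b * (t (Suc i) - Re \<zeta>)"
    then have "germ_in l (of_real (t (Suc i)) - \<zeta>) \<notin> frontier G"
      by (intro B(3)) (auto simp: dist_norm norm_minus_commute)
    moreover have "\<zeta> \<in> ball (of_real (t (Suc i))) rb'" using \<zeta>(1) by (simp add: dist_commute)
    ultimately show "\<zeta> \<in> arc_dom i \<and> arc_ext i \<zeta> \<notin> frontier G" using rb' by (auto simp: germ_in_def l_def)
  qed (use A B ra' rb' that in auto)
qed

text \<open>The winding number is 0 or \<open>1\<close> off the curve and grows by \<open>1\<close>
  from the lower to the upper side of the arc, so it is 0 below. This is where the counterclockwise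
  orientation decides which half is exterior; one point suffices, since the half rhombus is
  connected and its image misses the boundary.\<close>

lemma lower_half_outside:
  assumes i: "i < N" and \<kappa>: "\<kappa> > 0"
    and off: "\<And>\<zeta>. \<zeta> \<in> lower_half (t i) (t (Suc i)) \<kappa> \<union> upper_half (t i) (t (Suc i)) \<kappa> \<Longrightarrow>
     \<zeta> \<in> arc_dom i \<and> arc_ext i \<zeta> \<notin> frontier G"
    and \<zeta>: "\<zeta> \<in> lower_half (t i) (t (Suc i)) \<kappa>"
  shows "arc_ext i \<zeta> \<notin> closure G"
proof -
  let ?V = "lower_half (t i) (t (Suc i)) \<kappa>"
  define h where "h = (t (Suc i) - t i) / 2"
  define x where "x = t i + h"
  have h: "h > 0" "t i + h = t (Suc i) - h" using t_Suc[OF i] by (auto simp: h_def field_simps)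
  have x: "t i < x" "x < t (Suc i)" "x \<in> {t i + h..t (Suc i) - h}" using h by (auto simp: x_def)
  have x': "x \<in> {t i..t (Suc i)}" using x by auto
  have x01: "0 < x" "x < 1" using t_range[of i] t_range[of "Suc i"] i x by auto
  have inj: "y = x" if "y \<in> {0..1}" "g y = g x" for y
    using simple that x01 unfolding simple_path_def loop_free_def by fastforce
  obtain r where r: "r > 0" "\<And>\<zeta>. dist \<zeta> (of_real x) < r \<Longrightarrow> Im \<zeta> \<noteq> 0 \<Longrightarrow> \<zeta> \<in> arc_dom i \<and> arc_ext i \<zeta> \<notin> frontier G"
    by (rule arc_interior_avoids[OF i x(1,2)], rule that)
  have b: "0 \<le> t i" "t (Suc i) \<le> 1" using t_range[of i] t_range[of "Suc i"] i by auto
  have "\<forall>\<^sub>F \<eta> in at_right 0. winding_number g (arc_ext i (of_real x + \<i> * of_real \<eta>)) - winding_number g (arc_ext i (of_real x - \<i> * of_real \<eta>)) = 1"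
    by (rule winding_number_jump[OF valid_path_g loop b(1) x(1,2) b(2) inj arc_holo[OF i] open_dom[OF i] in_dom[OF i x'] arc_deriv[OF i x'] arc_eq[OF i] r(1)])
       (use r(2) path_image in auto)
  moreover have "\<forall>\<^sub>F \<eta> in at_right 0. \<eta> < \<kappa> * h" using \<kappa> h by (intro order_tendstoD[OF tendsto_ident_at]) auto
  moreover have "\<forall>\<^sub>F \<eta> in at_right 0. (0::real) < \<eta>" by (rule eventually_at_right_less)
  ultimately have "\<forall>\<^sub>F \<eta> in at_right 0. winding_number g (arc_ext i (of_real x + \<i> * of_real \<eta>)) - winding_number g (arc_ext i (of_real x - \<i> * of_real \<eta>)) = 1
     \<and> \<eta> < \<kappa> * h \<and> 0 < \<eta>" by eventually_elim simp
  then obtain \<eta> where \<eta>: "winding_number g (arc_ext i (of_real x + \<i> * of_real \<eta>)) - winding_number g (arc_ext i (of_real x - \<i> * of_real \<eta>)) = 1"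
     "\<eta> < \<kappa> * h" "0 < \<eta>"
    using eventually_happens'[OF trivial_limit_at_right_real] by fastforce
  note V = lower_halfI[OF x(3) \<eta>(3,2) \<kappa>]
  define zp where "zp = arc_ext i (of_real x + \<i> * of_real \<eta>)"
  define zm where "zm = arc_ext i (of_real x - \<i> * of_real \<eta>)"
  have "zp \<notin> frontier G" "zm \<notin> frontier G" using off V by (auto simp: zp_def zm_def)
  then have side: "winding_number g zp \<in> {0, 1}" "zm \<in> G \<Longrightarrow> winding_number g zm = 1" "zm \<notin> G \<Longrightarrow> zm \<notin> closure G"
    using off_frontier winding_inside winding_outside by blast+
  have zm: "zm \<notin> closure G"
  proof
    assume "zm \<in> closure G"
    then have "winding_number g zm = 1" using side(2,3) by blast
    then have "winding_number g zp = 2" using \<eta>(1) by (simp add: zp_def zm_def algebra_simps)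
    then show False using side(1) by simp
  qed
  have "continuous_on ?V (arc_ext i)"
    using off by (intro holomorphic_on_imp_continuous_on holomorphic_on_subset[OF arc_holo[OF i]]) auto
  then have "connected (arc_ext i ` ?V)"
    by (intro connected_continuous_image convex_connected convex_lower_half)
  then show ?thesis
    by (rule connected_side[where z = zm]) (use off V zm \<zeta> in \<open>auto simp: zm_def\<close>)
qed

lemma uniform_rhombus:
  obtains \<kappa> where "\<kappa> > 0" "\<And>i \<zeta>. i < N \<Longrightarrow> \<zeta> \<in> lower_half (t i) (t (Suc i)) \<kappa> \<union> upper_half (t i) (t (Suc i)) \<kappa> \<Longrightarrow>
     \<zeta> \<in> arc_dom i \<and> arc_ext i \<zeta> \<notin> frontier G"
    "\<And>j. j \<in> {1..N} \<Longrightarrow> \<kappa> \<le> exterior_angle g N t j"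
proof -
  have "\<forall>i\<in>{..<N}. \<exists>\<kappa>>0. \<forall>\<zeta>\<in>lower_half (t i) (t (Suc i)) \<kappa> \<union> upper_half (t i) (t (Suc i)) \<kappa>.
     \<zeta> \<in> arc_dom i \<and> arc_ext i \<zeta> \<notin> frontier G"
  proof
    fix i assume "i \<in> {..<N}"
    then have i: "i < N" by simp
    show "\<exists>\<kappa>>0. \<forall>\<zeta>\<in>lower_half (t i) (t (Suc i)) \<kappa> \<union> upper_half (t i) (t (Suc i)) \<kappa>.
     \<zeta> \<in> arc_dom i \<and> arc_ext i \<zeta> \<notin> frontier G"
      by (rule arc_rhombus[OF i]) blast
  qed
  then obtain k where k: "\<And>i. i < N \<Longrightarrow> k i > 0" "\<And>i \<zeta>. i < N \<Longrightarrow>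
      \<zeta> \<in> lower_half (t i) (t (Suc i)) (k i) \<union> upper_half (t i) (t (Suc i)) (k i) \<Longrightarrow> \<zeta> \<in> arc_dom i \<and> arc_ext i \<zeta> \<notin> frontier G"
    by (metis lessThan_iff)
  define A where "A = k ` {..<N} \<union> exterior_angle g N t ` {1..N}"
  have A: "finite A" "A \<noteq> {}" using N by (auto simp: A_def)
  define \<kappa> where "\<kappa> = Min A"
  have le: "\<kappa> \<le> a" if "a \<in> A" for a using A that by (simp add: \<kappa>_def)
  have "\<forall>a\<in>A. a > 0" using k(1) angle by (auto simp: A_def)
  then have \<kappa>: "\<kappa> > 0" using A by (simp add: \<kappa>_def)
  show ?thesis
  proof (rule that[OF \<kappa>])
    fix i \<zeta> assume i: "i < N" and "\<zeta> \<in> lower_half (t i) (t (Suc i)) \<kappa> \<union> upper_half (t i) (t (Suc i)) \<kappa>"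
    then have "\<zeta> \<in> lower_half (t i) (t (Suc i)) (k i) \<union> upper_half (t i) (t (Suc i)) (k i)"
      using lower_half_mono[OF le t_Suc[OF i] \<kappa>] upper_half_mono[OF le t_Suc[OF i] \<kappa>] by (auto simp: A_def)
    then show "\<zeta> \<in> arc_dom i \<and> arc_ext i \<zeta> \<notin> frontier G" using k(2)[OF i] by blast
  qed (rule le, simp add: A_def)
qed

text \<open>The sector avoids the boundary and is connected, and it contains points of the outgoing
  ray, which are exterior by \<open>lower_half_outside\<close>; hence the whole sector is exterior.
  The ray at each arc is turned into the sector by the angle
  \<open>arctan \<kappa>'\<close>.\<close>

lemma corner_rays:
  assumes j: "j \<in> {1..N}" and \<kappa>: "0 < \<kappa>'" "\<kappa>' < \<kappa>" "\<kappa> \<le> exterior_angle g N t j"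
    and off: "\<And>i \<zeta>. i < N \<Longrightarrow> \<zeta> \<in> lower_half (t i) (t (Suc i)) \<kappa> \<union> upper_half (t i) (t (Suc i)) \<kappa> \<Longrightarrow>
       \<zeta> \<in> arc_dom i \<and> arc_ext i \<zeta> \<notin> frontier G"
  obtains C \<rho> \<theta> \<tau>1 \<tau>2 l1 l2 where "C > 0"
    "\<And>\<tau>. \<tau> \<in> log_sector \<theta> (exterior_angle g N t j) C \<rho> \<Longrightarrow> g (t j) + exp \<tau> \<notin> closure G"
    "\<forall>\<^sub>F s in at_right 0. g (t j) + exp (\<tau>1 s) = arc_ext (outgoing j) (of_real (t (outgoing j)) + of_real s * Complex 1 (- \<kappa>'))"
    "\<forall>\<^sub>F s in at_right 0. g (t j) + exp (\<tau>2 s) = arc_ext (j - 1) (of_real (t j) - of_real s * Complex 1 \<kappa>')"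
    "((\<lambda>s. \<tau>1 s - of_real (ln s)) \<longlongrightarrow> l1) (at_right 0)" "((\<lambda>s. \<tau>2 s - of_real (ln s)) \<longlongrightarrow> l2) (at_right 0)"
    "\<bar>Im l1 - \<theta>\<bar> < exterior_angle g N t j * pi / 2" "\<bar>Im l2 - \<theta>\<bar> < exterior_angle g N t j * pi / 2"
proof -
  define \<omega> where "\<omega> = exterior_angle g N t j"
  have \<omega>: "0 < \<omega>" "\<omega> < 2" using angle[OF j] by (auto simp: \<omega>_def)
  let ?o = "outgoing j"
  have o: "?o < N" by (rule outgoing_less[OF j])
  obtain r \<nu>1 \<nu>2 \<theta> where c: "r > 0" "germ_out j holomorphic_on ball 0 r" "germ_in j holomorphic_on ball 0 r"
    "deriv (germ_out j) 0 = exp \<nu>1" "deriv (germ_in j) 0 = exp \<nu>2"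
    "germ_out j 0 = g (t j)" "germ_in j 0 = g (t j)"
    "Im \<nu>1 = \<theta> + \<omega> * pi / 2" "Im \<nu>2 = \<theta> - \<omega> * pi / 2"
    by (rule corner_data[OF j, folded \<omega>_def], rule that)
  obtain C \<rho> where C: "C > 0" "\<And>\<tau>. \<tau> \<in> log_sector \<theta> \<omega> C \<rho> \<Longrightarrow> g (t j) + exp \<tau> \<notin> frontier G"
    by (rule sector_avoids_arcs[OF \<omega> corner_near_arcs[OF j] c(2,1,4,6) c(3,1,5,7) c(8,9)], rule that)
  have der: "(germ_out j has_field_derivative exp \<nu>1) (at 0)" "(germ_in j has_field_derivative exp \<nu>2) (at 0)"
    using holomorphic_derivI[OF c(2) open_ball, of 0] holomorphic_derivI[OF c(3) open_ball, of 0] c(1,4,5) by auto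
  obtain \<tau>1 where \<tau>1: "\<forall>\<^sub>F s in at_right 0. g (t j) + exp (\<tau>1 s) = germ_out j (of_real s * Complex 1 (- \<kappa>'))"
    "((\<lambda>s. \<tau>1 s - of_real (ln s)) \<longlongrightarrow> \<nu>1 + Ln (Complex 1 (- \<kappa>'))) (at_right 0)"
    by (rule germ_ray[OF der(1) c(6), of "Complex 1 (- \<kappa>')"]) (auto intro: that)
  obtain \<tau>2 where \<tau>2: "\<forall>\<^sub>F s in at_right 0. g (t j) + exp (\<tau>2 s) = germ_in j (of_real s * Complex 1 \<kappa>')"
    "((\<lambda>s. \<tau>2 s - of_real (ln s)) \<longlongrightarrow> \<nu>2 + Ln (Complex 1 \<kappa>')) (at_right 0)"
    by (rule germ_ray[OF der(2) c(7), of "Complex 1 \<kappa>'"]) (auto intro: that)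
  have a1: "0 < arctan \<kappa>'" using \<kappa> by simp
  \<comment> \<open>Neither ray leaves the sector through its opposite side.\<close>
  have a2: "arctan \<kappa>' < \<omega> * pi"
  proof -
    have "arctan \<kappa>' \<le> \<kappa>'" using \<kappa> by (intro arctan_le_self) auto
    also have "\<dots> < \<omega> * 1" using \<kappa> by (simp add: \<omega>_def)
    also have "\<dots> \<le> \<omega> * pi" using \<omega> pi_gt3 by (intro mult_left_mono) auto
    finally show ?thesis .
  qed
  have a3: "Im (Ln (Complex 1 (- \<kappa>'))) = - arctan \<kappa>'" "Im (Ln (Complex 1 \<kappa>')) = arctan \<kappa>'"
    by (simp_all add: Im_Ln_eq Complex_eq_0 arctan_minus)
  have l: "\<bar>Im (\<nu>1 + Ln (Complex 1 (- \<kappa>'))) - \<theta>\<bar> < \<omega> * pi / 2" "\<bar>Im (\<nu>2 + Ln (Complex 1 \<kappa>')) - \<theta>\<bar> < \<omega> * pi / 2"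
    unfolding plus_complex.sel a3 c(8,9) using a1 a2 by linarith+
  have "\<forall>\<^sub>F s in at_right 0. s < (t (Suc ?o) - t ?o) / 2"
    using t_Suc[OF o] by (intro order_tendstoD[OF tendsto_ident_at]) auto
  then have "\<forall>\<^sub>F s in at_right 0. \<tau>1 s \<in> log_sector \<theta> \<omega> C \<rho> \<and> g (t j) + exp (\<tau>1 s) \<notin> closure G"
    using ray_in_log_sector[OF \<tau>1(2) l(1), of C \<rho>] \<tau>1(1) eventually_at_right_less[of "0::real"]
  proof eventually_elim
    case (elim s)
    have "of_real (t ?o) + of_real s * Complex 1 (- \<kappa>') \<in> lower_half (t ?o) (t (Suc ?o)) \<kappa>"
    proof -
      have "s * \<kappa>' < \<kappa> * s" using elim \<kappa> by (simp add: mult.commute)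
      moreover have "\<kappa> * s \<le> \<kappa> * (t (Suc ?o) - t ?o - s)" using elim \<kappa> by (intro mult_left_mono) auto
      moreover have "s * \<kappa>' > 0" using elim \<kappa> by simp
      ultimately show ?thesis by (auto simp: lower_half_def algebra_simps)
    qed
    then have "arc_ext ?o (of_real (t ?o) + of_real s * Complex 1 (- \<kappa>')) \<notin> closure G"
      using \<kappa> by (intro lower_half_outside[OF o _ off[OF o]]) auto
    then show ?case using elim by (simp add: germ_out_def)
  qed
  then obtain s where s: "\<tau>1 s \<in> log_sector \<theta> \<omega> C \<rho>" "g (t j) + exp (\<tau>1 s) \<notin> closure G"
    using eventually_happens'[OF trivial_limit_at_right_real] by fastforce
  define W where "W = (\<lambda>\<tau>. g (t j) + exp \<tau>) ` log_sector \<theta> \<omega> C \<rho>"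
  have "connected W"
    unfolding W_def using C(1)
    by (intro connected_continuous_image convex_connected convex_log_sector continuous_intros) auto
  then have out: "g (t j) + exp \<tau> \<notin> closure G" if "\<tau> \<in> log_sector \<theta> \<omega> C \<rho>" for \<tau>
    by (rule connected_side[where z = "g (t j) + exp (\<tau>1 s)"]) (use C(2) s that in \<open>auto simp: W_def\<close>)
  show ?thesis
    by (rule that[of C \<theta> \<rho> \<tau>1 \<tau>2, OF C(1) _ _ _ \<tau>1(2) \<tau>2(2)])
       (use out l \<tau>1(1) \<tau>2(1) in \<open>auto simp: \<omega>_def germ_out_def germ_in_def\<close>)
qed

section \<open>Growth of the exterior map along the rays at both ends of an arc\<close>

definition half_length :: "nat \<Rightarrow> real" where "half_length i = (t (Suc i) - t i) / 2"

lemma half_length: "i < N \<Longrightarrow> 0 < half_length i \<and> half_length i \<le> 1"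
  using t_Suc[of i] t_range[of i] t_range[of "Suc i"] by (auto simp: half_length_def)

lemma ray_in_lower_half:
  assumes i: "i < N" and s: "0 < s" "s \<le> half_length i" and \<kappa>: "0 < \<kappa>'" "\<kappa>' < \<kappa>"
  shows "of_real (t i) + of_real s * Complex 1 (- \<kappa>') \<in> lower_half (t i) (t (Suc i)) \<kappa>"
    "of_real (t (Suc i)) - of_real s * Complex 1 \<kappa>' \<in> lower_half (t i) (t (Suc i)) \<kappa>"
proof -
  have "s * \<kappa>' < \<kappa> * s" using s \<kappa> by (simp add: mult.commute)
  moreover have "\<kappa> * s \<le> \<kappa> * (t (Suc i) - t i - s)" using s \<kappa> by (intro mult_left_mono) (auto simp: half_length_def)
  moreover have "s * \<kappa>' > 0" using s \<kappa> by simp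
  ultimately show "of_real (t i) + of_real s * Complex 1 (- \<kappa>') \<in> lower_half (t i) (t (Suc i)) \<kappa>"
    "of_real (t (Suc i)) - of_real s * Complex 1 \<kappa>' \<in> lower_half (t i) (t (Suc i)) \<kappa>"
    by (auto simp: lower_half_def algebra_simps)
qed

text \<open>The bound by the exterior angles keeps the rays of slope below \<open>\<kappa>\<close> inside the corner sectors.\<close>

definition admissible :: "real \<Rightarrow> bool" where
  "admissible \<kappa> \<longleftrightarrow> 0 < \<kappa> \<and> (\<forall>j\<in>{1..N}. \<kappa> \<le> exterior_angle g N t j) \<and>
     (\<forall>i<N. \<forall>\<zeta>\<in>lower_half (t i) (t (Suc i)) \<kappa> \<union> upper_half (t i) (t (Suc i)) \<kappa>. \<zeta> \<in> arc_dom i \<and> arc_ext i \<zeta> \<notin> frontier G)"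

lemma admissible_exists: obtains \<kappa> where "admissible \<kappa>"
proof (rule uniform_rhombus)
  fix \<kappa> :: real
  assume a: "0 < \<kappa>" "\<And>i \<zeta>. i < N \<Longrightarrow> \<zeta> \<in> lower_half (t i) (t (Suc i)) \<kappa> \<union> upper_half (t i) (t (Suc i)) \<kappa> \<Longrightarrow>
     \<zeta> \<in> arc_dom i \<and> arc_ext i \<zeta> \<notin> frontier G" "\<And>j. j \<in> {1..N} \<Longrightarrow> \<kappa> \<le> exterior_angle g N t j"
  have "admissible \<kappa>" unfolding admissible_def using a by blast
  then show thesis by (rule that)
qed

lemma admissible_outside:
  assumes "admissible \<kappa>" "i < N" "\<zeta> \<in> lower_half (t i) (t (Suc i)) \<kappa>"
  shows "arc_ext i \<zeta> \<notin> closure G"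
  by (rule lower_half_outside[OF assms(2) _ _ assms(3)]) (use assms in \<open>auto simp: admissible_def\<close>)

lemma arc_decay:
  assumes E: "exterior_map G \<Phi> \<gamma>" and \<kappa>: "admissible \<kappa>" "0 < \<kappa>'" "\<kappa>' < \<kappa>" and i: "i < N"
    and \<omega>0: "0 < \<omega>0" "\<And>j. j \<in> {1..N} \<Longrightarrow> \<omega>0 \<le> exterior_angle g N t j"
  obtains c where "c > 0"
    "\<And>s. 0 < s \<Longrightarrow> s \<le> half_length i \<Longrightarrow> exp (c * s powr (1 / \<omega>0)) \<le> cmod (\<Phi> (arc_ext i (of_real (t i) + of_real s * Complex 1 (- \<kappa>'))))"
    "\<And>s. 0 < s \<Longrightarrow> s \<le> half_length i \<Longrightarrow> exp (c * s powr (1 / \<omega>0)) \<le> cmod (\<Phi> (arc_ext i (of_real (t (Suc i)) - of_real s * Complex 1 \<kappa>')))"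
proof -
  have \<Phi>h: "\<Phi> holomorphic_on (- closure G)" using E by (simp add: exterior_map_def)
  have \<Phi>c: "continuous_on (- closure G) \<Phi>" by (rule holomorphic_on_imp_continuous_on[OF \<Phi>h])
  have \<Phi>1: "cmod (\<Phi> z) > 1" if "z \<in> - closure G" for z using exterior_map_inverse(4)[OF E] that by simp
  have op: "open (- closure G)" by (intro open_Compl closed_closure)
  have off: "\<zeta> \<in> arc_dom i \<and> arc_ext i \<zeta> \<notin> frontier G"
    if "i < N" "\<zeta> \<in> lower_half (t i) (t (Suc i)) \<kappa> \<union> upper_half (t i) (t (Suc i)) \<kappa>" for i \<zeta>
    using \<kappa>(1) that by (auto simp: admissible_def)
  have bc: "continuous_on (lower_half (t i) (t (Suc i)) \<kappa>) (arc_ext i)"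
    using off[OF i] by (intro holomorphic_on_imp_continuous_on holomorphic_on_subset[OF arc_holo[OF i]]) auto
  note h = half_length[OF i]
  note ray = ray_in_lower_half[OF i _ _ \<kappa>(2,3)]
  define k1 where "k1 s = arc_ext i (of_real (t i) + of_real s * Complex 1 (- \<kappa>'))" for s
  define k2 where "k2 s = arc_ext i (of_real (t (Suc i)) - of_real s * Complex 1 \<kappa>')" for s
  have kc: "continuous_on {0<..half_length i} k1" "continuous_on {0<..half_length i} k2"
    unfolding k1_def k2_def using ray by (auto intro!: continuous_on_compose2[OF bc] continuous_intros)
  have ko: "k1 s \<in> - closure G" "k2 s \<in> - closure G" if "s \<in> {0<..half_length i}" for s
    unfolding k1_def k2_def using ray that admissible_outside[OF \<kappa>(1) i] by auto
  \<comment> \<open>One argument for both ends: arc \<open>i\<close> leaves the corner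
    \<open>j\<close> with \<open>i = outgoing j\<close> and enters the corner \<open>j\<close> with
    \<open>i = j - 1\<close>.\<close>
  have ending: "\<exists>c>0. \<forall>s. 0 < s \<longrightarrow> s \<le> half_length i \<longrightarrow> exp (c * s powr (1 / \<omega>0)) \<le> cmod (\<Phi> (k s))"
    if j: "j \<in> {1..N}" and k: "k = k1 \<and> i = outgoing j \<or> k = k2 \<and> i = j - 1" for j k
  proof -
    define \<omega> where "\<omega> = exterior_angle g N t j"
    have \<omega>: "0 < \<omega>" "\<omega> < 2" using angle[OF j] by (auto simp: \<omega>_def)
    have kj: "\<kappa> \<le> exterior_angle g N t j" using \<kappa>(1) j by (simp add: admissible_def)
    obtain C \<rho> \<theta> \<tau>1 \<tau>2 l1 l2 where c: "C > 0"
      "\<And>\<tau>. \<tau> \<in> log_sector \<theta> \<omega> C \<rho> \<Longrightarrow> g (t j) + exp \<tau> \<notin> closure G"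
      "\<forall>\<^sub>F s in at_right 0. g (t j) + exp (\<tau>1 s) = arc_ext (outgoing j) (of_real (t (outgoing j)) + of_real s * Complex 1 (- \<kappa>'))"
      "\<forall>\<^sub>F s in at_right 0. g (t j) + exp (\<tau>2 s) = arc_ext (j - 1) (of_real (t j) - of_real s * Complex 1 \<kappa>')"
      "((\<lambda>s. \<tau>1 s - of_real (ln s)) \<longlongrightarrow> l1) (at_right 0)" "((\<lambda>s. \<tau>2 s - of_real (ln s)) \<longlongrightarrow> l2) (at_right 0)"
      "\<bar>Im l1 - \<theta>\<bar> < \<omega> * pi / 2" "\<bar>Im l2 - \<theta>\<bar> < \<omega> * pi / 2"
      by (rule corner_rays[OF j \<kappa>(2,3) kj off, folded \<omega>_def], assumption, assumption, rule that)
    have sec: "g (t j) + exp \<tau> \<in> - closure G" if "\<tau> \<in> log_sector \<theta> \<omega> C \<rho>" for \<tau> using c(2)[OF that] by simp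
    obtain c0 \<rho>1 where c0: "c0 > 0"
      "\<And>\<sigma>. Re \<sigma> < \<rho>1 \<Longrightarrow> \<bar>Im \<sigma>\<bar> < \<omega> * pi / 2 \<Longrightarrow> Re (corner_barrier \<omega> \<sigma>) > 0 \<Longrightarrow>
       exp (c0 * Re (corner_barrier \<omega> \<sigma>)) \<le> cmod (\<Phi> (g (t j) + exp (\<sigma> + \<i> * of_real \<theta>)))"
      by (rule corner_barrier_bound[OF \<omega> c(1) op \<Phi>h \<Phi>1 sec], assumption, assumption, rule that)
    have "\<exists>\<tau> l. (\<forall>\<^sub>F s in at_right 0. g (t j) + exp (\<tau> s) = k s) \<and> ((\<lambda>s. \<tau> s - of_real (ln s)) \<longlongrightarrow> l) (at_right 0) \<and> \<bar>Im l - \<theta>\<bar> < \<omega> * pi / 2"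
      using k
    proof
      assume a: "k = k1 \<and> i = outgoing j"
      show ?thesis
        by (intro exI[of _ \<tau>1] exI[of _ l1] conjI c(5,7)) (use c(3) a in \<open>simp add: k1_def\<close>)
    next
      assume a: "k = k2 \<and> i = j - 1"
      then have "Suc i = j" using j by auto
      then show ?thesis
        by (intro exI[of _ \<tau>2] exI[of _ l2] conjI c(6,8)) (use c(4) a in \<open>simp add: k2_def\<close>)
    qed
    then obtain \<tau> l where \<tau>: "\<forall>\<^sub>F s in at_right 0. g (t j) + exp (\<tau> s) = k s" "((\<lambda>s. \<tau> s - of_real (ln s)) \<longlongrightarrow> l) (at_right 0)"
      "\<bar>Im l - \<theta>\<bar> < \<omega> * pi / 2" by blast
    obtain c' \<delta> where c': "c' > 0" "\<delta> > 0" "\<And>s. 0 < s \<Longrightarrow> s < \<delta> \<Longrightarrow> exp (c' * s powr (1 / \<omega>)) \<le> cmod (\<Phi> (k s))"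
      by (rule corner_ray_decay[OF \<omega> c0 \<tau>], assumption, assumption, assumption, rule that)
    have le: "\<omega>0 \<le> \<omega>" using \<omega>0(2)[OF j] by (simp add: \<omega>_def)
    have kk: "continuous_on {0<..half_length i} k" "k s \<in> - closure G" if "s \<in> {0<..half_length i}" for s
      using k kc ko[OF that] by auto
    have kcont: "continuous_on {0<..half_length i} k" using k kc by auto
    obtain c1 where "c1 > 0" "\<And>s. 0 < s \<Longrightarrow> s \<le> half_length i \<Longrightarrow> exp (c1 * s powr (1 / \<omega>0)) \<le> cmod (\<Phi> (k s))"
      by (rule powr_decay_extend[where k = k and \<Phi> = \<Phi> and h = "half_length i", OF c' \<omega>0(1) le _ _ \<Phi>c \<Phi>1 kcont kk(2)]) (use h in auto)
    then show ?thesis by blast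
  qed
  have j1: "incoming_corner i \<in> {1..N}" "i = outgoing (incoming_corner i)" using incoming_corner[OF i] by auto
  obtain ca where ca: "ca > 0" "\<And>s. 0 < s \<Longrightarrow> s \<le> half_length i \<Longrightarrow> exp (ca * s powr (1 / \<omega>0)) \<le> cmod (\<Phi> (k1 s))"
    using ending[OF j1(1), of k1] j1(2) by auto
  obtain cb where cb: "cb > 0" "\<And>s. 0 < s \<Longrightarrow> s \<le> half_length i \<Longrightarrow> exp (cb * s powr (1 / \<omega>0)) \<le> cmod (\<Phi> (k2 s))"
    using ending[of "Suc i" k2] i by auto
  show ?thesis
  proof (rule that[of "min ca cb"])
    show "min ca cb > 0" using ca cb by simp
    fix s assume s: "0 < s" "s \<le> half_length i"
    have le: "exp (min ca cb * s powr (1 / \<omega>0)) \<le> exp (ca * s powr (1 / \<omega>0))" "exp (min ca cb * s powr (1 / \<omega>0)) \<le> exp (cb * s powr (1 / \<omega>0))"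
      by (auto intro: mult_right_mono)
    show "exp (min ca cb * s powr (1 / \<omega>0)) \<le> cmod (\<Phi> (arc_ext i (of_real (t i) + of_real s * Complex 1 (- \<kappa>'))))"
      by (rule order_trans[OF le(1) ca(2)[OF s, unfolded k1_def]])
    show "exp (min ca cb * s powr (1 / \<omega>0)) \<le> cmod (\<Phi> (arc_ext i (of_real (t (Suc i)) - of_real s * Complex 1 \<kappa>')))"
      by (rule order_trans[OF le(2) cb(2)[OF s, unfolded k2_def]])
  qed
qed

section \<open>The residue term and the contributions of arcs and corners\<close>

definition log_kernel :: "complex \<Rightarrow> nat \<Rightarrow> complex \<Rightarrow> complex" where
  "log_kernel z0 i \<zeta> = deriv (arc_ext i) \<zeta> / (arc_ext i \<zeta> - z0)"

definition log_integral :: "complex \<Rightarrow> nat \<Rightarrow> real \<Rightarrow> complex" where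
  "log_integral z0 i x = integral {t i..x} (\<lambda>s. log_kernel z0 i (of_real s))"

lemma log_kernel_continuous:
  assumes i: "i < N" and S: "S \<subseteq> arc_dom i" and ne: "\<And>\<zeta>. \<zeta> \<in> S \<Longrightarrow> arc_ext i \<zeta> \<noteq> z0"
  shows "continuous_on S (log_kernel z0 i)"
proof -
  have "continuous_on S (deriv (arc_ext i))" "continuous_on S (arc_ext i)"
    using S holomorphic_deriv[OF arc_holo[OF i] open_dom[OF i]] arc_holo[OF i]
    by (meson continuous_on_subset holomorphic_on_imp_continuous_on)+
  then show ?thesis unfolding log_kernel_def[abs_def] by (intro continuous_intros) (use ne in auto)
qed

lemma log_kernel_segment:
  assumes i: "i < N" and z0: "z0 \<in> G"
  shows "continuous_on {t i..t (Suc i)} (\<lambda>s. log_kernel z0 i (of_real s))"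
proof (rule continuous_on_compose2[OF log_kernel_continuous[OF i]])
  show "of_real ` {t i..t (Suc i)} \<subseteq> arc_dom i" using in_dom[OF i] by auto
  fix \<zeta> assume "\<zeta> \<in> complex_of_real ` {t i..t (Suc i)}"
  then obtain s where s: "s \<in> {t i..t (Suc i)}" "\<zeta> = of_real s" by auto
  then have "arc_ext i \<zeta> \<in> frontier G" using arc_eq[OF i] arc_range[OF i] g_in_frontier by auto
  then show "arc_ext i \<zeta> \<noteq> z0" using frontier_disjoint z0 by auto
qed (auto intro!: continuous_intros)

lemma log_integral_derivative:
  assumes i: "i < N" and z0: "z0 \<in> G"
  shows "t i < x \<Longrightarrow> x < t (Suc i) \<Longrightarrow> (log_integral z0 i has_vector_derivative log_kernel z0 i (of_real x)) (at x)"
    and "continuous_on {t i..t (Suc i)} (log_integral z0 i)"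
proof -
  have D: "(log_integral z0 i has_vector_derivative log_kernel z0 i (of_real x)) (at x within {t i..t (Suc i)})"
    if "x \<in> {t i..t (Suc i)}" for x
    unfolding log_integral_def by (rule integral_has_vector_derivative[OF log_kernel_segment[OF i z0] that])
  show "t i < x \<Longrightarrow> x < t (Suc i) \<Longrightarrow> (log_integral z0 i has_vector_derivative log_kernel z0 i (of_real x)) (at x)"
    using D[of x] by (simp add: at_within_Icc_at)
  show "continuous_on {t i..t (Suc i)} (log_integral z0 i)"
    unfolding continuous_on_eq_continuous_within by (intro ballI has_vector_derivative_continuous[OF D])
qed

lemma log_integral_total:
  assumes "z0 \<in> G"
  shows "(\<Sum>i<N. log_integral z0 i (t (Suc i)) - log_integral z0 i (t i)) = 2 * of_real pi * \<i>"
proof -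
  have "z0 \<notin> frontier G" using frontier_disjoint assms by auto
  then have "(\<Sum>i<N. log_integral z0 i (t (Suc i)) - log_integral z0 i (t i)) = 2 * of_real pi * \<i> * winding_number g z0"
    by (rule boundary_integral)
       (use log_integral_derivative[OF _ assms] in \<open>auto simp: log_kernel_def\<close>)
  then show ?thesis using winding_inside[OF assms] by simp
qed

text \<open>The order of quantifiers is the point: \<open>C\<close> depends on the curve, the
  exterior map, \<open>\<omega>0\<close>, \<open>\<kappa>\<close> and \<open>z0\<close>, but not on
  \<open>n\<close>, \<open>P\<close> or \<open>\<beta>\<close>. Whatever depends on these is
  collected in \<open>X\<close>, which carries a factor \<open>\<epsilon>\<close>.\<close>

lemma arc_contribution:
  assumes E: "exterior_map G \<Phi> \<gamma>"
    and L: "laurent_at_infinity (inv_into (- closure G) \<Phi>) (complex_of_real (1 / \<gamma>)) b 1"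
    and \<kappa>: "admissible \<kappa>" and i: "i < N" and z0: "z0 \<in> G"
    and \<omega>0: "0 < \<omega>0" "\<And>j. j \<in> {1..N} \<Longrightarrow> \<omega>0 \<le> exterior_angle g N t j"
  obtains C where "\<And>n P \<beta>. n \<ge> 1 \<Longrightarrow> (\<And>z. z \<notin> closure G \<Longrightarrow> (P has_field_derivative \<Phi> z ^ n + \<beta> / (z - z0)) (at z)) \<Longrightarrow>
    \<exists>X. \<forall>\<epsilon>. 0 < \<epsilon> \<longrightarrow> \<epsilon> < half_length i \<longrightarrow>
      cmod (P (arc_ext i (of_real (t (Suc i)) - of_real \<epsilon> * Complex 1 (\<kappa> / 4))) - P (arc_ext i (of_real (t i) + of_real \<epsilon> * Complex 1 (- (\<kappa> / 4))))
        - \<beta> * (log_integral z0 i (t (Suc i) - \<epsilon>) - log_integral z0 i (t i + \<epsilon>))) \<le> C / real n powr \<omega>0 + \<epsilon> * X"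
proof -
  have k0: "\<kappa> > 0" using \<kappa> by (simp add: admissible_def)
  \<comment> \<open>At half the admissible slope the closed rhombus \<open>R\<close>, its two end
    vertices included, is still inside \<open>arc_dom i\<close>, so continuous functions on it are
    bounded. The rays have half of that slope again, as \<open>reflected_arc_estimate\<close> asks
    for a strictly smaller one.\<close>
  define \<kappa>1 where "\<kappa>1 = \<kappa> / 2"
  define \<kappa>' where "\<kappa>' = \<kappa> / 4"
  have k: "0 < \<kappa>'" "\<kappa>' < \<kappa>1" "\<kappa>1 < \<kappa>" "0 < \<kappa>1" "\<kappa>' < \<kappa>" using k0 by (auto simp: \<kappa>1_def \<kappa>'_def)
  define a where "a = t i"
  define e where "e = t (Suc i)"
  have ae: "a < e" using t_Suc[OF i] by (simp add: a_def e_def)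
  let ?V = "lower_half a e \<kappa>1" and ?U = "upper_half a e \<kappa>1"
  have VV: "?V \<subseteq> lower_half a e \<kappa>" "?U \<subseteq> upper_half a e \<kappa>"
    using lower_half_mono[of \<kappa>1 \<kappa> a e] upper_half_mono[of \<kappa>1 \<kappa> a e] k ae by auto
  have dom: "\<zeta> \<in> arc_dom i" if "\<zeta> \<in> lower_half a e \<kappa> \<union> upper_half a e \<kappa>" for \<zeta>
    using \<kappa> i that by (auto simp: admissible_def a_def e_def)
  have out: "arc_ext i \<zeta> \<notin> closure G" if "\<zeta> \<in> lower_half a e \<kappa>" for \<zeta>
    using admissible_outside[OF \<kappa> i] that by (simp add: a_def e_def)
  define R where "R = {\<zeta>. \<bar>Im \<zeta>\<bar> \<le> \<kappa>1 * (Re \<zeta> - a) \<and> \<bar>Im \<zeta>\<bar> \<le> \<kappa>1 * (e - Re \<zeta>)}"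
  have RRe: "a \<le> Re \<zeta>" "Re \<zeta> \<le> e" if "\<zeta> \<in> R" for \<zeta>
  proof -
    have "0 \<le> \<kappa>1 * (Re \<zeta> - a)" "0 \<le> \<kappa>1 * (e - Re \<zeta>)" using that abs_ge_zero[of "Im \<zeta>"] by (auto simp: R_def)
    then show "a \<le> Re \<zeta>" "Re \<zeta> \<le> e" using k(4) by (auto simp: zero_le_mult_iff)
  qed
  have R: "compact R"
  proof -
    have "closed R" unfolding R_def by (intro closed_Collect_conj closed_Collect_le continuous_intros)
    moreover have "bounded R"
    proof (rule boundedI)
      fix \<zeta> assume z: "\<zeta> \<in> R"
      then have "\<bar>Im \<zeta>\<bar> \<le> \<kappa>1 * (Re \<zeta> - a)" by (simp add: R_def)
      also have "\<dots> \<le> \<kappa>1 * (e - a)" using k RRe[OF z] by (intro mult_left_mono) auto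
      finally show "cmod \<zeta> \<le> (\<bar>a\<bar> + \<bar>e\<bar>) + \<kappa>1 * (e - a)"
        using RRe[OF z] by (intro order_trans[OF cmod_le] add_mono) auto
    qed
    ultimately show ?thesis by (simp add: compact_eq_bounded_closed)
  qed
  have Rcases: "\<zeta> \<in> lower_half a e \<kappa> \<or> \<zeta> \<in> upper_half a e \<kappa> \<or> (Im \<zeta> = 0 \<and> Re \<zeta> \<in> {a..e} \<and> \<zeta> = of_real (Re \<zeta>))" if z: "\<zeta> \<in> R" for \<zeta>
  proof (cases "Im \<zeta> = 0")
    case True then show ?thesis using RRe[OF z] by (auto simp: complex_eq_iff)
  next
    case False
    then have "0 < \<kappa>1 * (Re \<zeta> - a)" "0 < \<kappa>1 * (e - Re \<zeta>)" using z by (auto simp: R_def intro: less_le_trans[of 0 "\<bar>Im \<zeta>\<bar>"])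
    then have "0 < Re \<zeta> - a" "0 < e - Re \<zeta>" using k by (auto simp: zero_less_mult_iff)
    then have "\<kappa>1 * (Re \<zeta> - a) < \<kappa> * (Re \<zeta> - a)" "\<kappa>1 * (e - Re \<zeta>) < \<kappa> * (e - Re \<zeta>)" using k by (auto intro: mult_strict_right_mono)
    then have "\<bar>Im \<zeta>\<bar> < \<kappa> * (Re \<zeta> - a)" "\<bar>Im \<zeta>\<bar> < \<kappa> * (e - Re \<zeta>)" using z unfolding R_def mem_Collect_eq by linarith+
    then show ?thesis using False by (auto simp: lower_half_def upper_half_def abs_if split: if_splits)
  qed
  have Rdom: "R \<subseteq> arc_dom i"
  proof
    fix \<zeta> assume "\<zeta> \<in> R"
    then show "\<zeta> \<in> arc_dom i" using Rcases[of \<zeta>] dom[of \<zeta>] in_dom[OF i, of "Re \<zeta>"] by (auto simp: a_def e_def)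
  qed
  have VR: "?V \<subseteq> R" "?U \<subseteq> R" by (auto simp: R_def lower_half_def upper_half_def)
  have fr: "arc_ext i (of_real x) \<in> frontier G" if "x \<in> {a..e}" for x
    using arc_eq[OF i, of x] arc_range[OF i] g_in_frontier[of x] that by (auto simp: a_def e_def)
  \<comment> \<open>The upper half is mapped into \<open>G\<close> and may hit \<open>z0\<close>,
    where \<open>log_kernel\<close> has a pole; this kernel is therefore bounded only on the closed
    lower half.\<close>
  define R' where "R' = R \<inter> {\<zeta>. Im \<zeta> \<le> 0}"
  have R': "compact R'"
    unfolding R'_def by (intro compact_Int_closed R closed_halfspace_Im_le)
  have VR': "?V \<subseteq> R'" using VR by (auto simp: R'_def lower_half_def)
  have R'ne: "arc_ext i \<zeta> \<noteq> z0" if "\<zeta> \<in> R'" for \<zeta>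
  proof -
    have "\<zeta> \<in> R" "\<zeta> \<notin> upper_half a e \<kappa>" using that by (auto simp: R'_def upper_half_def)
    then consider "\<zeta> \<in> lower_half a e \<kappa>" | "Re \<zeta> \<in> {a..e}" "\<zeta> = of_real (Re \<zeta>)" using Rcases[of \<zeta>] by blast
    then show ?thesis
    proof cases
      case 1 then show ?thesis using out z0 closure_subset by fastforce
    next
      case 2 then show ?thesis using fr[of "Re \<zeta>"] frontier_disjoint z0 by auto
    qed
  qed
  have dcont: "continuous_on (arc_dom i) (deriv (arc_ext i))"
    by (rule holomorphic_on_imp_continuous_on[OF holomorphic_deriv[OF arc_holo[OF i] open_dom[OF i]]])
  have "bounded (deriv (arc_ext i) ` R)"
    by (intro compact_imp_bounded compact_continuous_image R continuous_on_subset[OF dcont Rdom])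
  then obtain B where B: "B > 0" "\<And>\<zeta>. \<zeta> \<in> R \<Longrightarrow> cmod (deriv (arc_ext i) \<zeta>) \<le> B" unfolding bounded_pos by auto
  have "bounded (log_kernel z0 i ` R')"
    using Rdom R'ne by (intro compact_imp_bounded compact_continuous_image R' log_kernel_continuous[OF i]) (auto simp: R'_def)
  then obtain Q where Q: "\<And>\<zeta>. \<zeta> \<in> R' \<Longrightarrow> cmod (log_kernel z0 i \<zeta>) \<le> Q" unfolding bounded_pos by auto
  have "bounded (arc_ext i ` R)"
    by (intro compact_imp_bounded compact_continuous_image R continuous_on_subset[OF holomorphic_on_imp_continuous_on[OF arc_holo[OF i]] Rdom])
  then obtain B1 where B1: "\<And>\<zeta>. \<zeta> \<in> R \<Longrightarrow> cmod (arc_ext i \<zeta>) \<le> B1" unfolding bounded_pos by auto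
  obtain M where M: "\<And>z. z \<notin> closure G \<Longrightarrow> cmod z \<le> B1 \<Longrightarrow> cmod (\<Phi> z) \<le> M"
    by (rule exterior_map_bounded[OF E L, of B1], rule that)
  obtain c where c: "c > 0"
    "\<And>s. 0 < s \<Longrightarrow> s \<le> half_length i \<Longrightarrow> exp (c * s powr (1 / \<omega>0)) \<le> cmod (\<Phi> (arc_ext i (of_real (t i) + of_real s * Complex 1 (- \<kappa>'))))"
    "\<And>s. 0 < s \<Longrightarrow> s \<le> half_length i \<Longrightarrow> exp (c * s powr (1 / \<omega>0)) \<le> cmod (\<Phi> (arc_ext i (of_real (t (Suc i)) - of_real s * Complex 1 \<kappa>')))"
    by (rule arc_decay[OF E \<kappa> k(1,5) i \<omega>0], assumption, rule that)
  obtain K where K: "K > 0" "\<And>x. x \<ge> 0 \<Longrightarrow> exp (- c * x powr (1 / \<omega>0)) \<le> K / (1 + x)\<^sup>2"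
    by (rule exp_powr_decay[OF c(1), of "1 / \<omega>0"]) (use \<omega>0 in \<open>auto intro: that\<close>)
  define F where "F \<zeta> = \<Phi> (arc_ext i \<zeta>)" for \<zeta>
  have \<Phi>h: "\<Phi> holomorphic_on (- closure G)" using E by (simp add: exterior_map_def)
  have outV: "arc_ext i \<zeta> \<notin> closure G" if "\<zeta> \<in> ?V" for \<zeta> using out VV that by blast
  have Fh: "F holomorphic_on ?V"
  proof -
    have "\<Phi> \<circ> arc_ext i holomorphic_on ?V"
      by (rule holomorphic_on_compose_gen[OF holomorphic_on_subset[OF arc_holo[OF i]] \<Phi>h])
         (use outV VR Rdom in auto)
    then show ?thesis by (simp add: F_def[abs_def] o_def)
  qed
  have F1: "cmod (F \<zeta>) > 1" if "\<zeta> \<in> ?V" for \<zeta> using exterior_map_inverse(4)[OF E outV[OF that]] by (simp add: F_def)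
  have FM: "cmod (F \<zeta>) \<le> M" if "\<zeta> \<in> ?V" for \<zeta>
    unfolding F_def using outV[OF that] B1 VR that by (intro M) auto
  have Flim: "((\<lambda>\<zeta>. cmod (F \<zeta>)) \<longlongrightarrow> 1) (at (of_real x) within ?V)" if x: "a < x" "x < e" for x
  proof -
    have xin: "x \<in> {a..e}" using x by auto
    have "of_real x \<in> arc_dom i" using in_dom[OF i, of x] xin by (simp add: a_def e_def)
    then have "isCont (arc_ext i) (of_real x)" using arc_has_deriv[OF i] DERIV_isCont by blast
    then have lim: "(arc_ext i \<longlongrightarrow> arc_ext i (of_real x)) (at (of_real x) within ?V)"
      by (meson continuous_at_imp_continuous_at_within continuous_within)
    have pf: "arc_ext i (of_real x) \<in> closure G" using fr[OF xin] frontier_disjoint by blast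
    have "filterlim (arc_ext i) (at (arc_ext i (of_real x)) within - closure G) (at (of_real x) within ?V)"
      unfolding filterlim_at
    proof
      show "\<forall>\<^sub>F \<zeta> in at (of_real x) within ?V. arc_ext i \<zeta> \<in> - closure G \<and> arc_ext i \<zeta> \<noteq> arc_ext i (of_real x)"
        unfolding eventually_at_filter using outV pf by (intro always_eventually allI impI) (metis ComplI)
    qed (rule lim)
    then show ?thesis unfolding F_def by (rule filterlim_compose[OF exterior_map_boundary[OF E L pf]])
  qed
  have qc: "isCont (log_kernel z0 i) (of_real x)" if x: "a < x" "x < e" for x
  proof -
    have xin: "x \<in> {a..e}" using x by auto
    then have xd: "of_real x \<in> arc_dom i" using in_dom[OF i, of x] by (simp add: a_def e_def)
    have "isCont (arc_ext i) (of_real x)" using arc_has_deriv[OF i xd] DERIV_isCont by blast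
    moreover have "isCont (deriv (arc_ext i)) (of_real x)"
      using dcont open_dom[OF i] xd by (simp add: continuous_on_eq_continuous_at)
    moreover have "arc_ext i (of_real x) \<noteq> z0" using fr[OF xin] frontier_disjoint z0 by auto
    ultimately show ?thesis unfolding log_kernel_def[abs_def] by (intro continuous_intros) auto
  qed
  have seg: "of_real ` {a<..<e} \<subseteq> arc_dom i" using in_dom[OF i] by (auto simp: a_def e_def)
  define C where "C = 2 * (K * B * cmod (Complex 1 \<kappa>'))"
  show ?thesis
  proof (rule that[of C])
    fix n :: nat and P \<beta>
    assume n: "n \<ge> 1" and P: "\<And>z. z \<notin> closure G \<Longrightarrow> (P has_field_derivative \<Phi> z ^ n + \<beta> / (z - z0)) (at z)"
    define X where "X = 2 * (\<kappa>' * (M ^ n * B + cmod \<beta> * Q + B))"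
    have PR: "((\<lambda>\<zeta>. P (arc_ext i \<zeta>)) has_field_derivative (F \<zeta> ^ n * deriv (arc_ext i) \<zeta> + \<beta> * log_kernel z0 i \<zeta>)) (at \<zeta>)"
      if \<zeta>: "\<zeta> \<in> ?V" for \<zeta>
    proof -
      have "\<zeta> \<in> arc_dom i" using VR Rdom \<zeta> by blast
      then have "((\<lambda>\<zeta>. P (arc_ext i \<zeta>)) has_field_derivative (\<Phi> (arc_ext i \<zeta>) ^ n + \<beta> / (arc_ext i \<zeta> - z0)) * deriv (arc_ext i) \<zeta>) (at \<zeta>)"
        by (rule DERIV_chain2[where f = P and g = "arc_ext i", OF P[OF outV[OF \<zeta>]] arc_has_deriv[OF i]])
      moreover have "(\<Phi> (arc_ext i \<zeta>) ^ n + \<beta> / (arc_ext i \<zeta> - z0)) * deriv (arc_ext i) \<zeta> = F \<zeta> ^ n * deriv (arc_ext i) \<zeta> + \<beta> * log_kernel z0 i \<zeta>"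
        by (simp add: F_def log_kernel_def distrib_right)
      ultimately show ?thesis by simp
    qed
    show "\<exists>X. \<forall>\<epsilon>. 0 < \<epsilon> \<longrightarrow> \<epsilon> < half_length i \<longrightarrow>
      cmod (P (arc_ext i (of_real (t (Suc i)) - of_real \<epsilon> * Complex 1 (\<kappa> / 4))) - P (arc_ext i (of_real (t i) + of_real \<epsilon> * Complex 1 (- (\<kappa> / 4))))
        - \<beta> * (log_integral z0 i (t (Suc i) - \<epsilon>) - log_integral z0 i (t i + \<epsilon>))) \<le> C / real n powr \<omega>0 + \<epsilon> * X"
    proof (intro exI[of _ X] allI impI)
      fix \<epsilon> assume \<epsilon>: "0 < \<epsilon>" "\<epsilon> < half_length i"
      have "cmod (P (arc_ext i (of_real e - of_real \<epsilon> * Complex 1 \<kappa>')) - P (arc_ext i (of_real a + of_real \<epsilon> * Complex 1 (- \<kappa>')))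
        - \<beta> * (log_integral z0 i (e - \<epsilon>) - log_integral z0 i (a + \<epsilon>)))
        \<le> 2 * (K * B * cmod (Complex 1 \<kappa>') / real n powr \<omega>0) + 2 * (\<kappa>' * \<epsilon> * (M ^ n * B + cmod \<beta> * Q + B))"
      proof (rule reflected_arc_estimate[where F = F and g = "deriv (arc_ext i)" and q = "log_kernel z0 i" and R = "\<lambda>\<zeta>. P (arc_ext i \<zeta>)"
            and S = "arc_dom i" and a = a and b = e and \<kappa> = \<kappa>1 and h = "half_length i" and c = c])
        show "deriv (arc_ext i) holomorphic_on arc_dom i" by (rule holomorphic_deriv[OF arc_holo[OF i] open_dom[OF i]])
        show "open (arc_dom i)" by (rule open_dom[OF i])
        show "?U \<subseteq> arc_dom i" "?V \<subseteq> arc_dom i" using VR Rdom by auto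
        show "cmod (deriv (arc_ext i) \<zeta>) \<le> B" if "\<zeta> \<in> ?U \<union> ?V" for \<zeta> using B(2) VR that by blast
        show "cmod (log_kernel z0 i \<zeta>) \<le> Q" if "\<zeta> \<in> ?V" for \<zeta> using Q VR' that by blast
        show "half_length i = (e - a) / 2" by (simp add: half_length_def a_def e_def)
        show "(log_integral z0 i has_vector_derivative log_kernel z0 i (of_real x)) (at x)" if "a < x" "x < e" for x
          using log_integral_derivative(1)[OF i z0] that by (simp add: a_def e_def)
        show "exp (c * s powr (1 / \<omega>0)) \<le> cmod (F (of_real a + of_real s * Complex 1 (- \<kappa>')))" if "0 < s" "s \<le> half_length i" for s
          using c(2)[OF that] by (simp add: F_def a_def)
        show "exp (c * s powr (1 / \<omega>0)) \<le> cmod (F (of_real e - of_real s * Complex 1 \<kappa>'))" if "0 < s" "s \<le> half_length i" for s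
          using c(3)[OF that] by (simp add: F_def e_def)
      qed (use k n \<omega>0 B Fh F1 FM Flim seg qc PR K(2) \<epsilon> in auto)
      also have "\<dots> = C / real n powr \<omega>0 + \<epsilon> * X" by (simp add: C_def X_def)
      finally show "cmod (P (arc_ext i (of_real (t (Suc i)) - of_real \<epsilon> * Complex 1 (\<kappa> / 4))) - P (arc_ext i (of_real (t i) + of_real \<epsilon> * Complex 1 (- (\<kappa> / 4))))
        - \<beta> * (log_integral z0 i (t (Suc i) - \<epsilon>) - log_integral z0 i (t i + \<epsilon>))) \<le> C / real n powr \<omega>0 + \<epsilon> * X"
        by (simp only: a_def e_def \<kappa>'_def)
    qed
  qed
qed

text \<open>For fixed \<open>n\<close> the derivative of \<open>P\<close> is bounded on the corner
  sector: \<open>\<Phi>\<close> is bounded on bounded parts of the exterior, and a disc about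
  \<open>z0\<close> lies inside \<open>G\<close>. Hence \<open>primitive_corner_jump\<close> applies
  to the two rays at this corner.\<close>

lemma corner_contribution:
  assumes E: "exterior_map G \<Phi> \<gamma>"
    and L: "laurent_at_infinity (inv_into (- closure G) \<Phi>) (complex_of_real (1 / \<gamma>)) b 1"
    and \<kappa>: "admissible \<kappa>" "0 < \<kappa>'" "\<kappa>' < \<kappa>" and j: "j \<in> {1..N}" and z0: "z0 \<in> G"
    and P: "\<And>z. z \<notin> closure G \<Longrightarrow> (P has_field_derivative \<Phi> z ^ n + \<beta> / (z - z0)) (at z)"
  shows "((\<lambda>s. P (arc_ext (j - 1) (of_real (t j) - of_real s * Complex 1 \<kappa>'))
     - P (arc_ext (outgoing j) (of_real (t (outgoing j)) + of_real s * Complex 1 (- \<kappa>')))) \<longlongrightarrow> 0) (at_right 0)"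
proof -
  have kj: "\<kappa> \<le> exterior_angle g N t j" using \<kappa>(1) j by (simp add: admissible_def)
  have off: "\<zeta> \<in> arc_dom i \<and> arc_ext i \<zeta> \<notin> frontier G"
    if "i < N" "\<zeta> \<in> lower_half (t i) (t (Suc i)) \<kappa> \<union> upper_half (t i) (t (Suc i)) \<kappa>" for i \<zeta>
    using \<kappa>(1) that by (auto simp: admissible_def)
  obtain C \<rho> \<theta> \<tau>1 \<tau>2 l1 l2 where c: "C > 0"
    "\<And>\<tau>. \<tau> \<in> log_sector \<theta> (exterior_angle g N t j) C \<rho> \<Longrightarrow> g (t j) + exp \<tau> \<notin> closure G"
    "\<forall>\<^sub>F s in at_right 0. g (t j) + exp (\<tau>1 s) = arc_ext (outgoing j) (of_real (t (outgoing j)) + of_real s * Complex 1 (- \<kappa>'))"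
    "\<forall>\<^sub>F s in at_right 0. g (t j) + exp (\<tau>2 s) = arc_ext (j - 1) (of_real (t j) - of_real s * Complex 1 \<kappa>')"
    "((\<lambda>s. \<tau>1 s - of_real (ln s)) \<longlongrightarrow> l1) (at_right 0)" "((\<lambda>s. \<tau>2 s - of_real (ln s)) \<longlongrightarrow> l2) (at_right 0)"
    "\<bar>Im l1 - \<theta>\<bar> < exterior_angle g N t j * pi / 2" "\<bar>Im l2 - \<theta>\<bar> < exterior_angle g N t j * pi / 2"
    by (rule corner_rays[OF j \<kappa>(2,3) kj off], assumption, assumption, rule that)
  obtain M where M: "\<And>z. z \<notin> closure G \<Longrightarrow> cmod z \<le> cmod (g (t j)) + exp \<rho> \<Longrightarrow> cmod (\<Phi> z) \<le> M"
    by (rule exterior_map_bounded[OF E L, of "cmod (g (t j)) + exp \<rho>"], rule that)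
  obtain r where r: "r > 0" "ball z0 r \<subseteq> G" using open_G z0 open_contains_ball by blast
  have "((\<lambda>s. P (g (t j) + exp (\<tau>2 s)) - P (g (t j) + exp (\<tau>1 s))) \<longlongrightarrow> 0) (at_right 0)"
  proof (rule primitive_corner_jump[where C = C and \<theta> = \<theta> and \<omega> = "exterior_angle g N t j" and \<rho> = \<rho> and p = "g (t j)"
        and P' = "\<lambda>z. \<Phi> z ^ n + \<beta> / (z - z0)" and B = "M ^ n + cmod \<beta> / r", OF _ _ _ c(6,8) c(5,7)])
    fix \<tau> assume \<tau>: "\<tau> \<in> log_sector \<theta> (exterior_angle g N t j) C \<rho>"
    let ?z = "g (t j) + exp \<tau>"
    have z: "?z \<notin> closure G" by (rule c(2)[OF \<tau>])
    show "(P has_field_derivative \<Phi> ?z ^ n + \<beta> / (?z - z0)) (at ?z)" by (rule P[OF z])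
    have "cmod ?z \<le> cmod (g (t j)) + exp \<rho>"
      using \<tau> by (intro order_trans[OF norm_triangle_ineq]) (simp add: log_sector_def norm_exp_eq_Re)
    then have "cmod (\<Phi> ?z) \<le> M" by (rule M[OF z])
    then have "cmod (\<Phi> ?z) ^ n \<le> M ^ n" by (intro power_mono) auto
    moreover have "?z \<notin> ball z0 r" using z r closure_subset by blast
    then have "r \<le> cmod (?z - z0)" by (simp add: dist_norm norm_minus_commute)
    then have "cmod \<beta> / cmod (?z - z0) \<le> cmod \<beta> / r"
      using r(1) by (intro divide_left_mono mult_pos_pos less_le_trans[OF r(1)]) auto
    ultimately show "cmod (\<Phi> ?z ^ n + \<beta> / (?z - z0)) \<le> M ^ n + cmod \<beta> / r"
      by (intro order_trans[OF norm_triangle_ineq] add_mono) (auto simp: norm_power norm_divide)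
  qed (use c(1) in auto)
  then show ?thesis
    by (rule Lim_transform_eventually) (use c(3,4) in \<open>eventually_elim, simp\<close>)
qed

text \<open>The sum \<open>S \<epsilon>\<close> of all arc discrepancies has a limit of modulus
  \<open>2 * pi * n * cmod (b n)\<close>, because the increments of \<open>P\<close> cancel at the
  corners and the logarithmic integrals add up to one full turn. Each discrepancy is of order
  \<open>1 / n powr \<omega>0\<close>, and division by \<open>n\<close> gives the remaining
  power.\<close>

lemma coefficient_bound:
  assumes E: "exterior_map G \<Phi> \<gamma>"
    and L: "laurent_at_infinity (inv_into (- closure G) \<Phi>) (complex_of_real (1 / \<gamma>)) b 1"
    and \<omega>0: "0 < \<omega>0" "\<And>j. j \<in> {1..N} \<Longrightarrow> \<omega>0 \<le> exterior_angle g N t j"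
  obtains C where "\<And>n. n \<ge> 1 \<Longrightarrow> cmod (b n) \<le> C * (1 / real n powr (1 + \<omega>0))"
proof -
  obtain z0 where z0: "z0 \<in> G" using jordan by (auto simp: jordan_domain_def)
  obtain \<kappa> where \<kappa>: "admissible \<kappa>" by (rule admissible_exists)
  have k: "0 < \<kappa> / 4" "\<kappa> / 4 < \<kappa>" using \<kappa> by (auto simp: admissible_def)
  define pe where "pe i \<epsilon> = arc_ext i (of_real (t (Suc i)) - of_real \<epsilon> * Complex 1 (\<kappa> / 4))" for i and \<epsilon> :: real
  define ps where "ps i \<epsilon> = arc_ext i (of_real (t i) + of_real \<epsilon> * Complex 1 (- (\<kappa> / 4)))" for i and \<epsilon> :: real
  define J where "J i \<epsilon> = log_integral z0 i (t (Suc i) - \<epsilon>) - log_integral z0 i (t i + \<epsilon>)" for i and \<epsilon> :: real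
  have "\<forall>i\<in>{..<N}. \<exists>C. \<forall>n P \<beta>. n \<ge> 1 \<longrightarrow> (\<forall>z. z \<notin> closure G \<longrightarrow> (P has_field_derivative \<Phi> z ^ n + \<beta> / (z - z0)) (at z)) \<longrightarrow>
    (\<exists>X. \<forall>\<epsilon>. 0 < \<epsilon> \<longrightarrow> \<epsilon> < half_length i \<longrightarrow>
      cmod (P (pe i \<epsilon>) - P (ps i \<epsilon>) - \<beta> * J i \<epsilon>) \<le> C / real n powr \<omega>0 + \<epsilon> * X)"
  proof
    fix i assume "i \<in> {..<N}"
    then have i: "i < N" by simp
    show "\<exists>C. \<forall>n P \<beta>. n \<ge> 1 \<longrightarrow> (\<forall>z. z \<notin> closure G \<longrightarrow> (P has_field_derivative \<Phi> z ^ n + \<beta> / (z - z0)) (at z)) \<longrightarrow>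
    (\<exists>X. \<forall>\<epsilon>. 0 < \<epsilon> \<longrightarrow> \<epsilon> < half_length i \<longrightarrow>
      cmod (P (pe i \<epsilon>) - P (ps i \<epsilon>) - \<beta> * J i \<epsilon>) \<le> C / real n powr \<omega>0 + \<epsilon> * X)"
    proof (rule arc_contribution[OF E L \<kappa> i z0 \<omega>0, folded pe_def ps_def J_def], assumption)
      fix C
      assume C: "\<And>n P \<beta>. n \<ge> 1 \<Longrightarrow> (\<And>z. z \<notin> closure G \<Longrightarrow> (P has_field_derivative \<Phi> z ^ n + \<beta> / (z - z0)) (at z)) \<Longrightarrow>
        \<exists>X. \<forall>\<epsilon>. 0 < \<epsilon> \<longrightarrow> \<epsilon> < half_length i \<longrightarrow>
        cmod (P (pe i \<epsilon>) - P (ps i \<epsilon>) - \<beta> * J i \<epsilon>) \<le> C / real n powr \<omega>0 + \<epsilon> * X"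
      show ?thesis by (rule exI[of _ C], intro allI impI, rule C) auto
    qed
  qed
  then obtain C where C: "\<forall>i\<in>{..<N}. \<forall>n P \<beta>. n \<ge> 1 \<longrightarrow> (\<forall>z. z \<notin> closure G \<longrightarrow> (P has_field_derivative \<Phi> z ^ n + \<beta> / (z - z0)) (at z)) \<longrightarrow>
    (\<exists>X. \<forall>\<epsilon>. 0 < \<epsilon> \<longrightarrow> \<epsilon> < half_length i \<longrightarrow>
      cmod (P (pe i \<epsilon>) - P (ps i \<epsilon>) - \<beta> * J i \<epsilon>) \<le> C i / real n powr \<omega>0 + \<epsilon> * X)"
    unfolding bchoice_iff by (elim exE)
  show ?thesis
  proof (rule that[of "(\<Sum>i<N. C i) / (2 * pi)"])
    fix n :: nat assume n: "n \<ge> 1"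
    obtain P where P: "\<And>z. z \<notin> closure G \<Longrightarrow> (P has_field_derivative \<Phi> z ^ n + of_nat n * b n / (z - z0)) (at z)"
      by (rule exterior_power_primitive[OF E L _ n, of z0]) (use z0 closure_subset in \<open>auto intro: that\<close>)
    define \<beta> where "\<beta> = of_nat n * b n"
    note P = P[folded \<beta>_def]
    have "\<forall>i\<in>{..<N}. \<exists>X. \<forall>\<epsilon>. 0 < \<epsilon> \<longrightarrow> \<epsilon> < half_length i \<longrightarrow>
      cmod (P (pe i \<epsilon>) - P (ps i \<epsilon>) - \<beta> * J i \<epsilon>) \<le> C i / real n powr \<omega>0 + \<epsilon> * X"
      using C n P by blast
    then obtain X where X: "\<forall>i\<in>{..<N}. \<forall>\<epsilon>. 0 < \<epsilon> \<longrightarrow> \<epsilon> < half_length i \<longrightarrow>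
      cmod (P (pe i \<epsilon>) - P (ps i \<epsilon>) - \<beta> * J i \<epsilon>) \<le> C i / real n powr \<omega>0 + \<epsilon> * X i"
      unfolding bchoice_iff by (elim exE)
    define S where "S \<epsilon> = (\<Sum>i<N. P (pe i \<epsilon>) - P (ps i \<epsilon>) - \<beta> * J i \<epsilon>)" for \<epsilon>
    \<comment> \<open>Regrouping by corners: the end of arc \<open>j - 1\<close> is paired with the
      start of the arc that leaves the same corner.\<close>
    have jumps: "(\<Sum>i<N. P (pe i \<epsilon>) - P (ps i \<epsilon>)) = (\<Sum>j\<in>{1..N}. P (pe (j - 1) \<epsilon>) - P (ps (outgoing j) \<epsilon>))" for \<epsilon>
    proof -
      have "(\<Sum>j\<in>{1..N}. P (pe (j - 1) \<epsilon>)) = (\<Sum>i<N. P (pe i \<epsilon>))"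
        by (rule sum.reindex_bij_witness[of _ Suc "\<lambda>j. j - 1"]) auto
      moreover have "(\<Sum>j\<in>{1..N}. P (ps (outgoing j) \<epsilon>)) = (\<Sum>i<N. P (ps i \<epsilon>))"
        by (rule sum.reindex_bij_witness[of _ incoming_corner outgoing])
           (use N in \<open>auto simp: incoming_corner_def outgoing_def split: if_splits\<close>)
      ultimately show ?thesis by (simp add: sum_subtractf)
    qed
    have jlim: "((\<lambda>\<epsilon>. \<Sum>i<N. P (pe i \<epsilon>) - P (ps i \<epsilon>)) \<longlongrightarrow> 0) (at_right 0)"
    proof -
      have "((\<lambda>\<epsilon>. \<Sum>j\<in>{1..N}. P (pe (j - 1) \<epsilon>) - P (ps (outgoing j) \<epsilon>)) \<longlongrightarrow> (\<Sum>j\<in>{1..N}. 0)) (at_right 0)"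
      proof (rule tendsto_sum)
        fix j assume j: "j \<in> {1..N}"
        then have "Suc (j - 1) = j" by auto
        then show "((\<lambda>\<epsilon>. P (pe (j - 1) \<epsilon>) - P (ps (outgoing j) \<epsilon>)) \<longlongrightarrow> 0) (at_right 0)"
          using corner_contribution[OF E L \<kappa> k j z0 P] by (simp add: pe_def ps_def)
      qed
      then show ?thesis by (simp add: jumps)
    qed
    have Jlim: "((\<lambda>\<epsilon>. \<Sum>i<N. J i \<epsilon>) \<longlongrightarrow> 2 * of_real pi * \<i>) (at_right 0)"
    proof -
      have "((\<lambda>\<epsilon>. \<Sum>i<N. J i \<epsilon>) \<longlongrightarrow> (\<Sum>i<N. log_integral z0 i (t (Suc i)) - log_integral z0 i (t i))) (at_right 0)"
      proof (rule tendsto_sum)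
        fix i assume "i \<in> {..<N}"
        then have i: "i < N" by simp
        have le: "t i < t (Suc i)" by (rule t_Suc[OF i])
        note cont = log_integral_derivative(2)[OF i z0]
        have "(log_integral z0 i \<longlongrightarrow> log_integral z0 i (t (Suc i))) (at (t (Suc i)) within {t i..t (Suc i)})"
          using cont le by (auto simp: continuous_on_def)
        then have 1: "(log_integral z0 i \<longlongrightarrow> log_integral z0 i (t (Suc i))) (at_left (t (Suc i)))"
          by (simp add: at_within_Icc_at_left[OF le])
        have "(log_integral z0 i \<longlongrightarrow> log_integral z0 i (t i)) (at (t i) within {t i..t (Suc i)})"
          using cont le by (auto simp: continuous_on_def)
        then have 2: "(log_integral z0 i \<longlongrightarrow> log_integral z0 i (t i)) (at_right (t i))"
          by (simp add: at_within_Icc_at_right[OF le])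
        have 3: "filterlim (\<lambda>\<epsilon>. t (Suc i) - \<epsilon>) (at_left (t (Suc i))) (at_right 0)"
          unfolding filterlim_at
          using eventually_at_right_less[of "0::real"] by (auto intro!: tendsto_eq_intros elim!: eventually_mono)
        have 4: "filterlim (\<lambda>\<epsilon>. t i + \<epsilon>) (at_right (t i)) (at_right 0)"
          unfolding filterlim_at
          using eventually_at_right_less[of "0::real"] by (auto intro!: tendsto_eq_intros elim!: eventually_mono)
        show "(J i \<longlongrightarrow> log_integral z0 i (t (Suc i)) - log_integral z0 i (t i)) (at_right 0)"
          unfolding J_def by (intro tendsto_diff filterlim_compose[OF 1 3] filterlim_compose[OF 2 4])
      qed
      then show ?thesis by (simp add: log_integral_total[OF z0])
    qed
    have "((\<lambda>\<epsilon>. (\<Sum>i<N. P (pe i \<epsilon>) - P (ps i \<epsilon>)) - \<beta> * (\<Sum>i<N. J i \<epsilon>)) \<longlongrightarrow> 0 - \<beta> * (2 * of_real pi * \<i>)) (at_right 0)"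
      by (intro tendsto_diff tendsto_mult tendsto_const jlim Jlim)
    then have Slim: "((\<lambda>\<epsilon>. cmod (S \<epsilon>)) \<longlongrightarrow> cmod (0 - \<beta> * (2 * of_real pi * \<i>))) (at_right 0)"
      by (intro tendsto_norm) (simp add: S_def sum_subtractf sum_distrib_left)
    have Blim: "((\<lambda>\<epsilon>. \<Sum>i<N. C i / real n powr \<omega>0 + \<epsilon> * X i) \<longlongrightarrow> (\<Sum>i<N. C i / real n powr \<omega>0 + 0 * X i)) (at_right 0)"
      by (intro tendsto_sum tendsto_add tendsto_mult tendsto_const tendsto_ident_at)
    have "\<forall>\<^sub>F \<epsilon> in at_right 0. \<forall>i\<in>{..<N}. \<epsilon> < half_length i"
      by (intro eventually_ball_finite ballI order_tendstoD[OF tendsto_ident_at]) (use half_length in auto)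
    then have "\<forall>\<^sub>F \<epsilon> in at_right 0. cmod (S \<epsilon>) \<le> (\<Sum>i<N. C i / real n powr \<omega>0 + \<epsilon> * X i)"
      using eventually_at_right_less[of "0::real"]
    proof eventually_elim
      case (elim \<epsilon>)
      show ?case unfolding S_def by (rule sum_norm_le) (use X elim in auto)
    qed
    \<comment> \<open>With \<open>n\<close> fixed, \<open>\<epsilon>\<close> tends to 0 and the
      terms containing \<open>X\<close> vanish, although \<open>X\<close> depends on
      \<open>n\<close>.\<close>
    then have "cmod (0 - \<beta> * (2 * of_real pi * \<i>)) \<le> (\<Sum>i<N. C i / real n powr \<omega>0 + 0 * X i)"
      by (rule tendsto_le[OF trivial_limit_at_right_real Blim Slim])
    then have "real n * cmod (b n) * (2 * pi) \<le> (\<Sum>i<N. C i) / real n powr \<omega>0"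
      by (simp add: \<beta>_def norm_mult sum_divide_distrib mult_ac)
    moreover have "real n powr (1 + \<omega>0) = real n * real n powr \<omega>0" using n by (simp add: powr_add)
    ultimately show "cmod (b n) \<le> (\<Sum>i<N. C i) / (2 * pi) * (1 / real n powr (1 + \<omega>0))"
      using n by (simp add: field_simps)
  qed
qed

end

text \<open>If no coefficient sequence exists, the claim is vacuous. Otherwise one sequence provides
  the constant, and by \<open>inverse_map_coeffs_unique\<close> it is the only one, so the constant
  depends on the curve alone.\<close>

lemma exterior_coefficient_bound:
  assumes G: "jordan_domain G" and \<omega>: "has_smallest_exterior_angle G \<omega>"
  shows "\<exists>c1::real. \<forall>b. inverse_map_coeffs G b \<longrightarrow> (\<forall>n\<ge>1. cmod (b n) \<le> c1 * (1 / real n powr (1 + \<omega>)))"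
proof (cases "\<exists>b. inverse_map_coeffs G b")
  case True
  then obtain b where b: "inverse_map_coeffs G b" by blast
  then obtain \<Phi> \<gamma> where E: "exterior_map G \<Phi> \<gamma>"
    and L: "laurent_at_infinity (inv_into (- closure G) \<Phi>) (complex_of_real (1 / \<gamma>)) b 1"
    by (auto simp: inverse_map_coeffs_def)
  obtain g N t where pa: "piecewise_analytic_without_cusps G g N t" and \<omega>: "\<omega> = Min (exterior_angle g N t ` {1..N})"
    using \<omega> by (auto simp: has_smallest_exterior_angle_def)
  interpret analytic_boundary G g N t
    by unfold_locales (use G pa connected_exterior[OF E] in auto)
  have fin: "finite (exterior_angle g N t ` {1..N})" "exterior_angle g N t ` {1..N} \<noteq> {}" using N by auto
  have "0 < \<omega>" using angle fin by (simp add: \<omega>)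
  moreover have "\<omega> \<le> exterior_angle g N t j" if "j \<in> {1..N}" for j using fin that by (simp add: \<omega>)
  ultimately obtain C where "\<And>n. n \<ge> 1 \<Longrightarrow> cmod (b n) \<le> C * (1 / real n powr (1 + \<omega>))"
    using coefficient_bound[OF E L] by metis
  then show ?thesis using inverse_map_coeffs_unique[OF b] by blast
qed auto

theorem theorem7p5:
  shows "(\<forall>G \<omega>. jordan_domain G \<and> has_smallest_exterior_angle G \<omega> \<longrightarrow>
            (\<exists>c1::real. \<forall>b. inverse_map_coeffs G b \<longrightarrow>
               (\<forall>n\<ge>1. cmod (b n) \<le> c1 * (1 / real n powr (1 + \<omega>)))))
       \<and> (\<exists>\<omega>::real. 0 < \<omega> \<and> \<omega> < 2 \<and>
            (\<exists>G b. jordan_domain G \<and> has_smallest_exterior_angle G \<omega> \<and> inverse_map_coeffs G b \<and>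
               (\<exists>c2::real. c2 > 0 \<and>
                  infinite {n. n \<ge> 1 \<and> cmod (b n) \<ge> c2 * (1 / real n powr (1 + \<omega>))})))"
  by (intro conjI sharpness_example allI impI exterior_coefficient_bound) simp_all

end
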